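(* There is an absolute constant $C>0$ such that the following holds for every $\sigma>0$. Let $I$ be the Fourier multiplier operator with symbol $m(\xi)=\frac12(e^{\sigma\xi}+e^{-\sigma\xi})$. Let $u_0$ be real-valued with $Iu_0\in H^1(\mathbb{R})$, and let $u$ with $Iu\in C([0,\delta];H^1(\mathbb{R}))$ be the local solution (described in the context) of the BBM equation $$u_t-u_{txx}+u_x+uu_x=0,\qquad u(0,x)=u_0(x),\qquad x\in\mathbb{R}.$$ Then $$\sup_{t\in[0,\delta]}\|Iu(t)\|_{H^1}^2\le\|Iu_0\|_{H^1}^2+C\,\delta\,\sigma^{\frac32}\,\|Iu_0\|_{H^1}^3 .$$
   Context: $\widehat f(\xi)=\int_{\mathbb{R}}e^{-ix\xi}f(x)\,dx$ and $Iu=\mathcal{F}^{-1}(m(\xi)\widehat u(\xi))$. Here $\|f\|_{H^1}^2=\int_{\mathbb{R}}(f^2+f_x^2)\,dx$. The equation is understood in the equivalent form $u_t+\varphi(D)u+\frac12\varphi(D)(u^2)=0$, $u(0)=u_0$, where $\varphi(D)=\partial_x(1-\partial_x^2)^{-1}$ is the Fourier multiplier with symbol $i\xi/(1+\xi^2)$; equivalently $u(t)=e^{-t\varphi(D)}u_0-\frac12\int_0^te^{-(t-\tau)\varphi(D)}\varphi(D)(u^2)(\tau)\,d\tau$. Local solution: for each $u_0$ with $Iu_0\in H^1(\mathbb{R})$ there is a unique solution on a time interval $[0,\delta]$ with $Iu\in C([0,\delta];H^1(\mathbb{R}))$ and $\sup_{t\in[0,\delta]}\|Iu(t)\|_{H^1}\le2\|Iu_0\|_{H^1}$,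 where $\delta>0$ is comparable to $\|Iu_0\|_{H^1}^{-1}$ up to absolute constants (for $u_0=0$ the solution is $u=0$ and $\delta>0$ is arbitrary). This is the solution and the $\delta$ meant in the claim. *)

theory Defs
  imports "HOL-Analysis.Analysis"
begin

text \<open>
  Elements of function spaces are represented by Borel measurable functions; equality of such
  elements is equality almost everywhere.
\<close>

definition L2 :: "(real \<Rightarrow> complex) \<Rightarrow> bool" where
  "L2 f \<longleftrightarrow> f \<in> borel_measurable lborel \<and> integrable lborel (\<lambda>x. (cmod (f x))\<^sup>2)"

definition L2_norm :: "(real \<Rightarrow> complex) \<Rightarrow> real" where
  "L2_norm f = sqrt (LINT x|lborel. (cmod (f x))\<^sup>2)"

definition truncated_fourier :: "real \<Rightarrow> (real \<Rightarrow> complex) \<Rightarrow> real \<Rightarrow> complex" where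
  "truncated_fourier R f \<xi> = (LINT x:{-R..R}|lborel. exp (- (\<i> * of_real (x * \<xi>))) * f x)"

text \<open>
  The Fourier integral need not converge for \<open>f\<close> in \<open>L\<^sup>2\<close>, so the transform is the
  \<open>L\<^sup>2\<close> limit of the truncated integrals. It is determined only almost everywhere, and
  \<open>fourier\<close> and \<open>inv_fourier\<close> pick some representative.
\<close>

definition has_fourier :: "(real \<Rightarrow> complex) \<Rightarrow> (real \<Rightarrow> complex) \<Rightarrow> bool" where
  "has_fourier f g \<longleftrightarrow> L2 f \<and> L2 g \<and>
     ((\<lambda>R. L2_norm (\<lambda>\<xi>. truncated_fourier R f \<xi> - g \<xi>)) \<longlongrightarrow> 0) at_top"

definition fourier :: "(real \<Rightarrow> complex) \<Rightarrow> real \<Rightarrow> complex" where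
  "fourier f = (SOME g. has_fourier f g)"

definition inv_fourier :: "(real \<Rightarrow> complex) \<Rightarrow> real \<Rightarrow> complex" where
  "inv_fourier g = (SOME f. has_fourier f g)"

definition multiplier :: "(real \<Rightarrow> complex) \<Rightarrow> (real \<Rightarrow> complex) \<Rightarrow> real \<Rightarrow> complex" where
  "multiplier m f = inv_fourier (\<lambda>\<xi>. m \<xi> * fourier f \<xi>)"

text \<open>The functions to which \<open>multiplier m\<close> may meaningfully be applied:\<close>

definition multiplier_dom :: "(real \<Rightarrow> complex) \<Rightarrow> (real \<Rightarrow> complex) \<Rightarrow> bool" where
  "multiplier_dom m f \<longleftrightarrow> L2 f \<and> L2 (\<lambda>\<xi>. m \<xi> * fourier f \<xi>)"

text \<open>
  The derivative in the Sobolev space is the weak one, tested against compactly supported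
  \<open>C\<^sup>1\<close> functions.
\<close>

definition test_function :: "(real \<Rightarrow> real) \<Rightarrow> bool" where
  "test_function \<psi> \<longleftrightarrow> \<psi> C1_differentiable_on UNIV \<and> compact (closure {x. \<psi> x \<noteq> 0})"

definition has_weak_deriv :: "(real \<Rightarrow> complex) \<Rightarrow> (real \<Rightarrow> complex) \<Rightarrow> bool" where
  "has_weak_deriv f g \<longleftrightarrow> (\<forall>\<psi>. test_function \<psi> \<longrightarrow>
     (LINT x|lborel. f x * of_real (deriv \<psi> x)) = - (LINT x|lborel. g x * of_real (\<psi> x)))"

definition H1 :: "(real \<Rightarrow> complex) \<Rightarrow> bool" where
  "H1 f \<longleftrightarrow> L2 f \<and> (\<exists>g. L2 g \<and> has_weak_deriv f g)"

definition weak_deriv :: "(real \<Rightarrow> complex) \<Rightarrow> real \<Rightarrow> complex" where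
  "weak_deriv f = (SOME g. L2 g \<and> has_weak_deriv f g)"

definition H1_norm :: "(real \<Rightarrow> complex) \<Rightarrow> real" where
  "H1_norm f = sqrt (LINT x|lborel. (cmod (f x))\<^sup>2 + (cmod (weak_deriv f x))\<^sup>2)"

definition I_symbol :: "real \<Rightarrow> real \<Rightarrow> complex" where
  "I_symbol \<sigma> \<xi> = of_real ((exp (\<sigma> * \<xi>) + exp (- (\<sigma> * \<xi>))) / 2)"

definition I_op :: "real \<Rightarrow> (real \<Rightarrow> real) \<Rightarrow> real \<Rightarrow> complex" where
  "I_op \<sigma> f = multiplier (I_symbol \<sigma>) (\<lambda>x. of_real (f x))"

text \<open>The assertion that \<open>I f\<close> is defined and lies in \<open>H\<^sup>1\<close>:\<close>

definition I_in_H1 :: "real \<Rightarrow> (real \<Rightarrow> real) \<Rightarrow> bool" where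
  "I_in_H1 \<sigma> f \<longleftrightarrow> multiplier_dom (I_symbol \<sigma>) (\<lambda>x. of_real (f x)) \<and> H1 (I_op \<sigma> f)"

definition I_continuous_H1 :: "real \<Rightarrow> real \<Rightarrow> (real \<Rightarrow> real \<Rightarrow> real) \<Rightarrow> bool" where
  "I_continuous_H1 \<sigma> \<delta> u \<longleftrightarrow>
     (\<forall>t\<in>{0..\<delta>}. I_in_H1 \<sigma> (u t) \<and>
        ((\<lambda>s. H1_norm (\<lambda>x. I_op \<sigma> (u s) x - I_op \<sigma> (u t) x)) \<longlongrightarrow> 0) (at t within {0..\<delta>}))"

definition phi_D :: "(real \<Rightarrow> real) \<Rightarrow> real \<Rightarrow> complex" where
  "phi_D f = multiplier (\<lambda>\<xi>. \<i> * of_real \<xi> / of_real (1 + \<xi>\<^sup>2)) (\<lambda>x. of_real (f x))"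

text \<open>
  The BBM equation in the form \<open>u\<^sub>t + \<phi>(D) u + 1/2 \<phi>(D)(u\<^sup>2) = 0\<close>, where \<open>u\<^sub>t\<close> is the
  derivative of the curve \<open>t \<mapsto> u(t)\<close> in \<open>L\<^sup>2\<close> (one-sided at the end points of the time interval).
\<close>

definition BBM_solution :: "(real \<Rightarrow> real) \<Rightarrow> real \<Rightarrow> (real \<Rightarrow> real \<Rightarrow> real) \<Rightarrow> bool" where
  "BBM_solution u0 \<delta> u \<longleftrightarrow>
     (AE x in lborel. u 0 x = u0 x) \<and>
     (\<forall>t\<in>{0..\<delta>}.
        ((\<lambda>s. L2_norm (\<lambda>x. of_real ((u s x - u t x) / (s - t))
             + phi_D (u t) x + 1/2 * phi_D (\<lambda>y. (u t y)\<^sup>2) x)) \<longlongrightarrow> 0) (at t within {0..\<delta>}))"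

text \<open>
  The local solution and its time of existence. The last conjunct says that \<open>\<delta>\<close> is comparable,
  with constants \<open>c1\<close> and \<open>c2\<close>, to the inverse of the norm of \<open>I u0\<close>; if that norm vanishes,
  then \<open>\<delta>\<close> is arbitrary and the bound on the norm forces \<open>u = 0\<close>.
\<close>

definition local_solution ::
  "real \<Rightarrow> real \<Rightarrow> real \<Rightarrow> (real \<Rightarrow> real) \<Rightarrow> real \<Rightarrow> (real \<Rightarrow> real \<Rightarrow> real) \<Rightarrow> bool" where
  "local_solution c1 c2 \<sigma> u0 \<delta> u \<longleftrightarrow>
     \<delta> > 0 \<and>
     I_continuous_H1 \<sigma> \<delta> u \<and>
     BBM_solution u0 \<delta> u \<and>
     (\<forall>t\<in>{0..\<delta>}. H1_norm (I_op \<sigma> (u t)) \<le> 2 * H1_norm (I_op \<sigma> u0)) \<and>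
     (H1_norm (I_op \<sigma> u0) \<noteq> 0 \<longrightarrow>
        c1 / H1_norm (I_op \<sigma> u0) \<le> \<delta> \<and> \<delta> \<le> c2 / H1_norm (I_op \<sigma> u0))"

end

theory Submission
  imports Defs "HOL-Probability.Characteristic_Functions" "HOL-Probability.Sinc_Integral"
begin

text \<open>
  With \<open>w = I u\<close> the equation gives \<open>d/dt \<parallel>w\<parallel>\<^sup>2 = \<integral> w\<^sub>x I(u\<^sup>2) dx\<close>, where \<open>\<parallel>\<cdot>\<parallel>\<close> is the
  \<open>H\<^sup>1\<close> norm. Since \<open>\<integral> w\<^sub>x w\<^sup>2 dx = 0\<close>, only \<open>I(u\<^sup>2) - (I u)\<^sup>2\<close> matters, and by
  \<open>cosh (a + b) - cosh a cosh b = sinh a sinh b\<close> it equals \<open>v\<^sup>2\<close>, where \<open>v\<close> has the Fourier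
  transform \<open>tanh (\<sigma>\<xi>)\<close> times that of \<open>w\<close>. From \<open>\<bar>tanh s\<bar> \<le> min 1 \<bar>s\<bar>\<close> one gets
  \<open>\<parallel>v\<parallel>\<^sub>2 \<lesssim> \<sigma> \<parallel>w\<parallel>\<close> and \<open>\<parallel>v\<parallel>\<^sub>\<infinity> \<lesssim> \<sigma>\<^sup>1\<^sup>/\<^sup>2 \<parallel>w\<parallel>\<close>, hence \<open>\<integral> w\<^sub>x v\<^sup>2 dx\<close> is
  \<open>O(\<sigma>\<^sup>3\<^sup>/\<^sup>2 \<parallel>w\<parallel>\<^sup>3)\<close>. As \<open>u\<close> is only differentiable in \<open>L\<^sup>2\<close>, the energy is first cut off at
  frequency \<open>N\<close>; the error is uniform in time because the orbit of \<open>w\<close> is compact in \<open>H\<^sup>1\<close>.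
\<close>

section \<open>Square-integrable functions\<close>

text \<open>The estimate is run on the Fourier side: \<open>v\<close> itself is never formed, only
  its transform \<open>Shat\<close>, and the sup norm of \<open>v\<close> enters as the L^1 norm of
  that transform. The half power of \<open>\<sigma>\<close> is scaling: Cauchy-Schwarz pairs
  \<open>\<xi> * Ihat\<close> with \<open>tanh (\<sigma> * \<xi>) / \<xi>\<close>, whose L^2 norm is
  a multiple of \<open>sqrt \<sigma>\<close>. The transform in the statement is an arbitrarily
  chosen L^2 limit, so formulas for it hold only almost everywhere. The arguments therefore use the
  relation \<open>has_fourier\<close> rather than the chosen functions; its laws (Plancherel,
  inversion, products) are insensitive to null sets. The H^1 norm likewise rests on an arbitrarily
  chosen weak derivative and becomes usable once the transform of that derivative is identified. The
  constant is explicit: the factors \<open>2 * pi\<close> from Parseval and from the convolution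
  cancel exactly against those lost in the estimates.\<close>

lemma L2_borel [measurable_dest]: "L2 f \<Longrightarrow> f \<in> borel_measurable borel"
  by (simp add: L2_def)

lemma L2_sq_integrable: "L2 f \<Longrightarrow> integrable lborel (\<lambda>x. (cmod (f x))\<^sup>2)"
  by (simp add: L2_def)

lemma L2_norm_nonneg [simp]: "0 \<le> L2_norm f"
  by (simp add: L2_norm_def)

lemma L2_norm_power2: "(L2_norm f)\<^sup>2 = (LINT x|lborel. (cmod (f x))\<^sup>2)"
  by (simp add: L2_norm_def)

lemma L2_dominated:
  assumes g: "g \<in> borel_measurable borel" and f: "L2 f" and le: "\<And>x. cmod (g x) \<le> c * cmod (f x)"
  shows "L2 g"
proof -
  have "integrable lborel (\<lambda>x. c\<^sup>2 * (cmod (f x))\<^sup>2)"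
    using f by (simp add: L2_def)
  then have "integrable lborel (\<lambda>x. (cmod (g x))\<^sup>2)"
    by (rule Bochner_Integration.integrable_bound)
      (use g le power_mono[OF le norm_ge_zero, of _ 2] in \<open>auto simp: power_mult_distrib\<close>)
  then show ?thesis using g by (simp add: L2_def)
qed

lemma L2_norm_mono:
  assumes g: "L2 g" and f: "L2 f" and le: "AE x in lborel. cmod (g x) \<le> cmod (f x)"
  shows "L2_norm g \<le> L2_norm f"
  unfolding L2_norm_def
  by (intro real_sqrt_le_mono integral_mono_AE)
    (use g f le in \<open>auto simp: L2_def elim!: eventually_mono intro: power_mono\<close>)

lemma L2_norm_cong_AE:
  assumes "f \<in> borel_measurable borel" "g \<in> borel_measurable borel"
    and "AE x in lborel. cmod (f x) = cmod (g x)"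
  shows "L2_norm f = L2_norm g"
  unfolding L2_norm_def using assms
  by (intro arg_cong[where f=sqrt] integral_cong_AE) auto

lemma L2_cong_AE:
  assumes "L2 f" "g \<in> borel_measurable borel" "AE x in lborel. f x = g x"
  shows "L2 g"
proof -
  have "integrable lborel (\<lambda>x. (cmod (f x))\<^sup>2) \<longleftrightarrow> integrable lborel (\<lambda>x. (cmod (g x))\<^sup>2)"
    using assms by (intro Bochner_Integration.integrable_cong_AE) auto
  then show ?thesis using assms by (simp add: L2_def)
qed

lemma L2_zero [simp]: "L2 (\<lambda>x. 0)"
  by (simp add: L2_def)

lemma L2_norm_zero [simp]: "L2_norm (\<lambda>x. 0) = 0"
  by (simp add: L2_norm_def)

lemma L2_add: 
  assumes f: "L2 f" and g: "L2 g" shows "L2 (\<lambda>x. f x + g x)"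
proof -
  have [measurable]: "f \<in> borel_measurable borel" "g \<in> borel_measurable borel"
    using assms by (auto simp: L2_def)
  have "integrable lborel (\<lambda>x. 2 * (cmod (f x))\<^sup>2 + 2 * (cmod (g x))\<^sup>2)"
    using f g by (simp add: L2_def)
  then have "integrable lborel (\<lambda>x. (cmod (f x + g x))\<^sup>2)"
  proof (rule Bochner_Integration.integrable_bound)
    show "AE x in lborel. norm ((cmod (f x + g x))\<^sup>2) \<le> norm (2 * (cmod (f x))\<^sup>2 + 2 * (cmod
      (g x))\<^sup>2)"
    proof (rule AE_I2)
      fix x
      have "(cmod (f x + g x))\<^sup>2 \<le> (cmod (f x) + cmod (g x))\<^sup>2"
        by (intro power_mono norm_triangle_ineq) auto
      also have "\<dots> \<le> 2 * (cmod (f x))\<^sup>2 + 2 * (cmod (g x))\<^sup>2"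
        using sum_squares_bound[of "cmod (f x)" "cmod (g x)"] by (simp add: power2_sum)
      finally show "norm ((cmod (f x + g x))\<^sup>2) \<le> norm (2 * (cmod (f x))\<^sup>2 + 2 * (cmod (g x))\<^sup>2)"
        by simp
    qed
  qed simp
  then show ?thesis by (simp add: L2_def)
qed

lemma L2_cmult: "L2 f \<Longrightarrow> L2 (\<lambda>x. c * f x)"
  by (rule L2_dominated[where c="cmod c" and f=f]) (auto simp: norm_mult)

lemma L2_uminus: "L2 f \<Longrightarrow> L2 (\<lambda>x. - f x)"
  using L2_cmult[of f "-1"] by simp

lemma L2_diff: "L2 f \<Longrightarrow> L2 g \<Longrightarrow> L2 (\<lambda>x. f x - g x)"
  using L2_add[of f "\<lambda>x. - g x"] L2_uminus[of g] by simp

lemma borel_measurable_cnj [measurable]: "cnj \<in> borel_measurable borel"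
  by (intro borel_measurable_continuous_onI continuous_intros)

lemma L2_cnj: "L2 f \<Longrightarrow> L2 (\<lambda>x. cnj (f x))"
  by (rule L2_dominated[where c=1 and f=f]) auto

lemma L2_norm_cnj: "L2_norm (\<lambda>x. cnj (f x)) = L2_norm f"
  by (simp add: L2_norm_def)

lemma L2_norm_cmult: "L2_norm (\<lambda>x. c * f x) = cmod c * L2_norm f"
  by (simp add: L2_norm_def norm_mult power_mult_distrib real_sqrt_mult)

lemma L2_norm_minus_commute: "L2_norm (\<lambda>x. f x - g x) = L2_norm (\<lambda>x. g x - f x)"
  by (simp add: L2_norm_def norm_minus_commute)

lemma L2_mult_integrable:
  assumes f: "L2 f" and g: "L2 g"
  shows "integrable lborel (\<lambda>x. f x * g x)" and "integrable lborel (\<lambda>x. cmod (f x) * cmod (g x))"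
proof -
  have [measurable]: "f \<in> borel_measurable borel" "g \<in> borel_measurable borel"
    using assms by (auto simp: L2_def)
  have i: "integrable lborel (\<lambda>x. (cmod (f x))\<^sup>2 + (cmod (g x))\<^sup>2)"
    using f g by (simp add: L2_def)
  have le: "cmod (f x) * cmod (g x) \<le> (cmod (f x))\<^sup>2 + (cmod (g x))\<^sup>2" for x
  proof -
    have "2 * (cmod (f x) * cmod (g x)) \<le> (cmod (f x))\<^sup>2 + (cmod (g x))\<^sup>2"
      using sum_squares_bound[of "cmod (f x)" "cmod (g x)"] by simp
    moreover have "0 \<le> cmod (f x) * cmod (g x)" by simp
    ultimately show ?thesis by linarith
  qed
  show "integrable lborel (\<lambda>x. f x * g x)"
    by (rule Bochner_Integration.integrable_bound[OF i]) (auto simp: norm_mult le)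
  show "integrable lborel (\<lambda>x. cmod (f x) * cmod (g x))"
    by (rule Bochner_Integration.integrable_bound[OF i]) (auto simp: norm_mult le)
qed

lemma L2_Cauchy_Schwarz:
  assumes f: "L2 f" and g: "L2 g"
  shows "(LINT x|lborel. cmod (f x) * cmod (g x)) \<le> L2_norm f * L2_norm g"
proof -
  define F where "F = L2_norm f"
  define G where "G = L2_norm g"
  have FG: "0 \<le> F" "0 \<le> G" by (auto simp: F_def G_def)
  have *: "(LINT x|lborel. cmod (f x) * cmod (g x)) \<le> (F + e) * (G + e)" if "0 < e" for e
  proof -
    \<comment> \<open>This ratio balances the two terms of the weighted inequality of arithmetic and
      geometric means; \<open>e\<close> keeps it defined and positive when a norm vanishes, and is
      sent to 0 at the end.\<close>
    define r where "r = (G + e) / (F + e)"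
    have r: "0 < r" using that FG by (simp add: r_def)
    have "2 * (cmod (f x) * cmod (g x)) \<le> r * (cmod (f x))\<^sup>2 + inverse r * (cmod (g x))\<^sup>2" for x
    proof -
      have "0 \<le> (sqrt r * cmod (f x) - inverse (sqrt r) * cmod (g x))\<^sup>2" by simp
      also have "\<dots> = r * (cmod (f x))\<^sup>2 + inverse r * (cmod (g x))\<^sup>2 - 2 * (cmod (f x) * cmod
        (g x))"
        using r by (simp add: power2_diff power_mult_distrib power_inverse)
      finally show ?thesis by simp
    qed
    then have "(LINT x|lborel. 2 * (cmod (f x) * cmod (g x)))
      \<le> (LINT x|lborel. r * (cmod (f x))\<^sup>2 + inverse r * (cmod (g x))\<^sup>2)"
      using f g by (intro integral_mono) (auto simp: L2_def L2_mult_integrable)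
    also have "\<dots> = r * F\<^sup>2 + inverse r * G\<^sup>2"
      using f g by (simp add: L2_def L2_norm_power2 F_def G_def)
    also have "\<dots> \<le> r * (F + e)\<^sup>2 + inverse r * (G + e)\<^sup>2"
      using r FG that by (intro add_mono mult_left_mono power_mono) auto
    also have "\<dots> = 2 * ((F + e) * (G + e))"
    proof -
      have "F + e \<noteq> 0" "G + e \<noteq> 0" using that FG by auto
      then show ?thesis by (simp add: r_def power2_eq_square)
    qed
    finally show ?thesis by simp
  qed
  have "((\<lambda>e. (F + e) * (G + e)) \<longlongrightarrow> (F + 0) * (G + 0)) (at_right 0)"
    by (intro tendsto_intros)
  then have "(LINT x|lborel. cmod (f x) * cmod (g x)) \<le> (F + 0) * (G + 0)"
    by (rule tendsto_lowerbound) (auto simp: eventually_at_filter *)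
  then show ?thesis by (simp add: F_def G_def)
qed

lemma L2_inner_le:
  assumes f: "L2 f" and g: "L2 g"
  shows "cmod (LINT x|lborel. f x * g x) \<le> L2_norm f * L2_norm g"
proof -
  have "cmod (LINT x|lborel. f x * g x) \<le> (LINT x|lborel. cmod (f x * g x))"
    by (rule integral_norm_bound)
  then show ?thesis using L2_Cauchy_Schwarz[OF f g] by (simp add: norm_mult)
qed

lemma L2_norm_triangle:
  assumes f: "L2 f" and g: "L2 g"
  shows "L2_norm (\<lambda>x. f x + g x) \<le> L2_norm f + L2_norm g"
proof (rule power2_le_imp_le)
  have "(cmod (f x + g x))\<^sup>2 \<le> (cmod (f x))\<^sup>2 + (cmod (g x))\<^sup>2 + 2 * (cmod (f x) * cmod
    (g x))" for x
    using power_mono[OF norm_triangle_ineq[of "f x" "g x"], of 2] by (simp add: power2_sum)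
  then have "(L2_norm (\<lambda>x. f x + g x))\<^sup>2
    \<le> (LINT x|lborel. (cmod (f x))\<^sup>2 + (cmod (g x))\<^sup>2 + 2 * (cmod (f x) * cmod (g x)))"
    unfolding L2_norm_power2 using f g L2_add[OF f g]
    by (intro integral_mono) (auto simp: L2_def L2_mult_integrable)
  also have "\<dots> = (L2_norm f)\<^sup>2 + (L2_norm g)\<^sup>2 + 2 * (LINT x|lborel. cmod (f x) * cmod (g x))"
    using f g by (simp add: L2_norm_power2 L2_def L2_mult_integrable)
  also have "\<dots> \<le> (L2_norm f + L2_norm g)\<^sup>2"
    using L2_Cauchy_Schwarz[OF f g] by (simp add: power2_sum)
  finally show "(L2_norm (\<lambda>x. f x + g x))\<^sup>2 \<le> (L2_norm f + L2_norm g)\<^sup>2" .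
qed simp

lemma L2_norm_triangle_diff:
  assumes f: "L2 f" and g: "L2 g" and h: "L2 h"
  shows "L2_norm (\<lambda>x. f x - h x) \<le> L2_norm (\<lambda>x. f x - g x) + L2_norm (\<lambda>x. g x - h x)"
  using L2_norm_triangle[OF L2_diff[OF f g] L2_diff[OF g h]] by simp

lemma L2_norm_diff_ge:
  assumes f: "L2 f" and g: "L2 g"
  shows "\<bar>L2_norm f - L2_norm g\<bar> \<le> L2_norm (\<lambda>x. f x - g x)"
  using L2_norm_triangle[OF L2_diff[OF f g] g] L2_norm_triangle[OF L2_diff[OF g f] f]
  by (simp add: L2_norm_minus_commute[of f g])

lemma L2_norm_eq_0_AE:
  assumes f: "L2 f" and "L2_norm f = 0"
  shows "AE x in lborel. f x = 0"
proof -
  have "(LINT x|lborel. (cmod (f x))\<^sup>2) = 0" using assms(2) by (simp add: L2_norm_def)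
  then show ?thesis
    using integral_nonneg_eq_0_iff_AE[OF L2_sq_integrable[OF f]] by simp
qed

text \<open>Membership in L^2 is demanded at every index, not just eventually, which keeps the limit
  rules free of side conditions. Families that make sense only near the limit must then be
  extended.\<close>

definition L2_lim :: "('i \<Rightarrow> real \<Rightarrow> complex) \<Rightarrow> (real \<Rightarrow> complex) \<Rightarrow> 'i filter \<Rightarrow> bool" where
  "L2_lim f g F \<longleftrightarrow> (\<forall>n. L2 (f n)) \<and> L2 g \<and> ((\<lambda>n. L2_norm (\<lambda>x. f n x - g x)) \<longlongrightarrow> 0) F"

lemma L2_lim_norm: 
  assumes "L2_lim f g F" shows "((\<lambda>n. L2_norm (f n)) \<longlongrightarrow> L2_norm g) F"
proof -
  have "((\<lambda>n. L2_norm (f n) - L2_norm g) \<longlongrightarrow> 0) F"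
    by (rule Lim_null_comparison[where g="\<lambda>n. L2_norm (\<lambda>x. f n x - g x)"])
      (use assms L2_norm_diff_ge in \<open>auto simp: L2_lim_def\<close>)
  then show ?thesis by (simp add: LIM_zero_iff)
qed

lemma L2_lim_unique:
  assumes "L2_lim f g F" "L2_lim f h F" "F \<noteq> bot"
  shows "AE x in lborel. g x = h x"
proof -
  have L: "L2 g" "L2 h" "\<And>n. L2 (f n)" using assms by (auto simp: L2_lim_def)
  have "((\<lambda>n. L2_norm (\<lambda>x. f n x - g x) + L2_norm (\<lambda>x. f n x - h x)) \<longlongrightarrow> 0 + 0) F"
    using assms by (intro tendsto_add) (auto simp: L2_lim_def)
  then have "L2_norm (\<lambda>x. g x - h x) \<le> 0 + 0"
    by (rule tendsto_lowerbound)
      (use assms(3) L2_norm_triangle_diff[OF L(1) L(3) L(2)] in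
        \<open>simp_all add: L2_norm_minus_commute[of g "f _"]\<close>)
  then have "L2_norm (\<lambda>x. g x - h x) = 0"
    using L2_norm_nonneg[of "\<lambda>x. g x - h x"] by linarith
  from L2_norm_eq_0_AE[OF L2_diff[OF L(1,2)] this] show ?thesis by simp
qed

lemma L2_lim_add:
  assumes "L2_lim f g F" "L2_lim f' g' F"
  shows "L2_lim (\<lambda>n x. f n x + f' n x) (\<lambda>x. g x + g' x) F"
proof -
  have L: "L2 g" "L2 g'" "\<And>n. L2 (f n)" "\<And>n. L2 (f' n)" using assms by (auto simp: L2_lim_def)
  have "((\<lambda>n. L2_norm (\<lambda>x. f n x - g x) + L2_norm (\<lambda>x. f' n x - g' x)) \<longlongrightarrow> 0 + 0) F"
    using assms by (intro tendsto_add) (auto simp: L2_lim_def)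
  then have "((\<lambda>n. L2_norm (\<lambda>x. (f n x + f' n x) - (g x + g' x))) \<longlongrightarrow> 0) F"
    by (rule Lim_null_comparison[rotated, OF tendsto_eq_rhs])
      (use L2_norm_triangle[OF L2_diff[OF L(3) L(1)] L2_diff[OF L(4) L(2)]] in
        \<open>auto simp: algebra_simps\<close>)
  then show ?thesis using L by (auto simp: L2_lim_def L2_add)
qed

lemma L2_lim_cmult:
  assumes "L2_lim f g F" shows "L2_lim (\<lambda>n x. c * f n x) (\<lambda>x. c * g x) F"
proof -
  have "((\<lambda>n. cmod c * L2_norm (\<lambda>x. f n x - g x)) \<longlongrightarrow> cmod c * 0) F"
    using assms by (intro tendsto_intros) (auto simp: L2_lim_def)
  then show ?thesis using assms
    by (simp add: L2_lim_def L2_cmult L2_norm_cmult flip: right_diff_distrib)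
qed

lemma L2_lim_mult_bounded:
  assumes lim: "L2_lim f g F" and b[measurable]: "b \<in> borel_measurable borel" and B: "\<And>x. cmod
    (b x) \<le> B"
  shows "L2_lim (\<lambda>n x. b x * f n x) (\<lambda>x. b x * g x) F"
proof -
  have L: "L2 g" "\<And>n. L2 (f n)" using assms by (auto simp: L2_lim_def)
  have B0: "0 \<le> B" by (rule order_trans[OF norm_ge_zero B])
  have bL: "L2 (\<lambda>x. b x * h x)" if "L2 h" for h
    using that by (intro L2_dominated[OF _ that, where c=B])
      (auto simp: norm_mult B mult_right_mono L2_def)
  have "L2_norm (\<lambda>x. b x * f n x - b x * g x) \<le> B * L2_norm (\<lambda>x. f n x - g x)" for n
  proof -
    have "L2_norm (\<lambda>x. b x * (f n x - g x)) \<le> L2_norm (\<lambda>x. of_real B * (f n x - g x))"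
      using L B B0 by (intro L2_norm_mono bL L2_diff L2_cmult)
        (auto simp: norm_mult mult_right_mono)
    then show ?thesis using B0 by (simp only: L2_norm_cmult) (simp add: right_diff_distrib)
  qed
  moreover have "((\<lambda>n. B * L2_norm (\<lambda>x. f n x - g x)) \<longlongrightarrow> B * 0) F"
    using assms by (intro tendsto_intros) (auto simp: L2_lim_def)
  ultimately have "((\<lambda>n. L2_norm (\<lambda>x. b x * f n x - b x * g x)) \<longlongrightarrow> 0) F"
    using Lim_null_comparison[of "\<lambda>n. L2_norm (\<lambda>x. b x * f n x - b x * g x)"
        "\<lambda>n. B * L2_norm (\<lambda>x. f n x - g x)" F] by simp
  then show ?thesis using L bL by (auto simp: L2_lim_def)
qed

lemma L2_lim_cnj: "L2_lim f g F \<Longrightarrow> L2_lim (\<lambda>n x. cnj (f n x)) (\<lambda>x. cnj (g x)) F"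
  using L2_norm_cnj[of "\<lambda>x. f _ x - g x"] by (simp add: L2_lim_def L2_cnj)

lemma L2_lim_inner:
  assumes "L2_lim f g F" "L2_lim f' g' F"
  shows "((\<lambda>n. LINT x|lborel. f n x * f' n x) \<longlongrightarrow> (LINT x|lborel. g x * g' x)) F"
proof -
  have L: "L2 g" "L2 g'" "\<And>n. L2 (f n)" "\<And>n. L2 (f' n)" using assms by (auto simp: L2_lim_def)
  have e: "(LINT x|lborel. f n x * f' n x) - (LINT x|lborel. g x * g' x)
     = (LINT x|lborel. f n x * (f' n x - g' x)) + (LINT x|lborel. (f n x - g x) * g' x)" for n
    using L by (simp add: algebra_simps L2_mult_integrable)
  have "((\<lambda>n. L2_norm (f n) * L2_norm (\<lambda>x. f' n x - g' x) + L2_norm (\<lambda>x. f n x - g x) * L2_norm g')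
     \<longlongrightarrow> L2_norm g * 0 + 0 * L2_norm g') F"
    using assms L2_lim_norm[OF assms(1)] by (intro tendsto_intros) (auto simp: L2_lim_def)
  then have "((\<lambda>n. (LINT x|lborel. f n x * f' n x) - (LINT x|lborel. g x * g' x)) \<longlongrightarrow> 0) F"
  proof (rule Lim_null_comparison[rotated, OF tendsto_eq_rhs], goal_cases)
    case 2
    show ?case unfolding e
      by (intro always_eventually allI order_trans[OF norm_triangle_ineq] add_mono L2_inner_le L
        L2_diff)
  qed simp
  then show ?thesis by (simp add: LIM_zero_iff)
qed

lemma L2_lim_dominated:
  fixes f :: "nat \<Rightarrow> real \<Rightarrow> complex"
  assumes h: "L2 h" and m: "\<And>n. f n \<in> borel_measurable borel"
    and le: "\<And>n x. cmod (f n x) \<le> cmod (h x)"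
    and lim: "AE x in lborel. (\<lambda>n. f n x) \<longlonglongrightarrow> g x" and g: "g \<in> borel_measurable borel"
  shows "L2_lim f g sequentially"
proof -
  have fL: "L2 (f n)" for n
    using le by (intro L2_dominated[OF m h, of _ 1]) auto
  have gle: "AE x in lborel. cmod (g x) \<le> cmod (h x)"
    using lim
  proof eventually_elim
    case (elim x)
    then have "(\<lambda>n. cmod (f n x)) \<longlonglongrightarrow> cmod (g x)" by (rule tendsto_norm)
    then show ?case by (rule tendsto_upperbound) (auto simp: le)
  qed
  have "integrable lborel (\<lambda>x. (cmod (g x))\<^sup>2)"
    by (rule Bochner_Integration.integrable_bound[OF L2_sq_integrable[OF h]])
      (use gle g in \<open>auto elim!: eventually_mono intro: power_mono\<close>)
  then have gL: "L2 g" using g by (simp add: L2_def)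
  have "(\<lambda>n. LINT x|lborel. (cmod (f n x - g x))\<^sup>2) \<longlonglongrightarrow> (LINT x::real|lborel. 0)"
  proof (rule integral_dominated_convergence)
    show "integrable lborel (\<lambda>x. 4 * (cmod (h x))\<^sup>2)" using h by (simp add: L2_def)
    show "AE x in lborel. (\<lambda>n. (cmod (f n x - g x))\<^sup>2) \<longlonglongrightarrow> 0"
      using lim
    proof eventually_elim
      case (elim x)
      then have "(\<lambda>n. (cmod (f n x - g x))\<^sup>2) \<longlonglongrightarrow> (cmod (g x - g x))\<^sup>2"
        by (intro tendsto_intros)
      then show ?case by simp
    qed
    fix n
    show "AE x in lborel. norm ((cmod (f n x - g x))\<^sup>2) \<le> 4 * (cmod (h x))\<^sup>2"
      using gle
    proof eventually_elim
      case (elim x)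
      have "cmod (f n x - g x) \<le> 2 * cmod (h x)"
        using norm_triangle_ineq4[of "f n x" "g x"] le[of n x] elim by linarith
      then have "(cmod (f n x - g x))\<^sup>2 \<le> (2 * cmod (h x))\<^sup>2" by (rule power_mono) simp
      then show ?case by (simp add: power_mult_distrib)
    qed
  qed (use m g in auto)
  then have "(\<lambda>n. L2_norm (\<lambda>x. f n x - g x)) \<longlonglongrightarrow> sqrt 0"
    unfolding L2_norm_def by (intro tendsto_real_sqrt) simp
  then show ?thesis using fL gL by (simp add: L2_lim_def)
qed

text \<open>A limit along the reals is tested on all sequences tending to infinity, which brings it
  under dominated convergence for sequences.\<close>

lemma L2_lim_dominated_at_top:
  fixes f :: "real \<Rightarrow> real \<Rightarrow> complex"
  assumes h: "L2 h" and m: "\<And>n. f n \<in> borel_measurable borel"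
    and le: "\<And>n x. cmod (f n x) \<le> cmod (h x)"
    and lim: "AE x in lborel. ((\<lambda>n. f n x) \<longlongrightarrow> g x) at_top" and g: "g \<in> borel_measurable borel"
  shows "L2_lim f g at_top"
proof -
  have *: "L2_lim (\<lambda>n. f (X n)) g sequentially" if "filterlim X at_top sequentially" for X ::
    "nat \<Rightarrow> real"
    using that by (intro L2_lim_dominated[OF h m le _ g] eventually_mono[OF lim])
      (auto intro: filterlim_compose)
  have "((\<lambda>n. L2_norm (\<lambda>x. f n x - g x)) \<longlongrightarrow> 0) at_top"
    by (rule tendsto_at_topI_sequentially) (use * in \<open>auto simp: L2_lim_def\<close>)
  moreover have "L2 g" using *[OF filterlim_real_sequentially] by (simp add: L2_lim_def)
  moreover have "L2 (f n)" for n
    using le by (intro L2_dominated[OF m h, of _ 1]) auto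
  ultimately show ?thesis by (auto simp: L2_lim_def)
qed

text \<open>Serves where only a norm bound survives the limit: in Bessel's inequality, and in
  completeness, where it is applied to one index of a Cauchy sequence.\<close>

lemma L2_fatou:
  fixes f :: "nat \<Rightarrow> real \<Rightarrow> complex"
  assumes f: "\<And>n. L2 (f n)" and g[measurable]: "g \<in> borel_measurable borel"
    and lim: "AE x in lborel. (\<lambda>n. f n x) \<longlonglongrightarrow> g x" and B: "\<And>n. L2_norm (f n) \<le> B"
  shows "L2 g" and "L2_norm g \<le> B"
proof -
  have [measurable]: "f n \<in> borel_measurable borel" for n using f by (simp add: L2_def)
  have B0: "0 \<le> B" by (rule order_trans[OF L2_norm_nonneg B])
  have nn: "(\<integral>\<^sup>+x. ennreal ((cmod (f n x))\<^sup>2) \<partial>lborel) \<le> ennreal (B\<^sup>2)" for n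
  proof -
    have "(\<integral>\<^sup>+x. ennreal ((cmod (f n x))\<^sup>2) \<partial>lborel) = ennreal ((L2_norm (f n))\<^sup>2)"
      unfolding L2_norm_power2 using f by (intro nn_integral_eq_integral) (auto simp: L2_def)
    also have "\<dots> \<le> ennreal (B\<^sup>2)" by (intro ennreal_leI power_mono B) simp
    finally show ?thesis .
  qed
  have "(\<integral>\<^sup>+x. ennreal ((cmod (g x))\<^sup>2) \<partial>lborel) = (\<integral>\<^sup>+x. liminf (\<lambda>n. ennreal ((cmod
    (f n x))\<^sup>2)) \<partial>lborel)"
  proof (rule nn_integral_cong_AE, use lim in eventually_elim)
    case (elim x)
    then have "(\<lambda>n. ennreal ((cmod (f n x))\<^sup>2)) \<longlonglongrightarrow> ennreal ((cmod (g x))\<^sup>2)"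
      by (intro tendsto_intros)
    then show ?case by (rule lim_imp_Liminf[OF sequentially_bot, symmetric])
  qed
  also have "\<dots> \<le> liminf (\<lambda>n. \<integral>\<^sup>+x. ennreal ((cmod (f n x))\<^sup>2) \<partial>lborel)"
    by (intro nn_integral_liminf) simp
  also have "\<dots> \<le> liminf (\<lambda>n. ennreal (B\<^sup>2))"
    by (intro Liminf_mono always_eventually allI nn)
  also have "\<dots> = ennreal (B\<^sup>2)"
    by (simp add: Liminf_const)
  finally have le: "(\<integral>\<^sup>+x. ennreal ((cmod (g x))\<^sup>2) \<partial>lborel) \<le> ennreal (B\<^sup>2)" .
  have i: "integrable lborel (\<lambda>x. (cmod (g x))\<^sup>2)"
    by (rule integrableI_bounded) (use le in \<open>auto simp: le_less_trans\<close>)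
  then show "L2 g" by (simp add: L2_def)
  have "ennreal ((L2_norm g)\<^sup>2) \<le> ennreal (B\<^sup>2)"
    using le nn_integral_eq_integral[OF i] by (simp add: L2_norm_power2)
  then have "(L2_norm g)\<^sup>2 \<le> B\<^sup>2" by simp
  then show "L2_norm g \<le> B" using B0 by (rule power2_le_imp_le)
qed

text \<open>Riesz-Fischer: a rapidly converging subsequence converges almost everywhere, and Fatou
  upgrades the pointwise limit to a limit in norm.\<close>

lemma L2_complete:
  fixes f :: "nat \<Rightarrow> real \<Rightarrow> complex"
  assumes f: "\<And>n. L2 (f n)"
    and cauchy: "\<And>e. 0 < e \<Longrightarrow> \<exists>N. \<forall>m\<ge>N. \<forall>n\<ge>N. L2_norm (\<lambda>x. f m x - f n x) < e"
  shows "\<exists>g. L2_lim f g sequentially"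
proof -
  have [measurable]: "f n \<in> borel_measurable borel" for n using f by (simp add: L2_def)
  have "\<exists>N. \<forall>m\<ge>N. \<forall>n\<ge>N. L2_norm (\<lambda>x. f m x - f n x) < (1/2) ^ k" for k :: nat
    by (rule cauchy) simp
  then obtain N where N: "\<And>k m n. m \<ge> N k \<Longrightarrow> n \<ge> N k \<Longrightarrow> L2_norm (\<lambda>x. f m x - f n x) < (1/2) ^ k"
    by metis
  \<comment> \<open>The partial sums make \<open>r\<close> monotone although \<open>N\<close> need
    not be, and still put \<open>r k\<close> beyond \<open>N k\<close>.\<close>
  define r where "r k = k + (\<Sum>i\<le>k. N i)" for k
  have rN: "N k \<le> r k" for k
  proof -
    have "N k \<le> (\<Sum>i\<le>k. N i)" by (rule member_le_sum) auto
    then show ?thesis by (simp add: r_def)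
  qed
  have rinc: "r k \<le> r (Suc k)" for k by (simp add: r_def)
  have rk: "k \<le> r k" for k by (simp add: r_def)
  define D where "D k x = cmod (f (r (Suc k)) x - f (r k) x)" for k x
  \<comment> \<open>Successive distances are below \<open>(1/2) ^ k\<close>, so their squares stay
    summable in the mean even with the weight \<open>2 ^ k\<close>. By completing the square, that
    weight later turns summable squares into summable distances.\<close>
  have Dint: "(\<integral>\<^sup>+x. ennreal (2 ^ k * (D k x)\<^sup>2) \<partial>lborel) \<le> ennreal ((1/2) ^ k)" for k
  proof -
    have Lk: "L2 (\<lambda>x. f (r (Suc k)) x - f (r k) x)" by (intro L2_diff f)
    have "(\<integral>\<^sup>+x. ennreal (2 ^ k * (D k x)\<^sup>2) \<partial>lborel)
      = ennreal (2 ^ k * (L2_norm (\<lambda>x. f (r (Suc k)) x - f (r k) x))\<^sup>2)"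
      unfolding L2_norm_power2 D_def using Lk
      by (subst nn_integral_eq_integral) (auto simp: L2_def)
    also have "\<dots> \<le> ennreal (2 ^ k * ((1/2) ^ k)\<^sup>2)"
      using N[of k "r (Suc k)" "r k"] rN[of k] rinc[of k]
      by (intro ennreal_leI mult_left_mono power_mono) auto
    also have "2 ^ k * ((1/2) ^ k)\<^sup>2 = ((1/2) ^ k :: real)"
      by (simp add: power2_eq_square flip: power_mult_distrib mult.assoc)
    finally show ?thesis .
  qed
  have "(\<integral>\<^sup>+x. (\<Sum>k. ennreal (2 ^ k * (D k x)\<^sup>2)) \<partial>lborel) = (\<Sum>k. \<integral>\<^sup>+x. ennreal (2 ^ k *
    (D k x)\<^sup>2) \<partial>lborel)"
    unfolding D_def by (intro nn_integral_suminf) simp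
  also have "\<dots> \<le> (\<Sum>k. ennreal ((1/2) ^ k))"
    by (intro suminf_le Dint) auto
  also have "\<dots> = ennreal (\<Sum>k. (1/2) ^ k)"
    by (intro suminf_ennreal2) (auto intro: summable_geometric)
  finally have "(\<integral>\<^sup>+x. (\<Sum>k. ennreal (2 ^ k * (D k x)\<^sup>2)) \<partial>lborel) \<noteq> \<infinity>"
    by (auto simp: top_unique)
  then have "AE x in lborel. (\<Sum>k. ennreal (2 ^ k * (D k x)\<^sup>2)) \<noteq> \<infinity>"
    unfolding D_def by - (rule nn_integral_noteq_infinite, simp_all)
  then have conv: "AE x in lborel. convergent (\<lambda>k. f (r k) x)"
  proof eventually_elim
    case (elim x)
    have "summable (\<lambda>k. 2 ^ k * (D k x)\<^sup>2)"
      using elim by (intro summable_suminf_not_top) auto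
    then have s: "summable (\<lambda>k. 2 ^ k * (D k x)\<^sup>2 + (1/2) ^ k)"
      by (intro summable_add summable_geometric) auto
    have "D k x \<le> 2 ^ k * (D k x)\<^sup>2 + (1/2) ^ k" for k
    proof -
      have "0 \<le> 2 ^ k * (D k x - (1/2) ^ k)\<^sup>2" by simp
      also have "\<dots> = 2 ^ k * (D k x)\<^sup>2 - 2 * D k x * (2 ^ k * (1/2) ^ k) + (2 ^ k * (1/2) ^ k) *
        (1/2) ^ k"
        by (simp add: power2_eq_square algebra_simps)
      also have "(2 ^ k * (1/2) ^ k :: real) = 1" by (simp flip: power_mult_distrib)
      finally have "2 * D k x \<le> 2 ^ k * (D k x)\<^sup>2 + (1/2) ^ k" by simp
      moreover have "0 \<le> D k x" by (simp add: D_def)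
      ultimately show ?thesis by linarith
    qed
    then have "summable (\<lambda>k. f (r (Suc k)) x - f (r k) x)"
      by - (rule summable_norm_cancel, rule summable_comparison_test'[OF s, of 0], simp add: D_def)
    then have "convergent (\<lambda>n. \<Sum>k<n. f (r (Suc k)) x - f (r k) x)"
      by (simp add: summable_iff_convergent)
    then have "convergent (\<lambda>n. (f (r n) x - f (r 0) x) + f (r 0) x)"
      by (intro convergent_add convergent_const) (simp add: sum_lessThan_telescope[of "\<lambda>k. f
        (r k) x"])
    then show ?case by simp
  qed
  define g where "g x = lim (\<lambda>k. f (r k) x)" for x
  have g[measurable]: "g \<in> borel_measurable borel"
    unfolding g_def by (intro borel_measurable_lim_metric) simp
  have lim: "AE x in lborel. (\<lambda>k. f (r k) x) \<longlonglongrightarrow> g x"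
    using conv by eventually_elim (simp add: g_def convergent_LIMSEQ_iff)
  \<comment> \<open>Fatou along the subsequence, with the first index held fixed, turns the Cauchy
    property into a distance to the pointwise limit.\<close>
  have *: "L2 (\<lambda>x. f n x - g x) \<and> L2_norm (\<lambda>x. f n x - g x) \<le> (1/2) ^ j" if n: "N j \<le> n" for n j
  proof -
    have lim': "AE x in lborel. (\<lambda>k. f n x - f (r (k + j)) x) \<longlonglongrightarrow> f n x - g x"
      using lim by eventually_elim (intro tendsto_intros LIMSEQ_ignore_initial_segment)
    have le: "L2_norm (\<lambda>x. f n x - f (r (k + j)) x) \<le> (1/2) ^ j" for k
    proof -
      have "N j \<le> r (k + j)"
        by (rule order_trans[OF rN[of j]]) (simp add: r_def sum_mono2 add_mono)
      then show ?thesis using N[OF n] by (auto intro: less_imp_le)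
    qed
    have m: "(\<lambda>x. f n x - g x) \<in> borel_measurable borel" by simp
    show ?thesis using L2_fatou[OF L2_diff[OF f f] m lim' le] by simp
  qed
  have "L2 (\<lambda>x. f (N 0) x - g x)" using * by blast
  from L2_diff[OF f[of "N 0"] this] have gL: "L2 g" by simp
  have "(\<lambda>n. L2_norm (\<lambda>x. f n x - g x)) \<longlonglongrightarrow> 0"
  proof (rule LIMSEQ_I)
    fix e :: real assume "0 < e"
    then obtain j where j: "(1/2) ^ j < e" using real_arch_pow_inv[of e "1/2"] by auto
    show "\<exists>no. \<forall>n\<ge>no. norm (L2_norm (\<lambda>x. f n x - g x) - 0) < e"
      using * j by (intro exI[of _ "N j"]) (auto intro: le_less_trans)
  qed
  then show ?thesis using f gL by (auto simp: L2_lim_def)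
qed

section \<open>The Fourier integral and Plancherel's identity\<close>

definition ft :: "(real \<Rightarrow> complex) \<Rightarrow> real \<Rightarrow> complex" where
  "ft f \<xi> = (LINT x|lborel. exp (- (\<i> * of_real (x * \<xi>))) * f x)"

lemma norm_exp_minus_i [simp]: "cmod (exp (- (\<i> * of_real t))) = 1"
  using norm_exp_i_times[of "-t"] by simp

lemma ft_integrand:
  assumes "integrable lborel f"
  shows "integrable lborel (\<lambda>x. exp (- (\<i> * of_real (x * \<xi>))) * f x)"
  by (rule Bochner_Integration.integrable_bound[OF assms])
    (use assms in \<open>auto simp: norm_mult simp del: of_real_mult\<close>)

lemma ft_bound: 
  assumes "integrable lborel f"
  shows "cmod (ft f \<xi>) \<le> (LINT x|lborel. cmod (f x))"
proof -
  have "cmod (ft f \<xi>) \<le> (LINT x|lborel. cmod (exp (- (\<i> * of_real (x * \<xi>))) * f x))"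
    unfolding ft_def by (rule integral_norm_bound)
  then show ?thesis by (simp add: norm_mult del: of_real_mult)
qed

lemma ft_measurable [measurable]:
  assumes [measurable]: "f \<in> borel_measurable borel"
  shows "ft f \<in> borel_measurable borel"
  unfolding ft_def by measurable

lemma ft_add: 
  "integrable lborel f \<Longrightarrow> integrable lborel g \<Longrightarrow> ft (\<lambda>x. f x + g x) \<xi> = ft f \<xi> + ft g \<xi>"
  unfolding ft_def by (simp add: distrib_left ft_integrand del: of_real_mult)

lemma ft_diff: 
  "integrable lborel f \<Longrightarrow> integrable lborel g \<Longrightarrow> ft (\<lambda>x. f x - g x) \<xi> = ft f \<xi> - ft g \<xi>"
  unfolding ft_def by (simp add: right_diff_distrib ft_integrand del: of_real_mult)

lemma ft_cnj: "cnj (ft f \<xi>) = ft (\<lambda>x. cnj (f (- x))) \<xi>"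
proof -
  have "ft (\<lambda>x. cnj (f (- x))) \<xi> = (LINT x|lborel. cnj (exp (- (\<i> * of_real (x * \<xi>))) * f x))"
    unfolding ft_def by (subst lborel_integral_real_affine[where c="-1" and t=0])
      (auto simp: exp_cnj)
  also have "\<dots> = cnj (ft f \<xi>)" unfolding ft_def by (rule Bochner_Integration.integral_cnj)
  finally show ?thesis by simp
qed

lemma ft_continuous:
  assumes "integrable lborel f"
  shows "isCont (ft f) \<xi>"
  unfolding continuous_at_sequentially comp_def
proof (intro allI impI)
  fix X assume X: "X \<longlonglongrightarrow> \<xi>"
  show "(\<lambda>n. ft f (X n)) \<longlonglongrightarrow> ft f \<xi>"
    unfolding ft_def
    by (rule integral_dominated_convergence[where w="\<lambda>x. cmod (f x)"])
      (use assms X in \<open>auto simp: norm_mult simp del: of_real_mult intro!: AE_I2 tendsto_intros\<close>)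
qed

text \<open>Fubini, since the kernel is symmetric in the two variables. This multiplication formula
  drives Plancherel's identity and, extended to L^2, inversion.\<close>

lemma ft_duality:
  assumes f: "integrable lborel f" and g: "integrable lborel g"
  shows "(LINT x|lborel. ft f x * g x) = (LINT x|lborel. f x * ft g x)"
proof -
  have [measurable]: "f \<in> borel_measurable borel" "g \<in> borel_measurable borel"
    using f g by auto
  let ?h = "\<lambda>x y. exp (- (\<i> * of_real (y * x))) * f y * g x"
  have int: "integrable (lborel \<Otimes>\<^sub>M lborel) (case_prod ?h)"
  proof (rule lborel_pair.Fubini_integrable)
    show "integrable lborel (\<lambda>x. LINT y|lborel. norm (case (x, y) of (x, y) \<Rightarrow> ?h x y))"
      using f g by (simp add: norm_mult del: of_real_mult)
    show "AE x in lborel. integrable lborel (\<lambda>y. case (x, y) of (x, y) \<Rightarrow> ?h x y)"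
      using ft_integrand[OF f] by (auto simp del: of_real_mult)
  qed simp
  have "(LINT x|lborel. ft f x * g x) = (LINT x|lborel. LINT y|lborel. ?h x y)"
    unfolding ft_def by (simp del: of_real_mult)
  also have "\<dots> = (LINT y|lborel. LINT x|lborel. ?h x y)"
    using lborel_pair.Fubini_integral[OF int] by simp
  also have "\<dots> = (LINT y|lborel. f y * ft g y)"
    unfolding ft_def by (intro Bochner_Integration.integral_cong refl)
      (simp add: mult_ac flip: integral_mult_right_zero)
  finally show ?thesis .
qed

section \<open>Gaussian regularization and Bessel's inequality\<close>

lemma integrable_gauss: "integrable lborel (\<lambda>x::real. exp (- x\<^sup>2 / 2))"
proof -
  have "integrable lborel (\<lambda>x. sqrt (2 * pi) * std_normal_density x)" 
    by (intro integrable_mult_right integrable_normal_density)  simp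
  then show ?thesis by (simp add: std_normal_density_def)
qed

lemma integral_gauss: "(LINT x|lborel. exp (- x\<^sup>2 / 2)) = sqrt (2 * pi)"
proof -
  have "(LINT x|lborel. sqrt (2 * pi) * std_normal_density x) = sqrt (2 * pi)" by simp
  then show ?thesis by (simp add: std_normal_density_def)
qed

text \<open>The case \<open>e = 1\<close> is the characteristic function of the standard normal
  distribution; the rest is a change of scale.\<close>

lemma ft_gauss:
  assumes e: "0 < e"
  shows "ft (\<lambda>\<xi>. of_real (exp (- (e * \<xi>)\<^sup>2 / 2))) z = of_real (sqrt (2 * pi) / e * exp (-
    (z / e)\<^sup>2 / 2))"
proof -
  have "of_real (exp (- (z / e)\<^sup>2 / 2)) = char std_normal_distribution (- z / e)"
    by (simp add: char_std_normal_distribution)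
  also have "\<dots> = (LINT x|lborel. std_normal_density x *\<^sub>R exp (\<i> * of_real (- z / e * x)))"
    unfolding char_def by (subst integral_density) auto
  also have "\<dots> = (LINT x|lborel. of_real (1 / sqrt (2 * pi)) * (exp (- (\<i> * of_real
    (x / e * z))) * of_real (exp (- x\<^sup>2 / 2))))"
    by (intro Bochner_Integration.integral_cong refl)
      (simp add: std_normal_density_def scaleR_conv_of_real mult_ac)
  also have "\<dots> = of_real (1 / sqrt (2 * pi)) * (LINT x|lborel. exp (- (\<i> * of_real
    (x / e * z))) * of_real (exp (- x\<^sup>2 / 2)))"
    by (rule integral_mult_right_zero)
  finally have 1: "(LINT x|lborel. exp (- (\<i> * of_real (x / e * z))) * of_real (exp (- x\<^sup>2 / 2)))
    = of_real (sqrt (2 * pi) * exp (- (z / e)\<^sup>2 / 2))"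
    by (simp add: field_simps)
  have "ft (\<lambda>\<xi>. of_real (exp (- (e * \<xi>)\<^sup>2 / 2))) z 
     = \<bar>1 / e\<bar> *\<^sub>R (LINT x|lborel. exp (- (\<i> * of_real ((0 + 1 / e * x) * z))) * of_real (exp (-
       (e * (0 + 1 / e * x))\<^sup>2 / 2)))"
    unfolding ft_def using e by (intro lborel_integral_real_affine) auto
  also have "\<dots> = \<bar>1 / e\<bar> *\<^sub>R (LINT x|lborel. exp (- (\<i> * of_real (x / e * z))) * of_real (exp
    (- x\<^sup>2 / 2)))"
    using e by simp
  finally show ?thesis using e unfolding 1 by (simp add: scaleR_conv_of_real)
qed

lemma L2_shift:
  assumes "L2 f" shows "L2 (\<lambda>x. f (x - c))"
proof -
  have "integrable lborel (\<lambda>x. (cmod (f (- c + 1 * x)))\<^sup>2)"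
    by (rule lborel_integrable_real_affine[OF L2_sq_integrable[OF assms]]) simp
  moreover have [measurable]: "f \<in> borel_measurable borel" using assms by (simp add: L2_def)
  ultimately show ?thesis by (simp add: L2_def)
qed

lemma L2_norm_shift: "L2_norm (\<lambda>x. f (x - c)) = L2_norm f"
proof -
  have "(LINT x|lborel. (cmod (f x))\<^sup>2) = \<bar>1\<bar> *\<^sub>R (LINT x|lborel. (cmod (f (- c + 1 * x)))\<^sup>2)"
    by (rule lborel_integral_real_affine) simp
  then show ?thesis by (simp add: L2_norm_def)
qed

lemma L2_autocorrelation_le:
  assumes "L2 f"
  shows "cmod (LINT x|lborel. f x * cnj (f (x - c))) \<le> (L2_norm f)\<^sup>2"
  using L2_inner_le[OF assms L2_cnj[OF L2_shift[OF assms, of c]]]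
  by (simp add: L2_norm_cnj[of "\<lambda>x. f (x - c)"] L2_norm_shift power2_eq_square)

text \<open>The transform of a Gaussian after rescaling to unit width. Its total mass
  \<open>2 * pi\<close> is the constant of Plancherel's identity.\<close>

abbreviation gauss_weight :: "real \<Rightarrow> complex" where
  "gauss_weight z \<equiv> of_real (sqrt (2 * pi) * exp (- z\<^sup>2 / 2))"

lemma integrable_gauss_weight: "integrable lborel gauss_weight"
  by (intro integrable_of_real integrable_mult_right integrable_gauss)

lemma integral_cmod_gauss_weight: "(LINT z|lborel. cmod (gauss_weight z)) = 2 * pi"
  by (simp add: norm_mult integral_gauss[simplified])

lemma integral_gauss_weight: "(LINT z|lborel. gauss_weight z) = of_real (2 * pi)"
proof -
  have "(LINT z|lborel. gauss_weight z) = of_real (LINT z|lborel. sqrt (2 * pi) * exp (- z\<^sup>2 / 2))"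
    by (rule integral_complex_of_real)
  also have "\<dots> = of_real (2 * pi)"
    by (simp only: integral_mult_right_zero integral_gauss) (simp flip: of_real_mult)
  finally show ?thesis .
qed

lemma integrable_gauss_scaled: 
  "0 < e \<Longrightarrow> integrable lborel (\<lambda>\<xi>. complex_of_real (exp (- (e * \<xi>)\<^sup>2 / 2)))"
  using lborel_integrable_real_affine[OF integrable_gauss, of e 0] by (intro
    integrable_of_real) simp

text \<open>The Gaussian makes the integral of \<open>|ft f|^2\<close> converge before anything is
  known about \<open>ft f\<close> in L^2. Duality moves a transform off \<open>f\<close>, and what
  is left is an average of autocorrelations of \<open>f\<close> over shifts \<open>e * z\<close>, so
  small \<open>e\<close> probes the squared norm.\<close>

lemma ft_gauss_regularized:
  assumes f: "integrable lborel f" and fL: "L2 f" and e: "0 < e"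
  shows "(LINT \<xi>|lborel. ft f \<xi> * (cnj (ft f \<xi>) * of_real (exp (- (e * \<xi>)\<^sup>2 / 2))))
    = (LINT z|lborel. gauss_weight z * (LINT x|lborel. f x * cnj (f (x - e * z))))"
proof -
  have [measurable]: "f \<in> borel_measurable borel" using f by auto
  define G where "G \<xi> = complex_of_real (exp (- (e * \<xi>)\<^sup>2 / 2))" for \<xi>
  have G: "integrable lborel G" unfolding G_def by (rule integrable_gauss_scaled[OF e])
  have [measurable]: "G \<in> borel_measurable borel" using G by auto
  define h where "h y = cnj (f (- y))" for y
  have hft: "cnj (ft f \<xi>) = ft h \<xi>" for \<xi> unfolding h_def by (rule ft_cnj)
  have h: "integrable lborel h" 
    unfolding h_def using lborel_integrable_real_affine[OF f, of "-1" 0] by simp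
  have k: "integrable lborel (\<lambda>\<xi>. cnj (ft f \<xi>) * G \<xi>)"
    by (rule Bochner_Integration.integrable_bound[of _ "\<lambda>\<xi>. (LINT x|lborel. cmod (f x)) * cmod
      (G \<xi>)"])
      (use G ft_bound[OF f] in \<open>auto simp: norm_mult abs_mult intro!: AE_I2 mult_right_mono\<close>)
  have ftk: "ft (\<lambda>\<xi>. cnj (ft f \<xi>) * G \<xi>) x = (LINT z|lborel. cnj (f (x
    - e * z)) * gauss_weight z)" for x
  proof -
    \<comment> \<open>The modulation by \<open>x\<close> is absorbed into the Gaussian, where it
      becomes a shift of the transform (\<open>ftM\<close>).\<close>
    define M where "M \<xi> = exp (- (\<i> * of_real (\<xi> * x))) * G \<xi>" for \<xi>
    have ftM: "ft M y = ft G (x + y)" for y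
      unfolding ft_def M_def mult.assoc[symmetric] exp_add[symmetric] by (simp add: algebra_simps)
    have M: "integrable lborel M" unfolding M_def by (rule ft_integrand[OF G])
    have "ft (\<lambda>\<xi>. cnj (ft f \<xi>) * G \<xi>) x = (LINT \<xi>|lborel. ft h \<xi> * M \<xi>)"
      unfolding hft ft_def[of "\<lambda>\<xi>. ft h \<xi> * G \<xi>"] M_def by (simp add: mult_ac del: of_real_mult)
    also have "\<dots> = (LINT y|lborel. h y * ft M y)"
      by (rule ft_duality[OF h M])
    also have "\<dots> = (LINT y|lborel. h y * ft G (x + y))"
      by (simp only: ftM)
    \<comment> \<open>Measuring the shift in units of \<open>e\<close> frees the Gaussian of
      \<open>e\<close>; the Jacobian cancels the \<open>1 / e\<close> of
      \<open>ft_gauss\<close>.\<close>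
    also have "\<dots> = \<bar>e\<bar> *\<^sub>R (LINT z|lborel. h (- x + e * z) * ft G (x + (- x + e * z)))"
      using e by (intro lborel_integral_real_affine) simp
    also have "\<dots> = (LINT z|lborel. \<bar>e\<bar> *\<^sub>R (h (- x + e * z) * ft G (x + (- x + e * z))))"
      by simp
    also have "\<dots> = (LINT z|lborel. cnj (f (x - e * z)) * gauss_weight z)"
    proof (intro Bochner_Integration.integral_cong refl)
      fix z
      have "ft G (x + (- x + e * z)) = of_real (sqrt (2 * pi) / e * exp (- z\<^sup>2 / 2))"
        unfolding G_def ft_gauss[OF e] using e by simp
      then show "\<bar>e\<bar> *\<^sub>R (h (- x + e * z) * ft G (x + (- x + e * z))) = cnj (f (x
        - e * z)) * gauss_weight z"
        using e by (simp add: h_def scaleR_conv_of_real)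
    qed
    finally show ?thesis .
  qed
  let ?H = "\<lambda>z x. gauss_weight z * (f x * cnj (f (x - e * z)))"
  have int: "integrable (lborel \<Otimes>\<^sub>M lborel) (case_prod ?H)"
  proof (rule lborel_pair.Fubini_integrable)
    have "integrable lborel (\<lambda>z. cmod (gauss_weight z) * (LINT x|lborel. cmod (f x) * cmod (cnj (f
      (x - e * z)))))"
    proof (rule Bochner_Integration.integrable_bound)
      show "integrable lborel (\<lambda>z. (L2_norm f)\<^sup>2 * cmod (gauss_weight z))"
        by (intro integrable_mult_right integrable_norm integrable_gauss_weight)
      show "AE z in lborel. norm (cmod (gauss_weight z) * (LINT x|lborel. cmod (f x) * cmod (cnj
        (f (x - e * z)))))
         \<le> norm ((L2_norm f)\<^sup>2 * cmod (gauss_weight z))"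
      proof (rule AE_I2)
        fix z
        have "(LINT x|lborel. cmod (f x) * cmod (cnj (f (x - e * z)))) \<le> (L2_norm f)\<^sup>2"
          using L2_Cauchy_Schwarz[OF fL L2_cnj[OF L2_shift[OF fL, of "e * z"]]]
          by (simp add: L2_norm_cnj[of "\<lambda>x. f (x - e * z)"] L2_norm_shift power2_eq_square)
        moreover have "0 \<le> (LINT x|lborel. cmod (f x) * cmod (cnj (f (x - e * z))))"
          by (intro Bochner_Integration.integral_nonneg) simp
        ultimately show "norm (cmod (gauss_weight z) * (LINT x|lborel. cmod (f x) * cmod (cnj (f
          (x - e * z)))))
         \<le> norm ((L2_norm f)\<^sup>2 * cmod (gauss_weight z))"
          by (simp only: norm_mult real_norm_def abs_norm_cancel abs_of_nonneg zero_le_power2)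
            (simp add: mult.commute mult_right_mono)
      qed
    qed measurable
    then show "integrable lborel (\<lambda>z. LINT x|lborel. norm (case (z, x) of (z, x) \<Rightarrow> ?H z x))"
      by (simp only: prod.case norm_mult integral_mult_right_zero)
    show "AE z in lborel. integrable lborel (\<lambda>x. case (z, x) of (z, x) \<Rightarrow> ?H z x)"
      unfolding prod.case
      by (intro AE_I2 integrable_mult_right L2_mult_integrable(1)[OF fL L2_cnj[OF L2_shift[OF fL]]])
  qed measurable
  have "(LINT \<xi>|lborel. ft f \<xi> * (cnj (ft f \<xi>) * G \<xi>)) = (LINT x|lborel. f x * ft (\<lambda>\<xi>. cnj
    (ft f \<xi>) * G \<xi>) x)"
    by (rule ft_duality[OF f k])
  also have "\<dots> = (LINT x|lborel. LINT z|lborel. ?H z x)"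
    unfolding ftk by (intro Bochner_Integration.integral_cong refl)
      (simp add: mult_ac flip: integral_mult_right_zero)
  also have "\<dots> = (LINT z|lborel. LINT x|lborel. ?H z x)"
    by (rule lborel_pair.Fubini_integral[OF int])
  also have "\<dots> = (LINT z|lborel. gauss_weight z * (LINT x|lborel. f x * cnj (f (x - e * z))))"
    by (simp only: integral_mult_right_zero)
  finally show ?thesis unfolding G_def .
qed

text \<open>The exponent carries 4 instead of 2 because \<open>F\<close> holds the square root of
  the regularizing Gaussian. The third claim follows since an autocorrelation never exceeds the
  squared norm.\<close>

lemma ft_gauss_L2:
  assumes f: "integrable lborel f" and fL: "L2 f" and e: "0 < e"
  defines "F \<equiv> \<lambda>\<xi>. of_real (exp (- (e * \<xi>)\<^sup>2 / 4)) * ft f \<xi>"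
  shows "L2 F"
    and "of_real ((L2_norm F)\<^sup>2) = (LINT z|lborel. gauss_weight z * (LINT x|lborel. f x * cnj (f
      (x - e * z))))"
    and "(L2_norm F)\<^sup>2 \<le> 2 * pi * (L2_norm f)\<^sup>2"
proof -
  have [measurable]: "f \<in> borel_measurable borel" using f by auto
  have sq: "(exp (- (e * \<xi>)\<^sup>2 / 4))\<^sup>2 = exp (- (e * \<xi>)\<^sup>2 / 2)" for \<xi>
    using exp_double[of "- (e * \<xi>)\<^sup>2 / 4"] by simp
  have F2: "(cmod (F \<xi>))\<^sup>2 = (cmod (ft f \<xi>))\<^sup>2 * exp (- (e * \<xi>)\<^sup>2 / 2)" for \<xi>
    by (simp only: F_def norm_mult power_mult_distrib[of "exp _"] norm_of_real abs_exp_cancel sq)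
      (rule mult.commute)
  have "integrable lborel (\<lambda>\<xi>. (cmod (F \<xi>))\<^sup>2)"
  proof (rule Bochner_Integration.integrable_bound)
    show "integrable lborel (\<lambda>\<xi>. complex_of_real ((LINT x|lborel. cmod (f x))\<^sup>2) * of_real (exp (-
      (e * \<xi>)\<^sup>2 / 2)))"
      by (intro integrable_mult_right integrable_gauss_scaled e)
    show "AE \<xi> in lborel. norm ((cmod (F \<xi>))\<^sup>2) \<le> norm (complex_of_real ((LINT x|lborel. cmod
      (f x))\<^sup>2) * of_real (exp (- (e * \<xi>)\<^sup>2 / 2)))"
      unfolding F2 using ft_bound[OF f]
      by (intro AE_I2) (auto simp: norm_mult norm_power intro!: mult_right_mono power_mono)
  qed (simp add: F_def)
  then show FL: "L2 F" by (simp add: L2_def F_def)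
  have "complex_of_real ((L2_norm F)\<^sup>2) = (LINT \<xi>|lborel. complex_of_real ((cmod (F \<xi>))\<^sup>2))"
    unfolding L2_norm_power2 by (rule integral_complex_of_real[symmetric])
  also have "\<dots> = (LINT \<xi>|lborel. ft f \<xi> * (cnj (ft f \<xi>) * of_real (exp (- (e * \<xi>)\<^sup>2 / 2))))"
    unfolding F2 of_real_mult by (intro Bochner_Integration.integral_cong refl)
      (simp only: complex_norm_square mult.assoc)
  also have "\<dots> = (LINT z|lborel. gauss_weight z * (LINT x|lborel. f x * cnj (f (x - e * z))))"
    by (rule ft_gauss_regularized[OF f fL e])
  finally show eq: "of_real ((L2_norm F)\<^sup>2) = (LINT z|lborel. gauss_weight z *
    (LINT x|lborel. f x * cnj (f (x - e * z))))" .
  have "(L2_norm F)\<^sup>2 = cmod (of_real ((L2_norm F)\<^sup>2))"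
    by (simp only: norm_of_real abs_of_nonneg zero_le_power2)
  also have "\<dots> \<le> (LINT z|lborel. cmod (gauss_weight z) * (L2_norm f)\<^sup>2)"
    unfolding eq
  proof (rule Bochner_Integration.integral_norm_bound_integral)
    show i: "integrable lborel (\<lambda>z. cmod (gauss_weight z) * (L2_norm f)\<^sup>2)"
      by (intro integrable_mult_left integrable_norm integrable_gauss_weight)
    show le: "norm (gauss_weight z * (LINT x|lborel. f x * cnj (f (x - e * z)))) \<le> cmod
      (gauss_weight z) * (L2_norm f)\<^sup>2" for z
      unfolding norm_mult by (intro mult_left_mono L2_autocorrelation_le fL) simp
    show "integrable lborel (\<lambda>z. gauss_weight z * (LINT x|lborel. f x * cnj (f (x - e * z))))"
    proof (rule Bochner_Integration.integrable_bound[OF i])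
      show "AE z in lborel. norm (gauss_weight z * (LINT x|lborel. f x * cnj (f (x - e * z))))
        \<le> norm (cmod (gauss_weight z) * (L2_norm f)\<^sup>2)"
        by (rule AE_I2, rule order_trans[OF le]) simp
    qed measurable
  qed
  also have "\<dots> = 2 * pi * (L2_norm f)\<^sup>2"
    by (simp only: integral_mult_left_zero integral_cmod_gauss_weight)
  finally show "(L2_norm F)\<^sup>2 \<le> 2 * pi * (L2_norm f)\<^sup>2" .
qed

lemma exp_regularizer_tendsto:
  "(\<lambda>n. exp (- (1 / real (Suc n) * \<xi>)\<^sup>2 / 4)) \<longlonglongrightarrow> 1"
proof -
  have "(\<lambda>n. exp (- (1 / real (Suc n) * \<xi>)\<^sup>2 / 4)) \<longlonglongrightarrow> exp (- (0 * \<xi>)\<^sup>2 / 4)"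
    by (intro tendsto_intros lim_1_over_n LIMSEQ_Suc[OF lim_1_over_n]) auto
  then show ?thesis by simp
qed

text \<open>Fatou removes the Gaussian at the price of equality. The resulting continuity of
  \<open>ft\<close> in L^2 is what later extends the identity from nice functions to all.\<close>

lemma ft_bessel:
  assumes f: "integrable lborel f" and fL: "L2 f"
  shows "L2 (ft f)" and "L2_norm (ft f) \<le> sqrt (2 * pi) * L2_norm f"
proof -
  have [measurable]: "f \<in> borel_measurable borel" using f by auto
  define F where "F n \<xi> = of_real (exp (- (1 / real (Suc n) * \<xi>)\<^sup>2 / 4)) * ft f \<xi>" for n \<xi>
  have L: "L2 (F n)" for n unfolding F_def by (rule ft_gauss_L2[OF f fL]) simp
  have "(L2_norm (F n))\<^sup>2 \<le> (sqrt (2 * pi) * L2_norm f)\<^sup>2" for n 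
  proof -
    have "(L2_norm (F n))\<^sup>2 \<le> 2 * pi * (L2_norm f)\<^sup>2"
      unfolding F_def by (rule ft_gauss_L2(3)[OF f fL]) simp
    then show ?thesis by (simp add: power_mult_distrib)
  qed
  then have N: "L2_norm (F n) \<le> sqrt (2 * pi) * L2_norm f" for n
    by (rule power2_le_imp_le) simp
  have "AE \<xi> in lborel. (\<lambda>n. F n \<xi>) \<longlonglongrightarrow> ft f \<xi>"
    unfolding F_def
  proof (rule AE_I2)
    fix \<xi>
    have "(\<lambda>n. of_real (exp (- (1 / real (Suc n) * \<xi>)\<^sup>2 / 4)) * ft f \<xi>) \<longlonglongrightarrow> of_real 1 * ft f \<xi>"
      by (intro tendsto_mult tendsto_of_real exp_regularizer_tendsto tendsto_const)
    then show "(\<lambda>n. of_real (exp (- (1 / real (Suc n) * \<xi>)\<^sup>2 / 4)) * ft f \<xi>) \<longlonglongrightarrow> ft f \<xi>" by simp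
  qed
  from L2_fatou[OF L _ this N] show "L2 (ft f)" and "L2_norm (ft f) \<le> sqrt (2 * pi) * L2_norm f"
    by auto
qed

section \<open>Plancherel's identity by density\<close>

lemma compact_support_L2:
  fixes f :: "real \<Rightarrow> complex"
  assumes c: "continuous_on UNIV f" and s: "\<And>x. R < \<bar>x\<bar> \<Longrightarrow> f x = 0"
  obtains B where "\<And>x. cmod (f x) \<le> B" "integrable lborel f" "L2 f"
proof -
  have [measurable]: "f \<in> borel_measurable borel" 
    by (rule borel_measurable_continuous_onI[OF c])
  have "compact (f ` {- R..R})"
    by (intro compact_continuous_image continuous_on_subset[OF c]) auto
  then obtain B where B: "\<And>x. x \<in> {- R..R} \<Longrightarrow> cmod (f x) \<le> B"
    using compact_imp_bounded bounded_iff by (metis image_eqI)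
  have B': "cmod (f x) \<le> max B 0" for x
    using B[of x] s[of x] by (cases "x \<in> {-R..R}") auto
  have f_eq: "indicator {-R..R} x *\<^sub>R f x = f x" for x
    using s[of x] by (auto simp: indicator_def)
  have i: "integrable lborel f"
    using borel_integrable_compact[of "{-R..R}" f] continuous_on_subset[OF c] by (simp add: f_eq)
  have "integrable lborel (\<lambda>x. (cmod (f x))\<^sup>2)"
    by (rule Bochner_Integration.integrable_bound[of _ "\<lambda>x. max B 0 * cmod (f x)"])
      (use i B' in \<open>auto simp: power2_eq_square intro!: mult_right_mono\<close>)
  then have "L2 f" by (simp add: L2_def)
  then show ?thesis by (rule that[OF B' i])
qed

text \<open>For continuous \<open>f\<close> of compact support the autocorrelation is continuous at
  0, so the Gaussian average converges to \<open>2 * pi\<close> times the squared norm; the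
  regularized transforms converge because \<open>ft_bessel\<close> provides a dominating
  function.\<close>

lemma plancherel_compact_support:
  fixes f :: "real \<Rightarrow> complex"
  assumes c: "continuous_on UNIV f" and s: "\<And>x. R < \<bar>x\<bar> \<Longrightarrow> f x = 0"
  shows "L2_norm (ft f) = sqrt (2 * pi) * L2_norm f"
proof -
  obtain B where B: "\<And>x. cmod (f x) \<le> B" and f: "integrable lborel f" and fL: "L2 f"
    using compact_support_L2[OF c s] by metis
  have [measurable]: "f \<in> borel_measurable borel" using f by auto
  define e where "e n = 1 / real (Suc n)" for n
  have e0: "e \<longlonglongrightarrow> 0" unfolding e_def by (rule LIMSEQ_Suc[OF lim_1_over_n])
  define F where "F n \<xi> = of_real (exp (- (e n * \<xi>)\<^sup>2 / 4)) * ft f \<xi>" for n \<xi>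
  have [measurable]: "F n \<in> borel_measurable borel" for n unfolding F_def by measurable
  have "L2_lim F (ft f) sequentially"
  proof (rule L2_lim_dominated[OF ft_bessel(1)[OF f fL]])
    show "cmod (F n x) \<le> cmod (ft f x)" for n x
      unfolding F_def norm_mult by (rule mult_left_le_one_le) auto
    show "AE x in lborel. (\<lambda>n. F n x) \<longlonglongrightarrow> ft f x"
    proof (rule AE_I2)
      fix x
      have "(\<lambda>n. F n x) \<longlonglongrightarrow> of_real 1 * ft f x"
        unfolding F_def e_def by (intro tendsto_mult tendsto_of_real exp_regularizer_tendsto
          tendsto_const)
      then show "(\<lambda>n. F n x) \<longlonglongrightarrow> ft f x" by simp
    qed
  qed (simp_all add: F_def)
  then have 1: "(\<lambda>n. complex_of_real ((L2_norm (F n))\<^sup>2)) \<longlonglongrightarrow> of_real ((L2_norm (ft f))\<^sup>2)"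
    by (intro tendsto_intros L2_lim_norm)
  have "(\<lambda>n. LINT z|lborel. gauss_weight z * (LINT x|lborel. f x * cnj (f (x - e n * z))))
     \<longlonglongrightarrow> (LINT z|lborel. gauss_weight z * (LINT x|lborel. f x * cnj (f x)))"
  proof (rule integral_dominated_convergence)
    show "integrable lborel (\<lambda>z. cmod (gauss_weight z) * (L2_norm f)\<^sup>2)"
      by (intro integrable_mult_left integrable_norm integrable_gauss_weight)
    show "AE z in lborel. (\<lambda>n. gauss_weight z * (LINT x|lborel. f x * cnj (f (x - e n * z))))
         \<longlonglongrightarrow> gauss_weight z * (LINT x|lborel. f x * cnj (f x))"
    proof (intro AE_I2 tendsto_intros)
      fix z
      show "(\<lambda>n. LINT x|lborel. f x * cnj (f (x - e n * z))) \<longlonglongrightarrow> (LINT x|lborel. f x * cnj (f x))"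
      proof (rule integral_dominated_convergence)
        show "integrable lborel (\<lambda>x. cmod (f x) * B)" using f by auto
        show "AE x in lborel. (\<lambda>n. f x * cnj (f (x - e n * z))) \<longlonglongrightarrow> f x * cnj (f x)"
        proof (intro AE_I2 tendsto_intros)
          fix x
          have "isCont f (x - 0 * z)" using c by (simp add: continuous_on_eq_continuous_at)
          moreover have "(\<lambda>n. x - e n * z) \<longlonglongrightarrow> x - 0 * z" by (intro tendsto_intros e0)
          ultimately show "(\<lambda>n. f (x - e n * z)) \<longlonglongrightarrow> f x"
            using isCont_tendsto_compose by fastforce
        qed
        show "AE x in lborel. norm (f x * cnj (f (x - e n * z))) \<le> cmod (f x) * B" for n
          by (intro AE_I2) (auto simp: norm_mult B mult_left_mono)
      qed simp_all
    qed
    show "AE z in lborel. norm (gauss_weight z * (LINT x|lborel. f x * cnj (f (x - e n * z))))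
      \<le> cmod (gauss_weight z) * (L2_norm f)\<^sup>2" for n
      unfolding norm_mult by (intro AE_I2 mult_left_mono L2_autocorrelation_le fL) simp
  qed measurable
  moreover have "(LINT z|lborel. gauss_weight z * (LINT x|lborel. f x * cnj (f (x - e n * z))))
     = complex_of_real ((L2_norm (F n))\<^sup>2)" for n
    unfolding F_def by (rule ft_gauss_L2(2)[symmetric, OF f fL]) (simp add: e_def)
  moreover have "(LINT x|lborel. f x * cnj (f x)) = of_real ((L2_norm f)\<^sup>2)"
    unfolding L2_norm_power2 by (simp flip: complex_norm_square integral_complex_of_real)
  ultimately have 2: "(\<lambda>n. complex_of_real ((L2_norm (F n))\<^sup>2)) \<longlonglongrightarrow> of_real (2 * pi) * of_real
    ((L2_norm f)\<^sup>2)"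
    by (simp only: integral_mult_left_zero integral_gauss_weight)
  have "complex_of_real ((L2_norm (ft f))\<^sup>2) = of_real (2 * pi) * of_real ((L2_norm f)\<^sup>2)"
    by (rule LIMSEQ_unique[OF 1 2])
  then have "(L2_norm (ft f))\<^sup>2 = 2 * pi * (L2_norm f)\<^sup>2"
    by (metis of_real_eq_iff of_real_mult)
  also have "\<dots> = (sqrt (2 * pi) * L2_norm f)\<^sup>2" by (simp add: power_mult_distrib)
  finally show ?thesis by (subst (asm) power2_eq_iff_nonneg) auto
qed

text \<open>By Bessel's inequality \<open>ft\<close> is continuous in L^2, so the identity survives
  limits.\<close>

lemma plancherel_closed:
  assumes f: "integrable lborel f" and lim: "L2_lim h f sequentially" and h: "\<And>n.
    integrable lborel (h n)"
    and eq: "\<And>n::nat. L2_norm (ft (h n)) = sqrt (2 * pi) * L2_norm (h n)"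
  shows "L2_norm (ft f) = sqrt (2 * pi) * L2_norm f"
proof -
  have L: "L2 f" "\<And>n. L2 (h n)" using lim by (auto simp: L2_lim_def)
  have ft_hf: "ft (\<lambda>x. h n x - f x) = (\<lambda>\<xi>. ft (h n) \<xi> - ft f \<xi>)" for n
    by (rule ext) (rule ft_diff[OF h f])
  have "(\<lambda>n. L2_norm (\<lambda>\<xi>. ft (h n) \<xi> - ft f \<xi>)) \<longlonglongrightarrow> 0"
  proof (rule Lim_null_comparison)
    show "\<forall>\<^sub>F n in sequentially. norm (L2_norm (\<lambda>\<xi>. ft (h n) \<xi> - ft f \<xi>)) \<le> sqrt
      (2 * pi) * L2_norm (\<lambda>x. h n x - f x)"
      using ft_bessel(2)[OF Bochner_Integration.integrable_diff[OF h f] L2_diff[OF L(2,1)]]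
      by (simp add: ft_hf)
    have "(\<lambda>n. sqrt (2 * pi) * L2_norm (\<lambda>x. h n x - f x)) \<longlonglongrightarrow> sqrt (2 * pi) * 0"
      using lim by (intro tendsto_intros) (auto simp: L2_lim_def)
    then show "(\<lambda>n. sqrt (2 * pi) * L2_norm (\<lambda>x. h n x - f x)) \<longlonglongrightarrow> 0" by simp
  qed
  then have "L2_lim (\<lambda>n. ft (h n)) (ft f) sequentially"
    using ft_bessel(1) f h L by (auto simp: L2_lim_def)
  from L2_lim_norm[OF this] have 1: "(\<lambda>n. L2_norm (ft (h n))) \<longlonglongrightarrow> L2_norm (ft f)" .
  have 2: "(\<lambda>n. L2_norm (ft (h n))) \<longlonglongrightarrow> sqrt (2 * pi) * L2_norm f"
    unfolding eq by (intro tendsto_intros L2_lim_norm lim)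
  show ?thesis by (rule LIMSEQ_unique[OF 1 2])
qed

lemma integrable_indicator_Icc: "integrable lborel (indicator {a..b::real} :: real \<Rightarrow> real)"
  by (rule integrable_real_indicator) (auto simp: emeasure_lborel_Icc_eq)

lemma L2_indicator: "L2 (indicator {a..b})"
proof -
  have "integrable lborel (\<lambda>x. (cmod (indicator {a..b} x))\<^sup>2)"
    by (rule Bochner_Integration.integrable_bound[OF integrable_indicator_Icc[of a b]])
      (simp_all split: split_indicator)
  then show ?thesis by (simp add: L2_def)
qed

text \<open>\<open>measurable_on\<close> supplies continuous functions converging almost everywhere,
  but without control of size or support. The modified functions \<open>h\<close> restore both and
  so converge in L^2.\<close>

lemma plancherel_bounded:
  fixes f :: "real \<Rightarrow> complex"
  assumes f[measurable]: "f \<in> borel_measurable borel" and B: "\<And>x. cmod (f x) \<le> B" and s: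
    "\<And>x. R < \<bar>x\<bar> \<Longrightarrow> f x = 0"
    and B0: "0 < B" and R: "0 < R"
  shows "integrable lborel f" and "L2_norm (ft f) = sqrt (2 * pi) * L2_norm f"
proof -
  have "f measurable_on UNIV"
    by (rule lebesgue_measurable_imp_measurable_on) (auto
      intro: borel_measurable_subalgebra[of borel])
  then obtain N g where N: "negligible N" and g: "\<And>n::nat. continuous_on UNIV (g n)"
    and lim: "\<And>x. x \<notin> N \<Longrightarrow> (\<lambda>n. g n x) \<longlonglongrightarrow> f x"
    unfolding measurable_on_def by auto
  have "AE x in lebesgue. x \<notin> N"
    using N by (simp add: AE_not_in negligible_iff_null_sets)
  then have ae: "AE x in lborel. (\<lambda>n. g n x) \<longlonglongrightarrow> f x"
    by (subst AE_completion_iff[symmetric]) (auto elim!: eventually_mono intro: lim)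
  \<comment> \<open>The first factor is a trapezoid, 1 on \<open>[-R, R]\<close> and 0 outside
    \<open>[-R - 1, R + 1]\<close>; the second scales values down to modulus at most
    \<open>B\<close>. Neither changes \<open>f\<close>, hence neither changes the limit.\<close>
  define h where "h n x = of_real (max 0 (min 1 (R + 1 - \<bar>x\<bar>))) * (of_real (B / max B (cmod
    (g n x))) * g n x)" for n x
  have cont: "continuous_on UNIV (h n)" for n
    unfolding h_def using B0 by (intro continuous_intros g) auto
  have sup: "h n x = 0" if "R + 1 < \<bar>x\<bar>" for n x
    using that by (simp add: h_def)
  have le: "cmod (h n x) \<le> cmod (of_real B * indicator {-(R+1)..R+1} x)" for n x
  proof (cases "R + 1 < \<bar>x\<bar>")
    case True then show ?thesis by (simp add: sup)
  next
    case False
    have "cmod (h n x) \<le> 1 * (B / max B (cmod (g n x)) * cmod (g n x))"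
      unfolding h_def norm_mult using B0
      by (intro mult_mono) (auto simp: norm_divide)
    also have "\<dots> \<le> B" using B0 by (simp add: field_simps)
    finally show ?thesis using False B0 by (auto simp: indicator_def)
  qed
  have ind: "L2 (\<lambda>x. of_real B * indicator {-(R+1)..R+1} x)"
    by (intro L2_cmult L2_indicator)
  have lim: "L2_lim h f sequentially"
  proof (rule L2_lim_dominated[OF ind _ le _ f])
    show "h n \<in> borel_measurable borel" for n
      by (rule borel_measurable_continuous_onI[OF cont])
    show "AE x in lborel. (\<lambda>n. h n x) \<longlonglongrightarrow> f x"
      using ae
    proof eventually_elim
      case (elim x)
      show ?case
      proof (cases "R < \<bar>x\<bar>")
        case False
        have "(\<lambda>n. h n x) \<longlonglongrightarrow> of_real (max 0 (min 1 (R + 1 - \<bar>x\<bar>))) * (of_real (B / max B (cmod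
          (f x))) * f x)"
          unfolding h_def using B0 by (intro tendsto_intros elim) auto
        also have "of_real (max 0 (min 1 (R + 1 - \<bar>x\<bar>))) * (of_real (B / max B (cmod
          (f x))) * f x) = f x"
          using False B[of x] B0 by (simp add: max_def)
        finally show ?thesis .
      next
        case True
        have "(\<lambda>n. h n x) \<longlonglongrightarrow> of_real (max 0 (min 1 (R + 1 - \<bar>x\<bar>))) * (of_real (B / max B (cmod
          (f x))) * f x)"
          unfolding h_def using B0 by (intro tendsto_intros elim) auto
        then show ?thesis using s[OF True] by simp
      qed
    qed
  qed
  show f: "integrable lborel f"
  proof (rule Bochner_Integration.integrable_bound[of _ "\<lambda>x. B * indicator {-R..R} x :: real"])
    show "AE x in lborel. norm (f x) \<le> norm (B * indicator {-R..R} x :: real)"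
    proof (rule AE_I2)
      fix x show "norm (f x) \<le> norm (B * indicator {-R..R} x :: real)"
        using B[of x] s[of x] B0 by (cases "R < \<bar>x\<bar>") (auto simp: indicator_def)
    qed
  qed (auto intro: integrable_indicator_Icc)
  have "integrable lborel (h n)" for n
    using compact_support_L2[OF cont sup] by metis
  then show "L2_norm (ft f) = sqrt (2 * pi) * L2_norm f"
    by (rule plancherel_closed[OF f lim]) (rule plancherel_compact_support[OF cont sup])
qed

theorem plancherel_ft:
  assumes f: "integrable lborel f" and fL: "L2 f"
  shows "L2_norm (ft f) = sqrt (2 * pi) * L2_norm f"
proof -
  have [measurable]: "f \<in> borel_measurable borel" using f by auto
  \<comment> \<open>Both argument and size are cut off, which leaves bounded functions of bounded
    support; \<open>Suc n\<close> keeps the two bounds positive.\<close>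
  define h where "h n x = (if \<bar>x\<bar> \<le> real (Suc n) \<and> cmod (f x) \<le> real
    (Suc n) then f x else 0)" for n x
  have [measurable]: "h n \<in> borel_measurable borel" for n unfolding h_def by measurable
  have lim: "L2_lim h f sequentially"
  proof (rule L2_lim_dominated[OF fL])
    show "AE x in lborel. (\<lambda>n. h n x) \<longlonglongrightarrow> f x"
    proof (rule AE_I2)
      fix x
      obtain n where n: "max \<bar>x\<bar> (cmod (f x)) \<le> real n" using real_arch_simple by blast
      have "\<forall>\<^sub>F k in sequentially. h k x = f x"
        using eventually_ge_at_top[of n] by eventually_elim (use n in \<open>auto simp: h_def\<close>)
      then show "(\<lambda>n. h n x) \<longlonglongrightarrow> f x" by (rule tendsto_eventually)
    qed
  qed (auto simp: h_def)
  have "integrable lborel (h n) \<and> L2_norm (ft (h n)) = sqrt (2 * pi) * L2_norm (h n)" for n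
    using plancherel_bounded[of "h n" "real (Suc n)" "real (Suc n)"] by (auto simp: h_def)
  then show ?thesis by (intro plancherel_closed[OF f lim]) auto
qed

section \<open>The Fourier transform on \<open>L\<^sup>2\<close>\<close>

definition trunc :: "real \<Rightarrow> (real \<Rightarrow> complex) \<Rightarrow> real \<Rightarrow> complex" where
  "trunc R f x = indicator {-R..R} x *\<^sub>R f x"

lemma trunc_measurable [measurable]:
  "f \<in> borel_measurable borel \<Longrightarrow> trunc R f \<in> borel_measurable borel"
  unfolding trunc_def by measurable

lemma trunc_le: "cmod (trunc R f x) \<le> cmod (f x)"
  by (simp add: trunc_def indicator_def)

lemma L2_trunc: "L2 f \<Longrightarrow> L2 (trunc R f)"
  by (rule L2_dominated[where c=1 and f=f]) (auto simp: trunc_le trunc_measurable L2_def)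

lemma integrable_trunc:
  assumes "L2 f" shows "integrable lborel (trunc R f)"
proof -
  have "integrable lborel (\<lambda>x. indicator {-R..R} x * f x)"
    by (intro L2_mult_integrable L2_indicator assms)
  moreover have "(\<lambda>x. indicator {-R..R} x * f x) = trunc R f"
    by (auto simp: trunc_def indicator_def)
  ultimately show ?thesis by simp
qed

lemma trunc_lim: 
  assumes "L2 f" shows "L2_lim (\<lambda>R. trunc R f) f at_top"
proof (rule L2_lim_dominated_at_top[OF assms])
  show "AE x in lborel. ((\<lambda>R. trunc R f x) \<longlongrightarrow> f x) at_top"
  proof (rule AE_I2)
    fix x
    have "\<forall>\<^sub>F R in at_top. trunc R f x = f x"
      using eventually_ge_at_top[of "\<bar>x\<bar>"] by eventually_elim (auto simp: trunc_def indicator_def)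
    then show "((\<lambda>R. trunc R f x) \<longlongrightarrow> f x) at_top" by (rule tendsto_eventually)
  qed
qed (use assms trunc_le in \<open>auto simp: L2_def\<close>)

lemma truncated_fourier_eq: "truncated_fourier R f = ft (trunc R f)"
  unfolding truncated_fourier_def ft_def trunc_def set_lebesgue_integral_def by simp

lemma has_fourier_iff:
  "has_fourier f g \<longleftrightarrow> L2 f \<and> L2_lim (\<lambda>R. ft (trunc R f)) g at_top"
  using ft_bessel(1)[OF integrable_trunc L2_trunc]
  by (auto simp: has_fourier_def L2_lim_def truncated_fourier_eq)

lemma has_fourier_unique:
  assumes "has_fourier f g" "has_fourier f h" shows "AE x in lborel. g x = h x"
  using assms by (intro L2_lim_unique[of "\<lambda>R. ft (trunc R f)" g at_top h])
    (auto simp: has_fourier_iff)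

text \<open>Neither the truncated integrals nor the L^2 limit see null sets, so both sides of the
  relation may be altered there.\<close>

lemma has_fourier_cong_AE:
  assumes f: "has_fourier f g" and f': "f' \<in> borel_measurable borel" "AE x in lborel. f x = f' x"
    and g': "g' \<in> borel_measurable borel" "AE x in lborel. g x = g' x"
  shows "has_fourier f' g'"
proof -
  have L: "L2 f" "L2 g" using f by (auto simp: has_fourier_def)
  have [measurable]: "f \<in> borel_measurable borel" "g \<in> borel_measurable borel"
    "f' \<in> borel_measurable borel"
    "g' \<in> borel_measurable borel" using L f' g' by (auto simp: L2_def)
  have ft_eq: "ft (trunc R f) = ft (trunc R f')" for R
    unfolding ft_def using f' by (intro ext integral_cong_AE)
      (auto simp: trunc_def elim!: eventually_mono)
  have "L2_norm (\<lambda>\<xi>. ft (trunc R f') \<xi> - g \<xi>) = L2_norm (\<lambda>\<xi>. ft (trunc R f') \<xi> - g' \<xi>)" for R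
    using g' by (intro L2_norm_cong_AE) (auto elim!: eventually_mono)
  then show ?thesis using f L2_cong_AE[OF L(1) f'] L2_cong_AE[OF L(2) g']
    by (simp add: has_fourier_def truncated_fourier_eq ft_eq)
qed

lemma ft_diff_norm:
  assumes f: "integrable lborel f" "L2 f" and g: "integrable lborel g" "L2 g"
  shows "L2_norm (\<lambda>\<xi>. ft f \<xi> - ft g \<xi>) = sqrt (2 * pi) * L2_norm (\<lambda>x. f x - g x)"
proof -
  have "ft (\<lambda>x. f x - g x) = (\<lambda>\<xi>. ft f \<xi> - ft g \<xi>)"
    by (rule ext) (rule ft_diff[OF f(1) g(1)])
  then show ?thesis
    using plancherel_ft[OF Bochner_Integration.integrable_diff[OF f(1) g(1)] L2_diff[OF f(2)
      g(2)]] by simp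
qed

lemma has_fourier_ft:
  assumes f: "integrable lborel f" "L2 f" shows "has_fourier f (ft f)"
proof -
  have "((\<lambda>R. sqrt (2 * pi) * L2_norm (\<lambda>x. trunc R f x - f x)) \<longlongrightarrow> sqrt (2 * pi) * 0) at_top"
    using trunc_lim[OF f(2)] by (intro tendsto_intros) (simp add: L2_lim_def)
  then show ?thesis
    using f by (simp add: has_fourier_def truncated_fourier_eq ft_bessel ft_diff_norm L2_trunc
      integrable_trunc)
qed

text \<open>Completeness speaks of sequences, so the limit is found along integer truncation radii;
  Plancherel for truncations carries it to real radii.\<close>

lemma has_fourier_exists:
  assumes f: "L2 f" shows "\<exists>g. has_fourier f g"
proof -
  have t0: "((\<lambda>R. L2_norm (\<lambda>x. trunc R f x - f x)) \<longlongrightarrow> 0) at_top"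
    using trunc_lim[OF f] by (simp add: L2_lim_def)
  have d: "L2_norm (\<lambda>\<xi>. ft (trunc R f) \<xi> - ft (trunc S f) \<xi>)
     \<le> sqrt (2 * pi) * (L2_norm (\<lambda>x. trunc R f x - f x) + L2_norm (\<lambda>x. trunc S f x - f x))" for R S
    using L2_norm_triangle_diff[OF L2_trunc[OF f, of R] f L2_trunc[OF f, of S]]
    by (simp add: ft_diff_norm f L2_trunc integrable_trunc L2_norm_minus_commute[of f])
  have L: "L2 (ft (trunc R f))" for R
    by (intro ft_bessel(1) f L2_trunc integrable_trunc)
  have "\<exists>g. L2_lim (\<lambda>n::nat. ft (trunc (real n) f)) g sequentially"
  proof (rule L2_complete[OF L])
    fix e :: real assume e: "0 < e"
    have "\<forall>\<^sub>F R in at_top. L2_norm (\<lambda>x. trunc R f x - f x) < e / (2 * sqrt (2 * pi))"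
      using e by (intro order_tendstoD(2)[OF t0]) simp
    then obtain R0 where R0: "\<And>R. R0 \<le> R \<Longrightarrow> L2_norm (\<lambda>x. trunc R f x - f x) < e / (2 * sqrt
      (2 * pi))"
      by (auto simp: eventually_at_top_linorder)
    obtain N :: nat where N: "R0 \<le> real N" using real_arch_simple by blast
    show "\<exists>N. \<forall>m\<ge>N. \<forall>n\<ge>N. L2_norm (\<lambda>x. ft (trunc (real m) f) x - ft (trunc (real n) f) x) < e"
    proof (intro exI[of _ N] allI impI)
      fix m n assume "N \<le> m" "N \<le> n"
      then have "L2_norm (\<lambda>x. trunc (real m) f x - f x) + L2_norm (\<lambda>x. trunc (real n) f x - f x)
         < e / (2 * sqrt (2 * pi)) + e / (2 * sqrt (2 * pi))"
        using N by (intro add_strict_mono R0) auto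
      then have "sqrt (2 * pi) * (L2_norm (\<lambda>x. trunc (real m) f x - f x) + L2_norm (\<lambda>x. trunc
        (real n) f x - f x)) < e"
        by (simp add: field_simps)
      with d[of m n] show "L2_norm (\<lambda>x. ft (trunc (real m) f) x - ft (trunc (real n) f) x) < e"
        by (rule le_less_trans)
    qed
  qed
  then obtain g where g: "L2_lim (\<lambda>n::nat. ft (trunc (real n) f)) g sequentially" by blast
  \<comment> \<open>Each real radius is compared with the integer radius \<open>N R\<close> above
    it; both tend to infinity together.\<close>
  define N where "N R = nat \<lceil>R\<rceil>" for R :: real
  have N: "filterlim N sequentially at_top"
    unfolding filterlim_at_top
  proof
    fix Z show "\<forall>\<^sub>F R in at_top. Z \<le> N R"
      using eventually_ge_at_top[of "real Z"] by eventually_elim (auto simp: N_def, linarith)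
  qed
  have "((\<lambda>R. L2_norm (\<lambda>\<xi>. ft (trunc R f) \<xi> - g \<xi>)) \<longlongrightarrow> 0) at_top"
  proof (rule Lim_null_comparison)
    let ?b = "\<lambda>R. sqrt (2 * pi) * (L2_norm (\<lambda>x. trunc R f x - f x) + L2_norm (\<lambda>x. trunc (real
      (N R)) f x - f x))
        + L2_norm (\<lambda>\<xi>. ft (trunc (real (N R)) f) \<xi> - g \<xi>)"
    have "L2 g" using g by (simp add: L2_lim_def)
    then have "L2_norm (\<lambda>\<xi>. ft (trunc R f) \<xi> - g \<xi>) \<le> ?b R" for R
      by (rule order_trans[OF L2_norm_triangle_diff[OF L L] add_right_mono[OF d]])
    then show "\<forall>\<^sub>F R in at_top. norm (L2_norm (\<lambda>\<xi>. ft (trunc R f) \<xi> - g \<xi>)) \<le> ?b R" by simp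
    have gN: "((\<lambda>R. L2_norm (\<lambda>\<xi>. ft (trunc (real (N R)) f) \<xi> - g \<xi>)) \<longlongrightarrow> 0) at_top"
      using g by (intro filterlim_compose[OF _ N]) (simp add: L2_lim_def)
    have tN: "((\<lambda>R. L2_norm (\<lambda>x. trunc (real (N R)) f x - f x)) \<longlongrightarrow> 0) at_top"
      by (intro filterlim_compose[OF t0] filterlim_compose[OF filterlim_real_sequentially N])
    have "(?b \<longlongrightarrow> sqrt (2 * pi) * (0 + 0) + 0) at_top"
      by (intro tendsto_intros t0 tN gN)
    then show "(?b \<longlongrightarrow> 0) at_top" by simp
  qed
  then show ?thesis using f g by (auto simp: has_fourier_def truncated_fourier_eq L2_lim_def)
qed

lemma has_fourier_fourier: "L2 f \<Longrightarrow> has_fourier f (fourier f)"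
  unfolding fourier_def by (rule someI_ex[OF has_fourier_exists])

lemma has_fourier_plancherel:
  assumes "has_fourier f g" shows "L2_norm g = sqrt (2 * pi) * L2_norm f"
proof -
  have f: "L2 f" and lim: "L2_lim (\<lambda>R. ft (trunc R f)) g at_top" using assms by
    (auto simp: has_fourier_iff)
  have eq: "L2_norm (ft (trunc R f)) = sqrt (2 * pi) * L2_norm (trunc R f)" for R
    by (intro plancherel_ft integrable_trunc L2_trunc f)
  have "((\<lambda>R. L2_norm (ft (trunc R f))) \<longlongrightarrow> sqrt (2 * pi) * L2_norm f) at_top"
    unfolding eq by (intro tendsto_intros L2_lim_norm trunc_lim f)
  then show ?thesis using L2_lim_norm[OF lim] by (intro tendsto_unique[OF _ _ _]) auto
qed

lemma has_fourier_add:
  assumes "has_fourier f g" "has_fourier f' g'"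
  shows "has_fourier (\<lambda>x. f x + f' x) (\<lambda>x. g x + g' x)"
proof -
  have L: "L2 f" "L2 f'" using assms by (auto simp: has_fourier_def)
  have "ft (trunc R (\<lambda>x. f x + f' x)) = (\<lambda>\<xi>. ft (trunc R f) \<xi> + ft (trunc R f') \<xi>)" for R
    using ft_add[OF integrable_trunc[OF L(1)] integrable_trunc[OF L(2)], of R R]
    by (auto simp: trunc_def[abs_def] scaleR_add_right)
  then show ?thesis using assms by (simp add: has_fourier_iff L2_add L2_lim_add)
qed

lemma ft_cmult: "ft (\<lambda>x. c * f x) \<xi> = c * ft f \<xi>"
  unfolding ft_def by (simp add: mult.left_commute[of _ c] del: of_real_mult)

lemma has_fourier_cmult:
  assumes "has_fourier f g" shows "has_fourier (\<lambda>x. c * f x) (\<lambda>x. c * g x)"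
proof -
  have "ft (trunc R (\<lambda>x. c * f x)) = (\<lambda>\<xi>. c * ft (trunc R f) \<xi>)" for R
    using ft_cmult[of c "trunc R f"] by (auto simp: trunc_def[abs_def])
  then show ?thesis using assms by (simp add: has_fourier_iff L2_cmult L2_lim_cmult)
qed

lemma has_fourier_diff:
  assumes "has_fourier f g" "has_fourier f' g'"
  shows "has_fourier (\<lambda>x. f x - f' x) (\<lambda>x. g x - g' x)"
  using has_fourier_add[OF assms(1) has_fourier_cmult[OF assms(2), of "-1"]] by simp

lemma L2_norm_reflect: "L2_norm (\<lambda>x. f (- x)) = L2_norm f"
proof -
  have "(LINT x|lborel. (cmod (f x))\<^sup>2) = \<bar>-1\<bar> *\<^sub>R (LINT x|lborel. (cmod (f (0 + (-1) * x)))\<^sup>2)"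
    by (rule lborel_integral_real_affine) simp
  then show ?thesis by (simp add: L2_norm_def)
qed

lemma L2_reflect: 
  assumes "L2 f" shows "L2 (\<lambda>x. f (- x))"
proof -
  have "integrable lborel (\<lambda>x. (cmod (f (0 + (-1) * x)))\<^sup>2)"
    by (rule lborel_integrable_real_affine[OF L2_sq_integrable[OF assms]]) simp
  moreover have [measurable]: "f \<in> borel_measurable borel" using assms by (simp add: L2_def)
  ultimately show ?thesis by (simp add: L2_def)
qed

lemma has_fourier_cnj:
  assumes "has_fourier f g" shows "has_fourier (\<lambda>x. cnj (f x)) (\<lambda>\<xi>. cnj (g (- \<xi>)))"
proof -
  have L: "L2 f" "L2 g" using assms by (auto simp: has_fourier_def)
  have "ft (trunc R (\<lambda>x. cnj (f x))) = (\<lambda>\<xi>. cnj (ft (trunc R f) (- \<xi>)))" for R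
  proof
    fix \<xi>
    have "cnj (ft (trunc R f) (- \<xi>)) = (LINT x|lborel. cnj (exp (- (\<i> * of_real (x *
      - \<xi>))) * trunc R f x))"
      unfolding ft_def by (rule Bochner_Integration.integral_cnj[symmetric])
    then show "ft (trunc R (\<lambda>x. cnj (f x))) \<xi> = cnj (ft (trunc R f) (- \<xi>))"
      by (simp add: ft_def trunc_def exp_cnj)
  qed
  moreover have "L2_norm (\<lambda>\<xi>. cnj (ft (trunc R f) (- \<xi>)) - cnj (g (- \<xi>))) = L2_norm (\<lambda>\<xi>. ft
    (trunc R f) \<xi> - g \<xi>)" for R
    using L2_norm_cnj[of "\<lambda>\<xi>. ft (trunc R f) (- \<xi>) - g (- \<xi>)"] L2_norm_reflect[of "\<lambda>\<xi>. ft
      (trunc R f) \<xi> - g \<xi>"]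
    by simp
  ultimately show ?thesis using assms L
    by (simp add: has_fourier_def truncated_fourier_eq L2_cnj L2_reflect)
qed

lemma has_fourier_duality:
  assumes f: "has_fourier f F" and g: "has_fourier g G"
  shows "(LINT x|lborel. F x * g x) = (LINT x|lborel. f x * G x)"
proof -
  have L: "L2 f" "L2 g" and lim: "L2_lim (\<lambda>R. ft (trunc R f)) F at_top" "L2_lim (\<lambda>R. ft
    (trunc R g)) G at_top"
    using assms by (auto simp: has_fourier_iff)
  have eq: "(LINT x|lborel. ft (trunc R f) x * trunc R g x) = (LINT x|lborel. trunc R f x * ft
    (trunc R g) x)" for R
    by (intro ft_duality integrable_trunc L)
  have "((\<lambda>R. LINT x|lborel. ft (trunc R f) x * trunc R g x) \<longlongrightarrow> (LINT x|lborel. F x * g x)) at_top"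
    by (intro L2_lim_inner lim trunc_lim L)
  moreover have "((\<lambda>R. LINT x|lborel. ft (trunc R f) x * trunc R g x) \<longlongrightarrow>
    (LINT x|lborel. f x * G x)) at_top"
    unfolding eq by (intro L2_lim_inner lim trunc_lim L)
  ultimately show ?thesis by (rule tendsto_unique[OF trivial_limit_at_top_linorder])
qed

section \<open>Parseval, inversion and surjectivity\<close>

lemma L2_norm_add_sq:
  assumes f: "L2 f" and g: "L2 g"
  shows "(L2_norm (\<lambda>x. f x + c * g x))\<^sup>2 = (L2_norm f)\<^sup>2 + (cmod c)\<^sup>2 * (L2_norm g)\<^sup>2
    + 2 * Re (cnj c * (LINT x|lborel. f x * cnj (g x)))"
proof -
  have i: "integrable lborel (\<lambda>x. f x * cnj (g x))" by (intro L2_mult_integrable f L2_cnj g)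
  define p where "p x = Re (cnj c * (f x * cnj (g x)))" for x
  have p: "integrable lborel p"
    unfolding p_def by (rule integrable_Re[OF integrable_mult_right[OF i]])
  have "(cmod (f x + c * g x))\<^sup>2 = (cmod (f x))\<^sup>2 + (cmod c)\<^sup>2 * (cmod (g x))\<^sup>2 + 2 * p x" for x
    unfolding cmod_power2 p_def by (simp add: power2_eq_square algebra_simps)
  then have "(L2_norm (\<lambda>x. f x + c * g x))\<^sup>2 = (LINT x|lborel. (cmod (f x))\<^sup>2 + (cmod c)\<^sup>2 * (cmod
    (g x))\<^sup>2 + 2 * p x)"
    unfolding L2_norm_power2 by simp
  also have "\<dots> = (L2_norm f)\<^sup>2 + (cmod c)\<^sup>2 * (L2_norm g)\<^sup>2 + 2 * (LINT x|lborel. p x)"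
    unfolding L2_norm_power2 using f g p by (simp add: L2_def)
  also have "(LINT x|lborel. p x) = Re (cnj c * (LINT x|lborel. f x * cnj (g x)))"
    unfolding p_def integral_Re[OF integrable_mult_right[OF i]] by simp
  finally show ?thesis .
qed

text \<open>Polarization: Plancherel for \<open>f + c g\<close> yields the real part with
  \<open>c = 1\<close> and the imaginary part with \<open>c = \<i>\<close>.\<close>

lemma has_fourier_parseval:
  assumes f: "has_fourier f F" and g: "has_fourier g G"
  shows "(LINT \<xi>|lborel. F \<xi> * cnj (G \<xi>)) = of_real (2 * pi) * (LINT x|lborel. f x * cnj (g x))"
proof -
  have L: "L2 f" "L2 g" "L2 F" "L2 G" using assms by (auto simp: has_fourier_def)
  have "Re (cnj c * (LINT \<xi>|lborel. F \<xi> * cnj (G \<xi>))) = 2 * pi * Re (cnj c *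
    (LINT x|lborel. f x * cnj (g x)))" for c
  proof -
    have "(L2_norm (\<lambda>x. F x + c * G x))\<^sup>2 = 2 * pi * (L2_norm (\<lambda>x. f x + c * g x))\<^sup>2"
      using has_fourier_plancherel[OF has_fourier_add[OF f has_fourier_cmult[OF g, of c]]]
      by (simp add: power_mult_distrib)
    moreover have "(L2_norm F)\<^sup>2 = 2 * pi * (L2_norm f)\<^sup>2" "(L2_norm G)\<^sup>2 = 2 * pi * (L2_norm g)\<^sup>2"
      using has_fourier_plancherel[OF f] has_fourier_plancherel[OF g] by
        (simp_all add: power_mult_distrib)
    ultimately show ?thesis unfolding L2_norm_add_sq[OF L(3,4)] L2_norm_add_sq[OF L(1,2)]
      by (simp add: algebra_simps)
  qed
  from this[of 1] this[of \<i>] show ?thesis by (simp add: complex_eq_iff)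
qed

lemma L2_weak_eq_AE:
  assumes f: "L2 f" and g: "L2 g"
    and eq: "\<And>h. L2 h \<Longrightarrow> (LINT x|lborel. f x * h x) = (LINT x|lborel. g x * h x)"
  shows "AE x in lborel. f x = g x"
proof -
  define d where "d x = f x - g x" for x
  have d: "L2 d" unfolding d_def by (intro L2_diff f g)
  have "(LINT x|lborel. d x * cnj (d x)) = 0"
  proof -
    define k where "k x = cnj (d x)" for x
    have k: "L2 k" unfolding k_def by (rule L2_cnj[OF d])
    have "(LINT x|lborel. d x * k x) = (LINT x|lborel. f x * k x) - (LINT x|lborel. g x * k x)"
      unfolding d_def left_diff_distrib
      by (intro Bochner_Integration.integral_diff L2_mult_integrable f g k)
    then show ?thesis using eq[OF k] by (simp add: k_def)
  qed
  then have "complex_of_real ((L2_norm d)\<^sup>2) = 0"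
    unfolding L2_norm_power2 by (simp flip: complex_norm_square integral_complex_of_real)
  then have "L2_norm d = 0" by simp
  from L2_norm_eq_0_AE[OF d this] show ?thesis by (simp add: d_def)
qed

text \<open>Conjugation turns the forward transform into the inverse one, so a single transform
  suffices. The identity is tested against an arbitrary \<open>g\<close>: duality moves the
  transform onto \<open>g\<close>, and Parseval takes it off again.\<close>

theorem has_fourier_inversion:
  assumes "has_fourier f F"
  shows "has_fourier (\<lambda>\<xi>. cnj (F \<xi>)) (\<lambda>x. of_real (2 * pi) * cnj (f x))"
proof -
  have L: "L2 f" "L2 F" using assms by (auto simp: has_fourier_def)
  obtain h where h: "has_fourier (\<lambda>\<xi>. cnj (F \<xi>)) h" using has_fourier_exists[OF L2_cnj[OF L(2)]]
    by blast
  have "AE x in lborel. h x = of_real (2 * pi) * cnj (f x)"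
  proof (rule L2_weak_eq_AE)
    fix g assume g: "L2 g"
    then have G: "has_fourier g (fourier g)" by (rule has_fourier_fourier)
    have "(LINT x|lborel. h x * g x) = (LINT x|lborel. cnj (F x) * fourier g x)"
      by (rule has_fourier_duality[OF h G])
    also have "\<dots> = of_real (2 * pi) * (LINT x|lborel. g x * cnj (f x))"
      using has_fourier_parseval[OF G assms] by (simp add: mult.commute)
    also have "\<dots> = (LINT x|lborel. of_real (2 * pi) * cnj (f x) * g x)"
      by (simp only: mult.assoc integral_mult_right_zero mult.commute[of "cnj _"])
    finally show "(LINT x|lborel. h x * g x) = (LINT x|lborel. of_real (2 * pi) * cnj
      (f x) * g x)" .
  qed (use h L in \<open>auto simp: has_fourier_def intro: L2_cmult L2_cnj\<close>)
  then show ?thesis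
    by (intro has_fourier_cong_AE[OF h]) (use L in \<open>auto simp: L2_def\<close>)
qed

text \<open>Up to the factor \<open>1 / (2 * pi)\<close> the preimage is the conjugate of the
  transform of \<open>cnj g\<close>.\<close>

lemma has_fourier_surj:
  assumes g: "L2 g" shows "\<exists>f. has_fourier f g"
proof -
  obtain h where "has_fourier (\<lambda>\<xi>. cnj (g \<xi>)) h" using has_fourier_exists[OF L2_cnj[OF g]] by blast
  from has_fourier_cmult[OF has_fourier_inversion[OF this], of "of_real (1 / (2 * pi))"]
  show ?thesis by (auto simp: mult.assoc[symmetric] simp flip: of_real_mult)
qed

lemma has_fourier_inv_fourier: "L2 g \<Longrightarrow> has_fourier (inv_fourier g) g"
  unfolding inv_fourier_def by (rule someI_ex[OF has_fourier_surj])

lemma has_fourier_multiplier: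
  "multiplier_dom m f \<Longrightarrow> has_fourier (multiplier m f) (\<lambda>\<xi>. m \<xi> * fourier f \<xi>)"
  unfolding multiplier_def multiplier_dom_def by (simp add: has_fourier_inv_fourier)

text \<open>\<open>cnj (ft (cnj F))\<close> is the classical inversion integral, with the opposite
  sign in the exponent. For integrable \<open>F\<close> it leads to sup bounds on
  \<open>f\<close>.\<close>

lemma has_fourier_pointwise:
  assumes f: "has_fourier f F" and F: "integrable lborel F"
  shows "AE x in lborel. of_real (2 * pi) * f x = cnj (ft (\<lambda>\<xi>. cnj (F \<xi>)) x)"
proof -
  have "has_fourier (\<lambda>\<xi>. cnj (F \<xi>)) (ft (\<lambda>\<xi>. cnj (F \<xi>)))"
    using f F by (intro has_fourier_ft L2_cnj) (auto simp: has_fourier_def)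
  from has_fourier_unique[OF has_fourier_inversion[OF f] this]
  show ?thesis
  proof eventually_elim
    case (elim x)
    then have "cnj (of_real (2 * pi) * cnj (f x)) = cnj (ft (\<lambda>\<xi>. cnj (F \<xi>)) x)" by simp
    then show ?case by simp
  qed
qed

lemma has_fourier_bounded:
  assumes f: "has_fourier f F" and F: "integrable lborel F"
  shows "AE x in lborel. cmod (f x) \<le> (LINT \<xi>|lborel. cmod (F \<xi>)) / (2 * pi)"
  using has_fourier_pointwise[OF assms]
proof eventually_elim
  case (elim x)
  have "2 * pi * cmod (f x) = cmod (of_real (2 * pi) * f x)" by (simp add: norm_mult)
  also have "\<dots> \<le> (LINT \<xi>|lborel. cmod (F \<xi>))"
    unfolding elim using ft_bound[of "\<lambda>\<xi>. cnj (F \<xi>)" x] F by simp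
  finally show ?case by (simp add: field_simps)
qed

section \<open>Convolution\<close>

definition conv :: "(real \<Rightarrow> complex) \<Rightarrow> (real \<Rightarrow> complex) \<Rightarrow> real \<Rightarrow> complex" where
  "conv f g \<xi> = (LINT \<eta>|lborel. f (\<xi> - \<eta>) * g \<eta>)"

lemma conv_measurable [measurable]:
  assumes [measurable]: "f \<in> borel_measurable borel" "g \<in> borel_measurable borel"
  shows "conv f g \<in> borel_measurable borel"
  unfolding conv_def by measurable

lemma L2_flip_shift: 
  assumes "L2 f" shows "L2 (\<lambda>\<eta>. f (\<xi> - \<eta>))"
  using L2_shift[OF L2_reflect[OF assms], of \<xi>] by simp

lemma L2_norm_flip_shift: "L2_norm (\<lambda>\<eta>. f (\<xi> - \<eta>)) = L2_norm f"
  using L2_norm_shift[of "\<lambda>x. f (- x)" \<xi>] L2_norm_reflect[of f] by simp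

lemma conv_integrand:
  assumes "L2 f" "L2 g" shows "integrable lborel (\<lambda>\<eta>. f (\<xi> - \<eta>) * g \<eta>)"
  by (rule L2_mult_integrable(1)[OF L2_flip_shift[OF assms(1)] assms(2)])

lemma conv_commute: "conv f g \<xi> = conv g f \<xi>"
proof -
  have "conv f g \<xi> = \<bar>-1\<bar> *\<^sub>R (LINT \<eta>|lborel. f (\<xi> - (\<xi> + (-1) * \<eta>)) * g (\<xi> + (-1) * \<eta>))"
    unfolding conv_def by (rule lborel_integral_real_affine) simp
  then show ?thesis by (simp add: conv_def mult.commute)
qed

lemma conv_bound:
  assumes "L2 f" "L2 g" shows "cmod (conv f g \<xi>) \<le> L2_norm f * L2_norm g"
  using L2_inner_le[OF L2_flip_shift[OF assms(1), of \<xi>] assms(2)]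
  by (simp add: conv_def L2_norm_flip_shift)

lemma integrable_conv_pair:
  fixes f g :: "real \<Rightarrow> complex"
  assumes f: "integrable lborel f" and g: "integrable lborel g"
  shows "integrable (lborel \<Otimes>\<^sub>M lborel) (\<lambda>(\<eta>, \<xi>). f (\<xi> - \<eta>) * g \<eta>)"
proof (rule lborel_pair.Fubini_integrable)
  have [measurable]: "f \<in> borel_measurable borel" "g \<in> borel_measurable borel" using f g by auto
  show "(\<lambda>(\<eta>, \<xi>). f (\<xi> - \<eta>) * g \<eta>) \<in> borel_measurable (lborel \<Otimes>\<^sub>M lborel)" by measurable
  have fs: "integrable lborel (\<lambda>\<xi>. f (\<xi> - \<eta>))" for \<eta>
    using lborel_integrable_real_affine[OF f, of 1 "- \<eta>"] by simp
  have "(LINT \<xi>|lborel. cmod (f (\<xi> - \<eta>))) = (LINT \<xi>|lborel. cmod (f \<xi>))" for \<eta>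
    using lborel_integral_real_affine[of 1 "\<lambda>\<xi>. cmod (f \<xi>)" "- \<eta>"] by simp
  then show "integrable lborel (\<lambda>\<eta>. LINT \<xi>|lborel. norm (case (\<eta>, \<xi>) of (\<eta>, \<xi>) \<Rightarrow> f (\<xi> - \<eta>) * g \<eta>))"
    using g by (simp add: norm_mult)
  show "AE \<eta> in lborel. integrable lborel (\<lambda>\<xi>. case (\<eta>, \<xi>) of (\<eta>, \<xi>) \<Rightarrow> f (\<xi> - \<eta>) * g \<eta>)"
    using fs by simp
qed

lemma integrable_conv:
  assumes "integrable lborel f" "integrable lborel g"
  shows "integrable lborel (conv f g)"
  using lborel_pair.integrable_snd[of "\<lambda>\<eta> \<xi>. f (\<xi> - \<eta>) * g \<eta>", OF integrable_conv_pair[OF assms]]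
  by (simp add: conv_def[abs_def])

lemma integral_conv:
  assumes f: "integrable lborel f" and g: "integrable lborel g"
  shows "(LINT \<xi>|lborel. conv f g \<xi>) = (LINT \<xi>|lborel. f \<xi>) * (LINT \<xi>|lborel. g \<xi>)"
proof -
  have "(LINT \<xi>|lborel. conv f g \<xi>) = (LINT \<eta>|lborel. LINT \<xi>|lborel. f (\<xi> - \<eta>) * g \<eta>)"
    unfolding conv_def by (rule lborel_pair.Fubini_integral[OF integrable_conv_pair[OF f g]])
  also have "\<dots> = (LINT \<eta>|lborel. (LINT \<xi>|lborel. f \<xi>) * g \<eta>)"
    using lborel_integral_real_affine[of 1 f "- _"] by simp
  finally show ?thesis by simp
qed

lemma ft_conv:
  assumes f: "integrable lborel f" and g: "integrable lborel g"
  shows "ft (conv f g) z = ft f z * ft g z"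
proof -
  have "exp (- (\<i> * of_real (\<xi> * z))) * conv f g \<xi>
    = conv (\<lambda>x. exp (- (\<i> * of_real (x * z))) * f x) (\<lambda>x. exp (- (\<i> * of_real
      (x * z))) * g x) \<xi>" for \<xi>
  proof -
    have "exp (- (\<i> * of_real (\<xi> * z))) * (f (\<xi> - \<eta>) * g \<eta>)
      = exp (- (\<i> * of_real ((\<xi> - \<eta>) * z))) * f (\<xi> - \<eta>) * (exp (- (\<i> * of_real
        (\<eta> * z))) * g \<eta>)" for \<eta>
    proof -
      have "exp (- (\<i> * of_real (\<xi> * z))) = exp (- (\<i> * of_real ((\<xi> - \<eta>) * z))) * exp (-
        (\<i> * complex_of_real (\<eta> * z)))"
        unfolding exp_add[symmetric] by (simp add: algebra_simps)
      then show ?thesis by (simp only: mult_ac)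
    qed
    then show ?thesis unfolding conv_def by (simp only: integral_mult_right_zero[symmetric])
  qed
  then show ?thesis
    unfolding ft_def by (simp only: integral_conv ft_integrand f g)
qed

lemma L2_integrable_bounded:
  assumes f: "integrable lborel f" and B: "\<And>x. cmod (f x) \<le> B"
  shows "L2 f"
proof -
  have "integrable lborel (\<lambda>x. (cmod (f x))\<^sup>2)"
    by (rule Bochner_Integration.integrable_bound[of _ "\<lambda>x. B * cmod (f x)"])
      (use f in \<open>auto simp: power2_eq_square intro!: order_trans[OF mult_right_mono[OF B
        norm_ge_zero] abs_ge_self]\<close>)
  then show ?thesis using f by (auto simp: L2_def)
qed

lemma L2_conv:
  assumes "integrable lborel f" "L2 f" "integrable lborel g" "L2 g"
  shows "L2 (conv f g)"
  by (rule L2_integrable_bounded[OF integrable_conv conv_bound]) (use assms in auto)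

lemma cnj_conv: "cnj (conv f g \<xi>) = conv (\<lambda>x. cnj (f x)) (\<lambda>x. cnj (g x)) \<xi>"
  unfolding conv_def by (simp flip: Bochner_Integration.integral_cnj)

text \<open>The transform of a convolution is a product by Fubini; inversion, applied to the
  convolution of the conjugates, reverses the roles.\<close>

lemma has_fourier_mult:
  assumes u: "has_fourier u a" and a: "integrable lborel a"
    and v: "has_fourier v b" and b: "integrable lborel b"
  shows "has_fourier (\<lambda>x. u x * v x) (\<lambda>\<xi>. of_real (1 / (2 * pi)) * conv a b \<xi>)"
proof -
  have L: "L2 a" "L2 b" "L2 u" "L2 v" using u v by (auto simp: has_fourier_def)
  have [measurable]: "u \<in> borel_measurable borel" "v \<in> borel_measurable borel" using L by
    (auto simp: L2_def)
  have c: "integrable lborel (conv a b)" by (rule integrable_conv[OF a b])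
  let ?a = "\<lambda>x. cnj (a x)" and ?b = "\<lambda>x. cnj (b x)"
  have "has_fourier (conv ?a ?b) (ft (conv ?a ?b))"
    using a b L by (intro has_fourier_ft integrable_conv L2_conv L2_cnj) auto
  \<comment> \<open>One factor \<open>2 * pi\<close> each for \<open>u\<close> and \<open>v\<close>,
    because pointwise inversion recovers \<open>2 * pi\<close> times the function.\<close>
  from has_fourier_cmult[OF has_fourier_inversion[OF this], of "of_real (1 / (2 * pi) ^ 2)"]
  have 1: "has_fourier (\<lambda>x. of_real (1 / (2 * pi) ^ 2) * (cnj (ft ?a x) * cnj (ft ?b x)))
     (\<lambda>\<xi>. of_real (1 / (2 * pi) ^ 2) * (of_real (2 * pi) * conv a b \<xi>))"
    using a b by (simp add: ft_conv cnj_conv)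
  show ?thesis
  proof (rule has_fourier_cong_AE[OF 1])
    show "AE x in lborel. of_real (1 / (2 * pi) ^ 2) * (cnj (ft ?a x) * cnj (ft ?b x)) = u x * v x"
      using has_fourier_pointwise[OF u a] has_fourier_pointwise[OF v b]
    proof eventually_elim
      case (elim x)
      show ?case unfolding elim[symmetric] by (simp add: power2_eq_square)
    qed
  qed (use c in \<open>auto simp: power2_eq_square\<close>)
qed

text \<open>Young's inequality read on the physical side: convolution with \<open>a\<close> becomes
  multiplication by a function bounded by the L^1 norm of \<open>a\<close> over
  \<open>2 * pi\<close>, and Plancherel transfers the bound.\<close>

lemma conv_young:
  assumes a: "integrable lborel a" "L2 a" and b: "integrable lborel b" "L2 b"
  shows "L2_norm (conv a b) \<le> (LINT \<xi>|lborel. cmod (a \<xi>)) * L2_norm b"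
proof -
  obtain u v where u: "has_fourier u a" and v: "has_fourier v b"
    using has_fourier_surj a(2) b(2) by blast
  have uv: "has_fourier (\<lambda>x. u x * v x) (\<lambda>\<xi>. of_real (1 / (2 * pi)) * conv a b \<xi>)"
    by (rule has_fourier_mult[OF u a(1) v b(1)])
  define K where "K = (LINT \<xi>|lborel. cmod (a \<xi>)) / (2 * pi)"
  have K0: "0 \<le> K" unfolding K_def by (intro divide_nonneg_nonneg
    Bochner_Integration.integral_nonneg) auto
  have "L2_norm (conv a b) = 2 * pi * L2_norm (\<lambda>\<xi>. of_real (1 / (2 * pi)) * conv a b \<xi>)"
    unfolding L2_norm_cmult by (simp add: norm_divide norm_mult)
  also have "\<dots> = 2 * pi * (sqrt (2 * pi) * L2_norm (\<lambda>x. u x * v x))"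
    by (simp only: has_fourier_plancherel[OF uv])
  also have "L2_norm (\<lambda>x. u x * v x) \<le> L2_norm (\<lambda>x. of_real K * v x)"
  proof (rule L2_norm_mono)
    show "L2 (\<lambda>x. u x * v x)" "L2 (\<lambda>x. of_real K * v x)"
      using uv v by (auto simp: has_fourier_def intro: L2_cmult)
    show "AE x in lborel. cmod (u x * v x) \<le> cmod (of_real K * v x)"
      using has_fourier_bounded[OF u a(1)]
    proof eventually_elim
      case (elim x)
      then show ?case using K0 by (simp add: norm_mult K_def[symmetric] mult_right_mono)
    qed
  qed
  also have "2 * pi * (sqrt (2 * pi) * L2_norm (\<lambda>x. of_real K * v x)) = (LINT \<xi>|lborel. cmod
    (a \<xi>)) * L2_norm b"
    unfolding L2_norm_cmult has_fourier_plancherel[OF v] norm_of_real abs_of_nonneg[OF K0]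
    by (simp add: K_def)
  finally show ?thesis by simp
qed

text \<open>With the convolution opened, the integrand is
  \<open>f (- \<xi>) * g (\<xi> - \<eta>) * h \<eta>\<close>; the substitution of
  \<open>\<eta> - \<xi>\<close> for \<open>\<xi>\<close> exchanges the slots of \<open>f\<close> and
  \<open>g\<close>.\<close>

lemma trilinear_swap:
  assumes f: "L2 f" and g: "L2 g" and h: "integrable lborel h"
  shows "(LINT \<xi>|lborel. f (- \<xi>) * conv g h \<xi>) = (LINT \<xi>|lborel. g (- \<xi>) * conv f h \<xi>)"
proof -
  have [measurable]: "f \<in> borel_measurable borel" "g \<in> borel_measurable borel"
    "h \<in> borel_measurable borel"
    using f g h by (auto simp: L2_def)
  have int: "integrable (lborel \<Otimes>\<^sub>M lborel) (\<lambda>(\<eta>, \<xi>). f (- \<xi>) * g (\<xi> - \<eta>) * h \<eta>)"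
    if f: "L2 f" and g: "L2 g" for f g
  proof (rule lborel_pair.Fubini_integrable)
    have [measurable]: "f \<in> borel_measurable borel" "g \<in> borel_measurable borel"
      using f g by (auto simp: L2_def)
    show "(\<lambda>(\<eta>, \<xi>). f (- \<xi>) * g (\<xi> - \<eta>) * h \<eta>) \<in> borel_measurable (lborel \<Otimes>\<^sub>M lborel)" by measurable
    have gs: "L2 (\<lambda>\<xi>. g (\<xi> - \<eta>))" for \<eta> by (rule L2_shift[OF g])
    have le: "(LINT \<xi>|lborel. cmod (f (- \<xi>)) * cmod (g (\<xi> - \<eta>))) \<le> L2_norm f * L2_norm g" for \<eta>
      using L2_Cauchy_Schwarz[OF L2_reflect[OF f] gs[of \<eta>]]
      by (simp add: L2_norm_reflect L2_norm_shift)
    have "integrable lborel (\<lambda>\<eta>. (LINT \<xi>|lborel. cmod (f (- \<xi>)) * cmod (g (\<xi> - \<eta>))) * cmod (h \<eta>))"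
    proof (rule Bochner_Integration.integrable_bound)
      show "integrable lborel (\<lambda>\<eta>. L2_norm f * L2_norm g * cmod (h \<eta>))" using h by auto
      show "AE \<eta> in lborel. norm ((LINT \<xi>|lborel. cmod (f (- \<xi>)) * cmod (g (\<xi> - \<eta>))) * cmod (h \<eta>))
         \<le> norm (L2_norm f * L2_norm g * cmod (h \<eta>))"
        by (rule AE_I2) (auto simp: abs_mult intro!: mult_right_mono le)
    qed measurable
    then show "integrable lborel (\<lambda>\<eta>. LINT \<xi>|lborel. norm (case (\<eta>, \<xi>) of (\<eta>, \<xi>) \<Rightarrow> f (- \<xi>) * g (\<xi>
      - \<eta>) * h \<eta>))"
      by (simp add: norm_mult)
    show "AE \<eta> in lborel. integrable lborel (\<lambda>\<xi>. case (\<eta>, \<xi>) of (\<eta>, \<xi>) \<Rightarrow> f (- \<xi>) * g (\<xi> - \<eta>) * h \<eta>)"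
      using L2_mult_integrable(1)[OF L2_reflect[OF f] gs] by simp
  qed
  have eq: "(LINT \<xi>|lborel. f (- \<xi>) * conv g h \<xi>) = (LINT \<eta>|lborel. LINT \<xi>|lborel. f (- \<xi>) * g (\<xi>
    - \<eta>) * h \<eta>)"
    if "L2 f" "L2 g" for f g
    using lborel_pair.Fubini_integral[OF int[OF that]]
    by (simp add: conv_def mult.assoc flip: integral_mult_right_zero)
  have "(LINT \<xi>|lborel. f (- \<xi>) * g (\<xi> - \<eta>) * h \<eta>) = (LINT \<xi>|lborel. g (- \<xi>) * f (\<xi>
    - \<eta>) * h \<eta>)" for \<eta>
    by (subst lborel_integral_real_affine[where c="-1" and t="\<eta>"]) (simp_all add: mult_ac)
  then show ?thesis unfolding eq[OF f g] eq[OF g f] by (simp only:)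
qed

text \<open>
  The Fourier form of \<open>\<integral> w\<^sub>x w\<^sup>2 = 0\<close>: the integral \<open>X\<close> satisfies \<open>X = 2 T\<close> by the product rule
  and \<open>X = - T\<close> by moving the factor \<open>\<xi>\<close> to the other end of the trilinear form.
\<close>

lemma trilinear_cancel:
  assumes A: "L2 A" "integrable lborel A" and B: "L2 (\<lambda>\<xi>. of_real \<xi> * A \<xi>)"
  shows "(LINT \<xi>|lborel. of_real \<xi> * A (- \<xi>) * conv A A \<xi>) = 0"
proof -
  let ?B = "\<lambda>\<xi>. of_real \<xi> * A \<xi>"
  define X where "X = (LINT \<xi>|lborel. of_real \<xi> * A (- \<xi>) * conv A A \<xi>)"
  define T where "T = (LINT \<xi>|lborel. A (- \<xi>) * conv ?B A \<xi>)"
  have leibniz: "of_real \<xi> * conv A A \<xi> = 2 * conv ?B A \<xi>" for \<xi>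
  proof -
    have "of_real \<xi> * conv A A \<xi> = (LINT \<eta>|lborel. ?B (\<xi> - \<eta>) * A \<eta> + A (\<xi> - \<eta>) * ?B \<eta>)"
      unfolding conv_def integral_mult_right_zero[symmetric]
      by (intro Bochner_Integration.integral_cong refl) (simp add: algebra_simps)
    also have "\<dots> = conv ?B A \<xi> + conv A ?B \<xi>"
      unfolding conv_def using conv_integrand[OF B A(1), of \<xi>] conv_integrand[OF A(1) B, of \<xi>]
      by (rule Bochner_Integration.integral_add)
    finally show ?thesis using conv_commute[of A ?B \<xi>] by simp
  qed
  have "X = (LINT \<xi>|lborel. 2 * (A (- \<xi>) * conv ?B A \<xi>))"
    unfolding X_def by (intro Bochner_Integration.integral_cong refl) (simp add: mult_ac leibniz)
  then have 1: "X = 2 * T" by (simp add: T_def)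
  have "T = (LINT \<xi>|lborel. ?B (- \<xi>) * conv A A \<xi>)"
    unfolding T_def by (rule trilinear_swap[OF A(1) B A(2)])
  also have "\<dots> = - X" unfolding X_def by (simp flip: integral_minus)
  finally show ?thesis using 1 unfolding X_def[symmetric] by simp
qed

section \<open>Weak derivatives on the Fourier side\<close>

text \<open>A squared positive part is C^1, as \<open>test_function\<close> asks. The centre is
  \<open>y\<close> and the radius of the support is \<open>1 / c\<close>: translations produce all
  characters on the Fourier side, and dilations avoid the zeros of the transform.\<close>

definition bump :: "real \<Rightarrow> real \<Rightarrow> real \<Rightarrow> real" where
  "bump c y x = (max 0 (1 - (c * (x - y))\<^sup>2))\<^sup>2"

definition bump' :: "real \<Rightarrow> real \<Rightarrow> real \<Rightarrow> real" where
  "bump' c y x = 2 * max 0 (1 - (c * (x - y))\<^sup>2) * (- 2 * c\<^sup>2 * (x - y))"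

lemma DERIV_max_0_sq: "((\<lambda>t. (max 0 t)\<^sup>2) has_real_derivative 2 * max 0 t) (at t)"
proof -
  consider "t < 0" | "t = 0" | "0 < t" by linarith
  then show ?thesis
  proof cases
    case 1
    have "((\<lambda>t. 0) has_real_derivative 2 * max 0 t) (at t)" using 1 by simp
    then show ?thesis
      by (rule DERIV_cong_ev[THEN iffD1, rotated -1, OF _ refl _ refl])
        (use eventually_nhds_in_open[of "{..<0}" t] 1 in \<open>auto elim!: eventually_mono\<close>)
  next
    case 3
    have "((\<lambda>t. t\<^sup>2) has_real_derivative 2 * max 0 t) (at t)" 
      using 3 by (auto intro!: derivative_eq_intros)
    then show ?thesis
      by (rule DERIV_cong_ev[THEN iffD1, rotated -1, OF _ refl _ refl])
        (use eventually_nhds_in_open[of "{0<..}" t] 3 in \<open>auto elim!: eventually_mono\<close>)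
  next
    case 2
    have "((\<lambda>h. ((max 0 (0 + h))\<^sup>2 - (max 0 0)\<^sup>2) / h) \<longlongrightarrow> 0) (at (0::real))"
    proof (rule Lim_null_comparison)
      show "\<forall>\<^sub>F h in at 0. norm (((max 0 (0 + h))\<^sup>2 - (max 0 0)\<^sup>2) / h) \<le> \<bar>h\<bar>"
        by (rule always_eventually) (auto simp: max_def power2_eq_square)
      show "((\<lambda>h. \<bar>h\<bar>) \<longlongrightarrow> 0) (at (0::real))"
        by (rule tendsto_rabs_zero) (rule tendsto_ident_at)
    qed
    then show ?thesis unfolding DERIV_def 2 by simp
  qed
qed

lemma DERIV_bump: "(bump c y has_real_derivative bump' c y x) (at x)"
proof -
  have "((\<lambda>x. 1 - (c * (x - y))\<^sup>2) has_real_derivative - 2 * c\<^sup>2 * (x - y)) (at x)"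
    by (auto intro!: derivative_eq_intros simp: power2_eq_square)
  from DERIV_chain2[OF DERIV_max_0_sq this] show ?thesis
    unfolding bump_def[abs_def] bump'_def .
qed

lemma continuous_bump: "continuous_on A (bump c y)" "continuous_on A (bump' c y)"
  unfolding bump_def[abs_def] bump'_def[abs_def] by (intro continuous_intros)+

lemma bump_support:
  assumes c: "0 < c" and x: "\<bar>y\<bar> + 1 / c < \<bar>x\<bar>" shows "bump c y x = 0" "bump' c y x = 0"
proof -
  have "1 / c \<le> \<bar>x - y\<bar>" using x by linarith
  then have "1 \<le> c * \<bar>x - y\<bar>" using c by (simp add: field_simps)
  then have "1 \<le> \<bar>c * (x - y)\<bar>" using c by (simp only: abs_mult abs_of_pos)
  then have "1 \<le> (c * (x - y))\<^sup>2" by (metis one_le_power power2_abs)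
  then show "bump c y x = 0" "bump' c y x = 0" by (auto simp: bump_def bump'_def)
qed

lemma test_function_bump:
  assumes c: "0 < c" shows "test_function (bump c y)" "deriv (bump c y) = bump' c y"
proof -
  show "deriv (bump c y) = bump' c y" by (rule ext) (rule DERIV_imp_deriv[OF DERIV_bump])
  have "{x. bump c y x \<noteq> 0} \<subseteq> {- (\<bar>y\<bar> + 1 / c)..\<bar>y\<bar> + 1 / c}"
  proof
    fix x assume "x \<in> {x. bump c y x \<noteq> 0}"
    then have "\<not> \<bar>y\<bar> + 1 / c < \<bar>x\<bar>" using bump_support(1)[OF c] by auto
    then show "x \<in> {- (\<bar>y\<bar> + 1 / c)..\<bar>y\<bar> + 1 / c}" by auto
  qed
  then have "bounded {x. bump c y x \<noteq> 0}" by (rule bounded_subset[rotated]) simp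
  then have "compact (closure {x. bump c y x \<noteq> 0})" by simp
  moreover have "bump c y C1_differentiable_on UNIV"
    unfolding C1_differentiable_on_def
    using DERIV_bump continuous_bump(2)
    by (intro exI[of _ "bump' c y"]) (simp add: has_real_derivative_iff_has_vector_derivative)
  ultimately show "test_function (bump c y)" by (simp add: test_function_def)
qed

lemma bump_L2:
  assumes c: "0 < c"
  shows "integrable lborel (\<lambda>x. complex_of_real (bump c y x))" "L2 (\<lambda>x. complex_of_real
    (bump c y x))"
    "integrable lborel (\<lambda>x. complex_of_real (bump' c y x))" "L2 (\<lambda>x. complex_of_real (bump' c y x))"
proof -
  have 1: "continuous_on UNIV (\<lambda>x. complex_of_real (bump c y x))" "continuous_on UNIV
    (\<lambda>x. complex_of_real (bump' c y x))"
    by (intro continuous_intros continuous_bump)+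
  have 2: "\<bar>y\<bar> + 1 / c < \<bar>x\<bar> \<Longrightarrow> complex_of_real (bump c y x) = 0" "\<bar>y\<bar> + 1 / c < \<bar>x\<bar>
    \<Longrightarrow> complex_of_real (bump' c y x) = 0" for x
    using bump_support[OF c] by auto
  show "integrable lborel (\<lambda>x. complex_of_real (bump c y x))" "L2 (\<lambda>x. complex_of_real
    (bump c y x))"
    "integrable lborel (\<lambda>x. complex_of_real (bump' c y x))" "L2 (\<lambda>x. complex_of_real (bump' c y x))"
    using compact_support_L2[OF 1(1) 2(1)] compact_support_L2[OF 1(2) 2(2)] by metis+
qed

text \<open>Integration by parts, carried out as the fundamental theorem of calculus for the product
  \<open>F\<close> of character and bump, which vanishes at both ends.\<close>

lemma ft_bump':
  assumes c: "0 < c"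
  shows "ft (\<lambda>x. of_real (bump' c y x)) \<xi> = \<i> * of_real \<xi> * ft (\<lambda>x. of_real (bump c y x)) \<xi>"
proof -
  define E where "E x = exp (- (\<i> * of_real \<xi>) * complex_of_real x)" for x
  have E: "exp (- (\<i> * of_real (x * \<xi>))) = E x" for x by (simp add: E_def mult_ac)
  \<comment> \<open>The extra 1 places both end points strictly outside the support, as
    \<open>bump_support\<close> requires.\<close>
  define R where "R = \<bar>y\<bar> + 1 / c + 1"
  have R0: "- R \<le> R" using c by (simp add: R_def field_simps add_nonneg_nonneg)
  define F where "F x = E x * of_real (bump c y x)" for x
  define F' where "F' x = E x * of_real (bump' c y x) - \<i> * of_real \<xi> * (E x * of_real
    (bump c y x))" for x
  have dE: "(E has_vector_derivative - (\<i> * of_real \<xi>) * E x) (at x within S)" for x S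
  proof -
    have "((\<lambda>z. exp (- (\<i> * of_real \<xi>) * z)) has_field_derivative exp (-
      (\<i> * of_real \<xi>) * of_real x) * (- (\<i> * of_real \<xi>))) (at (of_real x))"
      by (auto intro!: derivative_eq_intros)
    from has_vector_derivative_real_field[OF this] show ?thesis
      unfolding E_def by (simp add: mult_ac has_vector_derivative_at_within)
  qed
  have dB: "((\<lambda>x. complex_of_real (bump c y x)) has_vector_derivative of_real (bump' c y x))
    (at x within S)" for x S
    by (rule bounded_linear.has_vector_derivative[OF bounded_linear_of_real], rule
      has_vector_derivative_at_within)
      (use DERIV_bump in \<open>simp add: has_real_derivative_iff_has_vector_derivative\<close>)
  have dF: "(F has_vector_derivative F' x) (at x within S)" for x S
    unfolding F_def F'_def using has_vector_derivative_mult[OF dE[of x S] dB[of x S]]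
    by (simp add: mult_ac)
  have cF': "continuous_on {- R..R} F'"
    unfolding F'_def E_def by (intro continuous_intros continuous_bump)
  have "(LINT x|lborel. indicator {- R..R} x *\<^sub>R F' x) = F R - F (- R)"
    by (rule integral_FTC_Icc[OF R0 dF cF'])
  moreover have "F R = 0" "F (- R) = 0"
    using bump_support(1)[OF c, of y R] bump_support(1)[OF c, of y "- R"] c by
      (auto simp: F_def R_def)
  moreover have "indicator {- R..R} x *\<^sub>R F' x = F' x" for x
  proof (cases "\<bar>y\<bar> + 1 / c < \<bar>x\<bar>")
    case True
    then show ?thesis using bump_support[OF c True] by (simp add: F'_def)
  next
    case False
    then have "x \<in> {- R..R}" by (auto simp: R_def)
    then show ?thesis by simp
  qed
  ultimately have "(LINT x|lborel. F' x) = 0" by simp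
  moreover have "(LINT x|lborel. F' x) = ft (\<lambda>x. of_real (bump' c y x)) \<xi> - \<i> * of_real \<xi> * ft
    (\<lambda>x. of_real (bump c y x)) \<xi>"
    using ft_integrand[OF bump_L2(1)[OF c, of y], of \<xi>, unfolded E] ft_integrand[OF bump_L2(3)[OF
      c, of y], of \<xi>, unfolded E]
    unfolding F'_def ft_def E by simp
  ultimately show ?thesis by simp
qed

lemma ft_bump_scale:
  assumes c: "0 < c"
  shows "ft (\<lambda>x. of_real (bump c y x)) \<xi> = exp (- (\<i> * of_real (y * \<xi>))) * (of_real (1 / c) * ft
    (\<lambda>x. of_real (bump 1 0 x)) (\<xi> / c))"
proof -
  have "ft (\<lambda>x. of_real (bump c y x)) \<xi>
     = \<bar>1 / c\<bar> *\<^sub>R (LINT x|lborel. exp (- (\<i> * of_real ((y + 1 / c * x) * \<xi>))) * of_real (bump c y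
       (y + 1 / c * x)))"
    unfolding ft_def using c by (intro lborel_integral_real_affine) auto
  also have "(LINT x|lborel. exp (- (\<i> * of_real ((y + 1 / c * x) * \<xi>))) * of_real (bump c y (y
    + 1 / c * x)))
     = (LINT x|lborel. exp (- (\<i> * of_real (y * \<xi>))) * (exp (- (\<i> * of_real (x *
       (\<xi> / c)))) * of_real (bump 1 0 x)))"
  proof (intro Bochner_Integration.integral_cong refl)
    fix x
    have "bump c y (y + 1 / c * x) = bump 1 0 x" using c by (simp add: bump_def)
    moreover have "exp (- (\<i> * of_real ((y + 1 / c * x) * \<xi>))) = exp (- (\<i> * of_real
      (y * \<xi>))) * exp (- (\<i> * complex_of_real (x * (\<xi> / c))))"
      unfolding exp_add[symmetric] by (simp add: algebra_simps)
    ultimately show "exp (- (\<i> * of_real ((y + 1 / c * x) * \<xi>))) * of_real (bump c y (y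
      + 1 / c * x))
       = exp (- (\<i> * of_real (y * \<xi>))) * (exp (- (\<i> * of_real (x * (\<xi> / c)))) * of_real
         (bump 1 0 x))"
      by (simp only: mult.assoc)
  qed
  also have "\<dots> = exp (- (\<i> * of_real (y * \<xi>))) * ft (\<lambda>x. of_real (bump 1 0 x)) (\<xi> / c)"
    unfolding ft_def by (rule integral_mult_right_zero)
  finally show ?thesis using c by (simp add: scaleR_conv_of_real mult_ac)
qed

text \<open>Narrow bumps have wide transforms: by scaling, the value at \<open>\<xi>\<close> is
  governed by the transform of \<open>bump 1 0\<close> near frequency 0, where it is the positive
  integral of the bump.\<close>

lemma ft_bump_nonzero: "\<exists>n. ft (\<lambda>x. of_real (bump (real (Suc n)) 0 x)) \<xi> \<noteq> 0"
proof (rule ccontr)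
  let ?P = "ft (\<lambda>x. of_real (bump 1 0 x))"
  assume "\<not> ?thesis"
  then have z: "ft (\<lambda>x. of_real (bump (real (Suc n)) 0 x)) \<xi> = 0" for n by simp
  have "?P (\<xi> / real (Suc n)) = 0" for n
    using z[of n] unfolding ft_bump_scale[OF of_nat_0_less_iff[THEN iffD2, OF zero_less_Suc]] by
      (simp del: of_nat_Suc)
  moreover have "(\<lambda>n. ?P (\<xi> / real (Suc n))) \<longlonglongrightarrow> ?P 0"
  proof (rule isCont_tendsto_compose[OF ft_continuous])
    show "integrable lborel (\<lambda>x. complex_of_real (bump 1 0 x))" by (rule bump_L2) simp
    have "(\<lambda>n. \<xi> * (1 / real (Suc n))) \<longlonglongrightarrow> \<xi> * 0"
      by (intro tendsto_intros LIMSEQ_Suc[OF lim_1_over_n])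
    then show "(\<lambda>n. \<xi> / real (Suc n)) \<longlonglongrightarrow> 0" by simp
  qed
  ultimately have "?P 0 = 0" by (simp add: LIMSEQ_const_iff)
  moreover have "?P 0 = of_real (LINT x|lborel. bump 1 0 x)"
    unfolding ft_def by simp
  ultimately have "(LINT x|lborel. bump 1 0 x) = 0" by simp
  \<comment> \<open>On \<open>[-1/2, 1/2]\<close> the bump is at least
    \<open>(1 - 1/4)^2 = 9/16\<close>.\<close>
  moreover have "(LINT x|lborel. 9 / 16 * indicator {-1/2..1/2::real} x) \<le>
    (LINT x|lborel. bump 1 0 x)"
  proof (rule integral_mono)
    show "integrable lborel (\<lambda>x. 9 / 16 * indicator {-1/2..1/2::real} x :: real)"
      by (intro integrable_mult_right integrable_indicator_Icc)
    show "integrable lborel (bump 1 0)"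
      using integrable_Re[OF bump_L2(1)[of 1 0]] by simp
    fix x :: real
    show "9 / 16 * indicator {-1/2..1/2::real} x \<le> bump 1 0 x"
    proof (cases "x \<in> {-1/2..1/2::real}")
      case True
      then have "x\<^sup>2 \<le> (1/2)\<^sup>2" by (intro power2_le_iff_abs_le[THEN iffD2]) auto
      then have "3 / 4 \<le> max 0 (1 - x\<^sup>2)" by (simp add: power2_eq_square)
      then have "(3 / 4)\<^sup>2 \<le> (max 0 (1 - x\<^sup>2))\<^sup>2" by (rule power_mono) simp
      then show ?thesis using True by (simp add: bump_def power2_eq_square)
    qed (simp add: bump_def)
  qed
  moreover have "(LINT x|lborel. 9 / 16 * indicator {-1/2..1/2::real} x) = (9 / 16 :: real)" by simp
  ultimately show False by simp
qed

text \<open>Testing with every translate of one bump says that the transform of \<open>k\<close>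
  vanishes at every point, and Plancherel then kills \<open>k\<close>. Dividing by the transform of
  the bump requires it to be nonzero, which some scale achieves at each frequency.\<close>

theorem weak_deriv_fourier:
  assumes w: "has_weak_deriv f g" and f: "has_fourier f F" and g: "has_fourier g G"
  shows "AE \<xi> in lborel. G \<xi> = \<i> * of_real \<xi> * F \<xi>"
proof -
  have L: "L2 F" "L2 G" "L2 f" "L2 g" using f g by (auto simp: has_fourier_def)
  have [measurable]: "F \<in> borel_measurable borel" "G \<in> borel_measurable borel" using L by
    (auto simp: L2_def)
  define P where "P c y = ft (\<lambda>x. of_real (bump c y x))" for c y
  define P' where "P' c y = ft (\<lambda>x. of_real (bump' c y x))" for c y
  have key: "AE \<xi> in lborel. (G \<xi> - \<i> * of_real \<xi> * F \<xi>) * cnj (P c 0 \<xi>) = 0" if c: "0 < c" for c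
  proof -
    have hf: "has_fourier (\<lambda>x. of_real (bump c y x)) (P c y)" "has_fourier (\<lambda>x. of_real
      (bump' c y x)) (P' c y)" for y
      unfolding P_def P'_def by (intro has_fourier_ft bump_L2 c)+
    \<comment> \<open>Products of two L^2 functions of which one is bounded: \<open>k\<close> lies
      in both L^1 and L^2, so \<open>plancherel_ft\<close> applies to it.\<close>
    define k where "k \<xi> = G \<xi> * cnj (P c 0 \<xi>) + F \<xi> * cnj (P' c 0 \<xi>)" for \<xi>
    have PL: "L2 (\<lambda>\<xi>. cnj (P c y \<xi>))" "L2 (\<lambda>\<xi>. cnj (P' c y \<xi>))" for y
      using hf[of y] by (auto simp: has_fourier_def intro: L2_cnj)
    have k_int: "integrable lborel k"
      unfolding k_def by (intro Bochner_Integration.integrable_add L2_mult_integrable L PL)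
    have b: "cmod (P c 0 \<xi>) \<le> (LINT x|lborel. cmod (of_real (bump c 0 x)))" "cmod (P' c 0 \<xi>) \<le>
      (LINT x|lborel. cmod (of_real (bump' c 0 x)))" for \<xi>
      unfolding P_def P'_def by (intro ft_bound bump_L2 c)+
    have [measurable]: "P c 0 \<in> borel_measurable borel" "P' c 0 \<in> borel_measurable borel"
      using hf[of 0] by (auto simp: has_fourier_def L2_def)
    have "L2 (\<lambda>\<xi>. G \<xi> * cnj (P c 0 \<xi>))"
      by (rule L2_dominated[OF _ L(2), where c="LINT x|lborel. cmod (of_real (bump c 0 x))"])
        (use b in \<open>auto simp: norm_mult mult.commute[of "cmod (G _)"] intro: mult_right_mono\<close>)
    moreover have "L2 (\<lambda>\<xi>. F \<xi> * cnj (P' c 0 \<xi>))"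
      by (rule L2_dominated[OF _ L(1), where c="LINT x|lborel. cmod (of_real (bump' c 0 x))"])
        (use b in \<open>auto simp: norm_mult mult.commute[of "cmod (F _)"] intro: mult_right_mono\<close>)
    ultimately have k_L2: "L2 k" unfolding k_def by (rule L2_add)
    have "ft k y = 0" for y
    proof -
      \<comment> \<open>Translating the bump by \<open>-y\<close> multiplies its conjugated
        transform by the character at \<open>y\<close>, so the tested identity becomes
        \<open>ft k y = 0\<close>.\<close>
      have t: "cnj (P c (-y) \<xi>) = exp (- (\<i> * of_real (\<xi> * y))) * cnj (P c 0 \<xi>)"
        "cnj (P' c (-y) \<xi>) = exp (- (\<i> * of_real (\<xi> * y))) * cnj (P' c 0 \<xi>)" for \<xi>
        unfolding P_def P'_def ft_bump'[OF c] ft_bump_scale[OF c, of "-y"] ft_bump_scale[OF c, of 0]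
        by (simp_all add: exp_cnj mult_ac)
      have "(LINT x|lborel. f x * of_real (bump' c (-y) x)) = - (LINT x|lborel. g x * of_real
        (bump c (-y) x))"
        using w[unfolded has_weak_deriv_def, rule_format, OF test_function_bump(1)[OF c, of "-y"]]
        by (simp only: test_function_bump(2)[OF c])
      moreover have "(LINT \<xi>|lborel. F \<xi> * cnj (P' c (-y) \<xi>)) = of_real (2 * pi) *
        (LINT x|lborel. f x * of_real (bump' c (-y) x))"
        using has_fourier_parseval[OF f hf(2)[of "-y"]] by simp
      moreover have "(LINT \<xi>|lborel. G \<xi> * cnj (P c (-y) \<xi>)) = of_real (2 * pi) *
        (LINT x|lborel. g x * of_real (bump c (-y) x))"
        using has_fourier_parseval[OF g hf(1)[of "-y"]] by simp
      ultimately have "(LINT \<xi>|lborel. G \<xi> * cnj (P c (-y) \<xi>)) + (LINT \<xi>|lborel. F \<xi> * cnj (P' c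
        (-y) \<xi>)) = 0"
        by simp
      also have "(LINT \<xi>|lborel. G \<xi> * cnj (P c (-y) \<xi>)) + (LINT \<xi>|lborel. F \<xi> * cnj (P' c (-y) \<xi>))
        = (LINT \<xi>|lborel. G \<xi> * cnj (P c (-y) \<xi>) + F \<xi> * cnj (P' c (-y) \<xi>))"
        by (intro Bochner_Integration.integral_add[symmetric] L2_mult_integrable L PL)
      also have "\<dots> = ft k y"
        unfolding t k_def ft_def by (intro Bochner_Integration.integral_cong refl)
          (simp only: distrib_left mult_ac)
      finally show ?thesis .
    qed
    then have "ft k = (\<lambda>_. 0)" by auto
    then have "L2_norm k = 0" using plancherel_ft[OF k_int k_L2] by simp
    from L2_norm_eq_0_AE[OF k_L2 this] show ?thesis
    proof eventually_elim
      case (elim \<xi>)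
      then show ?case
        by (simp add: k_def P'_def P_def ft_bump'[OF c] algebra_simps)
    qed
  qed
  \<comment> \<open>Only countably many scales are used, so the exceptional null sets can be
    united.\<close>
  have "AE \<xi> in lborel. \<forall>n. (G \<xi> - \<i> * of_real \<xi> * F \<xi>) * cnj (P (real (Suc n)) 0 \<xi>) = 0"
    unfolding AE_all_countable by (intro allI key) simp
  then show ?thesis
  proof eventually_elim
    case (elim \<xi>)
    obtain n where "P (real (Suc n)) 0 \<xi> \<noteq> 0" using ft_bump_nonzero[of \<xi>] by (auto simp: P_def)
    then show ?case using elim[rule_format, of n] by simp
  qed
qed

text \<open>\<open>weak_deriv\<close> is just some function with the right property, but its
  transform is determined almost everywhere by that of \<open>f\<close>; this makes
  \<open>H1_norm\<close> computable.\<close>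

lemma H1_norm_fourier:
  assumes H: "H1 f" and f: "has_fourier f F"
  shows "L2 (\<lambda>\<xi>. of_real \<xi> * F \<xi>)"
    and "2 * pi * (H1_norm f)\<^sup>2 = (L2_norm F)\<^sup>2 + (L2_norm (\<lambda>\<xi>. of_real \<xi> * F \<xi>))\<^sup>2"
proof -
  have "\<exists>g. L2 g \<and> has_weak_deriv f g" using H by (simp add: H1_def)
  then have g: "L2 (weak_deriv f)" "has_weak_deriv f (weak_deriv f)"
    unfolding weak_deriv_def by (metis (mono_tags, lifting) someI_ex)+
  have L: "L2 f" "L2 F" using f by (auto simp: has_fourier_def)
  have [measurable]: "F \<in> borel_measurable borel" using L by (auto simp: L2_def)
  obtain G where G: "has_fourier (weak_deriv f) G" using has_fourier_exists[OF g(1)] by blast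
  then have GL: "L2 G" by (simp add: has_fourier_def)
  have ae: "AE \<xi> in lborel. G \<xi> = \<i> * of_real \<xi> * F \<xi>" by (rule weak_deriv_fourier[OF g(2) f G])
  have iF: "L2 (\<lambda>\<xi>. \<i> * of_real \<xi> * F \<xi>)" by (rule L2_cong_AE[OF GL _ ae]) simp
  from L2_cmult[OF this, of "- \<i>"] show 1: "L2 (\<lambda>\<xi>. of_real \<xi> * F \<xi>)" by
    (simp add: mult.assoc[symmetric])
  have "L2_norm G = L2_norm (\<lambda>\<xi>. of_real \<xi> * F \<xi>)"
    by (rule L2_norm_cong_AE) (use GL ae in \<open>auto simp: L2_def norm_mult elim!: eventually_mono\<close>)
  moreover have "2 * pi * (L2_norm (weak_deriv f))\<^sup>2 = (L2_norm G)\<^sup>2" "2 * pi * (L2_norm f)\<^sup>2 =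
    (L2_norm F)\<^sup>2"
    using has_fourier_plancherel[OF G] has_fourier_plancherel[OF f] by
      (simp_all add: power_mult_distrib)
  moreover have "(H1_norm f)\<^sup>2 = (L2_norm f)\<^sup>2 + (L2_norm (weak_deriv f))\<^sup>2"
    using L(1) g(1) unfolding H1_norm_def L2_norm_power2 by (subst real_sqrt_pow2)
      (auto simp: L2_def)
  ultimately show "2 * pi * (H1_norm f)\<^sup>2 = (L2_norm F)\<^sup>2 + (L2_norm (\<lambda>\<xi>. of_real \<xi> * F \<xi>))\<^sup>2"
    by (simp add: distrib_left)
qed

text \<open>Subtracting the two tested identities splits integrals, so the work lies in showing that
  \<open>\<psi>\<close> and its derivative are in L^2.\<close>

lemma H1_diff:
  assumes "H1 f" "H1 g" shows "H1 (\<lambda>x. f x - g x)"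
proof -
  obtain f' g' where f': "L2 f'" "has_weak_deriv f f'" and g': "L2 g'"
    "has_weak_deriv g g'" and L: "L2 f" "L2 g"
    using assms by (auto simp: H1_def)
  have "has_weak_deriv (\<lambda>x. f x - g x) (\<lambda>x. f' x - g' x)"
    unfolding has_weak_deriv_def
  proof (intro allI impI)
    fix \<psi> assume t: "test_function \<psi>"
    then obtain D where D: "\<And>x. (\<psi> has_vector_derivative D x) (at x)" "continuous_on UNIV D"
      and cpt: "compact (closure {x. \<psi> x \<noteq> 0})"
      by (auto simp: test_function_def C1_differentiable_on_def)
    have dD: "deriv \<psi> x = D x" for x
      using D(1)[of x] by (intro DERIV_imp_deriv)
        (simp add: has_real_derivative_iff_has_vector_derivative)
    obtain R where R: "\<And>x. x \<in> closure {x. \<psi> x \<noteq> 0} \<Longrightarrow> \<bar>x\<bar> \<le> R"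
      using compact_imp_bounded[OF cpt] by (auto simp: bounded_iff)
    have z: "\<psi> x = 0" if "R < \<bar>x\<bar>" for x
      using R[of x] that closure_subset[of "{x. \<psi> x \<noteq> 0}"] by fastforce
    \<comment> \<open>\<open>test_function\<close> restricts the support of \<open>\<psi>\<close>;
      the derivative vanishes wherever \<open>\<psi>\<close> is locally zero.\<close>
    have z': "D x = 0" if "R < \<bar>x\<bar>" for x
    proof -
      have "open {x::real. R < \<bar>x\<bar>}" by (intro open_Collect_less continuous_intros)
      then have "(\<psi> has_vector_derivative 0) (at x)"
        by (rule has_vector_derivative_transform_within_open[of "\<lambda>x. 0", rotated]) (use that z
          in auto)
      then show ?thesis using D(1)[of x] by (rule vector_derivative_unique_at[symmetric])
    qed
    have "continuous_on UNIV \<psi>"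
      using D(1) by (intro continuous_at_imp_continuous_on ballI has_vector_derivative_continuous)
    then have c: "continuous_on UNIV (\<lambda>x. complex_of_real (\<psi> x))" "continuous_on UNIV
      (\<lambda>x. complex_of_real (D x))"
      using D(2) by (auto intro: continuous_intros)
    have pL: "L2 (\<lambda>x. complex_of_real (\<psi> x))" "L2 (\<lambda>x. complex_of_real (D x))"
      using compact_support_L2[OF c(1), of R] compact_support_L2[OF c(2), of R] z z' by
        (metis of_real_0)+
    show "(LINT x|lborel. (f x - g x) * of_real (deriv \<psi> x)) = - (LINT x|lborel. (f' x
      - g' x) * of_real (\<psi> x))"
      using f'(2)[unfolded has_weak_deriv_def, rule_format, OF t] g'(2)[unfolded
        has_weak_deriv_def, rule_format, OF t]
        L f'(1) g'(1) pL unfolding dD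
      by (simp add: left_diff_distrib L2_mult_integrable)
  qed
  then show ?thesis using L f' g' by (auto simp: H1_def intro: L2_diff)
qed

section \<open>The flux of the modified energy\<close>

text \<open>A majorant of \<open>tanh (s * \<xi>) / \<xi>\<close> whose square is proportional to a
  Cauchy density, so that its L^2 norm is explicit and scales like \<open>sqrt s\<close>. With
  \<open>s = 1\<close> it also gives the embedding of weighted L^2 into L^1.\<close>

definition lorentz :: "real \<Rightarrow> real \<Rightarrow> complex" where
  "lorentz s \<xi> = of_real (sqrt 2 * s / sqrt (1 + (s * \<xi>)\<^sup>2))"

lemma lorentz_L2:
  assumes s: "0 < s"
  shows "L2 (lorentz s)" and "L2_norm (lorentz s) = sqrt (2 * pi * s)"
proof -
  have i: "integrable lborel (\<lambda>x::real. inverse (1 + x\<^sup>2))"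
    using integrable_inverse_1_plus_square by (simp add: set_integrable_def)
  have I: "(LINT x|lborel. inverse (1 + x\<^sup>2)) = pi"
    using LBINT_inverse_1_plus_square by (simp add:
      interval_lebesgue_integral_def set_lebesgue_integral_def)
  have scaled: "integrable lborel (\<lambda>\<xi>. inverse (1 + (s * \<xi>)\<^sup>2))"
    using lborel_integrable_real_affine[OF i, of s 0] s by simp
  have "pi = \<bar>s\<bar> *\<^sub>R (LINT \<xi>|lborel. inverse (1 + (0 + s * \<xi>)\<^sup>2))"
    unfolding I[symmetric] by (rule lborel_integral_real_affine) (use s in simp)
  then have Is: "s * (LINT \<xi>|lborel. inverse (1 + (s * \<xi>)\<^sup>2)) = pi" using s by simp
  have sq: "(cmod (lorentz s \<xi>))\<^sup>2 = 2 * s\<^sup>2 * inverse (1 + (s * \<xi>)\<^sup>2)" for \<xi>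
    unfolding lorentz_def norm_of_real by (simp add: power_mult_distrib power_divide field_simps)
  have "integrable lborel (\<lambda>\<xi>. (cmod (lorentz s \<xi>))\<^sup>2)" unfolding sq using scaled by simp
  moreover have "lorentz s \<in> borel_measurable borel" unfolding lorentz_def by measurable
  ultimately show "L2 (lorentz s)" by (simp add: L2_def)
  have "(LINT \<xi>|lborel. (cmod (lorentz s \<xi>))\<^sup>2) = 2 * s * (s * (LINT \<xi>|lborel. inverse (1 +
    (s * \<xi>)\<^sup>2)))"
    unfolding sq by (simp add: power2_eq_square)
  then show "L2_norm (lorentz s) = sqrt (2 * pi * s)" unfolding L2_norm_def Is by
    (simp add: mult_ac)
qed

lemma integral_le_lorentz:
  assumes s: "0 < s" and f[measurable]: "f \<in> borel_measurable borel" and g: "L2 g"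
    and le: "\<And>\<xi>. cmod (f \<xi>) \<le> cmod (lorentz s \<xi>) * cmod (g \<xi>)"
  shows "integrable lborel f" and "(LINT \<xi>|lborel. cmod (f \<xi>)) \<le> sqrt (2 * pi * s) * L2_norm g"
proof -
  have i: "integrable lborel (\<lambda>\<xi>. cmod (lorentz s \<xi>) * cmod (g \<xi>))"
    by (rule L2_mult_integrable(2)[OF lorentz_L2(1)[OF s] g])
  show fi: "integrable lborel f"
    by (rule Bochner_Integration.integrable_bound[OF i]) (use le in auto)
  have "(LINT \<xi>|lborel. cmod (f \<xi>)) \<le> (LINT \<xi>|lborel. cmod (lorentz s \<xi>) * cmod (g \<xi>))"
    by (intro integral_mono integrable_norm fi i le)
  also have "\<dots> \<le> sqrt (2 * pi * s) * L2_norm g"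
    using L2_Cauchy_Schwarz[OF lorentz_L2(1)[OF s] g] by (simp add: lorentz_L2(2)[OF s])
  finally show "(LINT \<xi>|lborel. cmod (f \<xi>)) \<le> sqrt (2 * pi * s) * L2_norm g" .
qed

lemma integrable_of_weighted_L2:
  assumes A: "L2 A" and B: "L2 (\<lambda>\<xi>. of_real \<xi> * A \<xi>)"
  shows "integrable lborel A"
    and "(LINT \<xi>|lborel. cmod (A \<xi>)) \<le> sqrt (2 * pi) * (L2_norm A + L2_norm (\<lambda>\<xi>. of_real \<xi> * A \<xi>))"
proof -
  \<comment> \<open>The factor \<open>1 + \<i> * \<xi>\<close> has modulus
    \<open>sqrt (1 + \<xi>^2)\<close>, so one Cauchy-Schwarz step covers both norms.\<close>
  let ?g = "\<lambda>\<xi>. A \<xi> + \<i> * (of_real \<xi> * A \<xi>)"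
  have [measurable]: "A \<in> borel_measurable borel" using A by (simp add: L2_def)
  have g: "L2 ?g" by (intro L2_add L2_cmult A B)
  have le: "cmod (A \<xi>) \<le> cmod (lorentz 1 \<xi>) * cmod (?g \<xi>)" for \<xi>
  proof -
    have "?g \<xi> = Complex 1 \<xi> * A \<xi>" by (simp add: Complex_eq algebra_simps)
    then have "cmod (?g \<xi>) = sqrt (1 + \<xi>\<^sup>2) * cmod (A \<xi>)" by
      (simp only: norm_mult complex_norm) simp
    moreover have "cmod (lorentz 1 \<xi>) = sqrt 2 / sqrt (1 + \<xi>\<^sup>2)"
      unfolding lorentz_def norm_of_real by simp
    moreover have "sqrt (1 + \<xi>\<^sup>2) \<noteq> 0" by (simp add: add_nonneg_eq_0_iff)
    ultimately have "cmod (lorentz 1 \<xi>) * cmod (?g \<xi>) = sqrt 2 * cmod (A \<xi>)" by simp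
    then show ?thesis by (simp add: mult_le_cancel_right1)
  qed
  have "L2_norm ?g \<le> L2_norm A + L2_norm (\<lambda>\<xi>. of_real \<xi> * A \<xi>)"
    using L2_norm_triangle[OF A L2_cmult[OF B, of \<i>]] by (simp only: L2_norm_cmult) simp
  then show "integrable lborel A"
    and "(LINT \<xi>|lborel. cmod (A \<xi>)) \<le> sqrt (2 * pi) * (L2_norm A + L2_norm (\<lambda>\<xi>. of_real \<xi> * A \<xi>))"
    using integral_le_lorentz[OF zero_less_one _ g le]
    by (auto intro: order_trans mult_left_mono)
qed

section \<open>Elementary inequalities for \<open>sinh\<close>, and the transforms attached to
  \<open>I\<close>\<close>

lemma abs_sinh_le_cosh: "\<bar>sinh x\<bar> \<le> cosh (x::real)"
  using sinh_le_cosh_real[of "\<bar>x\<bar>"] by simp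

text \<open>The difference \<open>y * cosh y - sinh y\<close> vanishes at 0 and has derivative
  \<open>y * sinh y\<close>.\<close>

lemma abs_sinh_le_mult_cosh: "\<bar>sinh x\<bar> \<le> \<bar>x\<bar> * cosh (x::real)"
proof -
  have *: "sinh y \<le> y * cosh y" if "0 \<le> y" for y :: real
  proof -
    have "(\<lambda>y. y * cosh y - sinh y) 0 \<le> (\<lambda>y. y * cosh y - sinh y) y"
    proof (rule DERIV_nonneg_imp_nondecreasing[OF that])
      fix z :: real assume "0 \<le> z" "z \<le> y"
      then show "\<exists>d. ((\<lambda>y. y * cosh y - sinh y) has_real_derivative d) (at z) \<and> 0 \<le> d"
        by (intro exI[of _ "z * sinh z"]) (auto intro!: derivative_eq_intros)
    qed
    then show ?thesis by simp
  qed
  show ?thesis using *[of "\<bar>x\<bar>"] by simp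
qed

text \<open>A smooth form of \<open>|tanh x| \<le> min 1 |x|\<close>: the quotient
  \<open>|x| / sqrt (1 + x^2)\<close> is comparable to the minimum, and \<open>sqrt 2\<close> is the
  loss at \<open>|x| = 1\<close>.\<close>

lemma abs_sinh_le_lorentz: "\<bar>sinh x\<bar> \<le> sqrt 2 * \<bar>x\<bar> / sqrt (1 + x\<^sup>2) * cosh (x::real)"
proof -
  have pos: "0 < sqrt (1 + x\<^sup>2)" by (simp add: add_pos_nonneg)
  show ?thesis
  proof (cases "\<bar>x\<bar> \<le> 1")
    case True
    then have "x\<^sup>2 \<le> 1" by (simp add: abs_le_square_iff[of x 1, simplified])
    then have "sqrt (1 + x\<^sup>2) \<le> sqrt 2" by simp
    then have "\<bar>x\<bar> * 1 \<le> \<bar>x\<bar> * (sqrt 2 / sqrt (1 + x\<^sup>2))" using pos by (intro mult_left_mono) auto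
    then have "\<bar>x\<bar> * cosh x \<le> sqrt 2 * \<bar>x\<bar> / sqrt (1 + x\<^sup>2) * cosh x"
      by (intro mult_right_mono) (auto simp: mult_ac)
    with abs_sinh_le_mult_cosh[of x] show ?thesis by linarith
  next
    case False
    then have "1 \<le> x\<^sup>2" by (simp add: abs_le_square_iff[of 1 x, simplified, symmetric])
    then have "sqrt (1 + x\<^sup>2) \<le> sqrt (2 * x\<^sup>2)" by simp
    also have "\<dots> = sqrt 2 * \<bar>x\<bar>" by (simp add: real_sqrt_mult)
    finally have "1 \<le> sqrt 2 * \<bar>x\<bar> / sqrt (1 + x\<^sup>2)" using pos by simp
    then have "1 * cosh x \<le> sqrt 2 * \<bar>x\<bar> / sqrt (1 + x\<^sup>2) * cosh x"
      by (intro mult_right_mono) auto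
    with abs_sinh_le_cosh[of x] show ?thesis by linarith
  qed
qed

definition fhat :: "(real \<Rightarrow> real) \<Rightarrow> real \<Rightarrow> complex" where
  "fhat f = fourier (\<lambda>x. of_real (f x))"

definition Ihat :: "real \<Rightarrow> (real \<Rightarrow> real) \<Rightarrow> real \<Rightarrow> complex" where
  "Ihat \<sigma> f \<xi> = of_real (cosh (\<sigma> * \<xi>)) * fhat f \<xi>"

text \<open>This is the transform of \<open>v\<close>: \<open>tanh (\<sigma> * \<xi>)\<close> times
  \<open>Ihat\<close>, written without the quotient.\<close>

definition Shat :: "real \<Rightarrow> (real \<Rightarrow> real) \<Rightarrow> real \<Rightarrow> complex" where
  "Shat \<sigma> f \<xi> = of_real (sinh (\<sigma> * \<xi>)) * fhat f \<xi>"

lemma I_symbol_cosh: "I_symbol \<sigma> \<xi> = of_real (cosh (\<sigma> * \<xi>))"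
  by (simp add: I_symbol_def cosh_field_def)

section \<open>Bounds for a single function \<open>f\<close> with \<open>I f\<close> in H^1\<close>

context
  fixes \<sigma> :: real and f :: "real \<Rightarrow> real"
  assumes I: "I_in_H1 \<sigma> f"
begin

lemma f_L2: "L2 (\<lambda>x. complex_of_real (f x))"
  using I by (simp add: I_in_H1_def multiplier_dom_def)

lemma has_fourier_fhat: "has_fourier (\<lambda>x. of_real (f x)) (fhat f)"
  unfolding fhat_def by (rule has_fourier_fourier[OF f_L2])

lemma fhat_L2: "L2 (fhat f)"
  using has_fourier_fhat by (simp add: has_fourier_def)

lemma fhat_measurable [measurable]: "fhat f \<in> borel_measurable borel"
  using fhat_L2 by (simp add: L2_def)

lemma Ihat_measurable [measurable]: "Ihat \<sigma> f \<in> borel_measurable borel"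
  unfolding Ihat_def[abs_def] cosh_field_def by measurable

lemma Shat_measurable [measurable]: "Shat \<sigma> f \<in> borel_measurable borel"
  unfolding Shat_def[abs_def] sinh_field_def by measurable

lemma has_fourier_Ihat: "has_fourier (I_op \<sigma> f) (Ihat \<sigma> f)"
proof -
  have "has_fourier (multiplier (I_symbol \<sigma>) (\<lambda>x. of_real (f x))) (\<lambda>\<xi>. I_symbol \<sigma> \<xi> * fourier
    (\<lambda>x. of_real (f x)) \<xi>)"
    using I by (intro has_fourier_multiplier) (simp add: I_in_H1_def)
  then show ?thesis by (simp add: I_op_def Ihat_def[abs_def] fhat_def I_symbol_cosh)
qed

lemma Ihat_L2: "L2 (Ihat \<sigma> f)"
  using has_fourier_Ihat by (simp add: has_fourier_def)

lemma dIhat_L2: "L2 (\<lambda>\<xi>. of_real \<xi> * Ihat \<sigma> f \<xi>)"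
  using H1_norm_fourier(1)[OF _ has_fourier_Ihat] I by (simp add: I_in_H1_def)

lemma energy_Ihat:
  "2 * pi * (H1_norm (I_op \<sigma> f))\<^sup>2 = (L2_norm (Ihat \<sigma> f))\<^sup>2 + (L2_norm
    (\<lambda>\<xi>. of_real \<xi> * Ihat \<sigma> f \<xi>))\<^sup>2"
  using H1_norm_fourier(2)[OF _ has_fourier_Ihat] I by (simp add: I_in_H1_def)

lemma Ihat_norm_le:
  "L2_norm (Ihat \<sigma> f) \<le> sqrt (2 * pi) * H1_norm (I_op \<sigma> f)"
  "L2_norm (\<lambda>\<xi>. of_real \<xi> * Ihat \<sigma> f \<xi>) \<le> sqrt (2 * pi) * H1_norm (I_op \<sigma> f)"
proof -
  have 0: "0 \<le> sqrt (2 * pi) * H1_norm (I_op \<sigma> f)" by (simp add: H1_norm_def)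
  have "(sqrt (2 * pi) * H1_norm (I_op \<sigma> f))\<^sup>2 = (L2_norm (Ihat \<sigma> f))\<^sup>2 + (L2_norm
    (\<lambda>\<xi>. of_real \<xi> * Ihat \<sigma> f \<xi>))\<^sup>2"
    unfolding energy_Ihat[symmetric] by (simp add: power_mult_distrib)
  then show "L2_norm (Ihat \<sigma> f) \<le> sqrt (2 * pi) * H1_norm (I_op \<sigma> f)"
    "L2_norm (\<lambda>\<xi>. of_real \<xi> * Ihat \<sigma> f \<xi>) \<le> sqrt (2 * pi) * H1_norm (I_op \<sigma> f)"
    by (auto intro!: power2_le_imp_le[OF _ 0])
qed

lemma Ihat_integrable: "integrable lborel (Ihat \<sigma> f)"
  by (rule integrable_of_weighted_L2(1)[OF Ihat_L2 dIhat_L2])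

lemma Ihat_L1_le: "(LINT \<xi>|lborel. cmod (Ihat \<sigma> f \<xi>)) \<le> 4 * pi * H1_norm (I_op \<sigma> f)"
proof -
  have "(LINT \<xi>|lborel. cmod (Ihat \<sigma> f \<xi>)) \<le> sqrt (2 * pi) * (sqrt (2 * pi) * H1_norm (I_op \<sigma> f)
    + sqrt (2 * pi) * H1_norm (I_op \<sigma> f))"
    by (rule order_trans[OF integrable_of_weighted_L2(2)[OF Ihat_L2 dIhat_L2] mult_left_mono[OF
      add_mono]])
      (use Ihat_norm_le in auto)
  also have "\<dots> = 2 * (sqrt (2 * pi) * sqrt (2 * pi)) * H1_norm (I_op \<sigma> f)" by
    (simp only: distrib_left)
  also have "\<dots> = 4 * pi * H1_norm (I_op \<sigma> f)" by simp
  finally show ?thesis .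
qed

lemma fhat_le_Ihat: "cmod (fhat f \<xi>) \<le> cmod (Ihat \<sigma> f \<xi>)"
  using cosh_real_ge_1[of "\<sigma> * \<xi>"] by (simp add: Ihat_def norm_mult mult_le_cancel_right1)

lemma fhat_integrable: "integrable lborel (fhat f)"
  by (rule Bochner_Integration.integrable_bound[OF Ihat_integrable]) (auto simp: fhat_le_Ihat)

lemma Shat_le_Ihat: "cmod (Shat \<sigma> f \<xi>) \<le> cmod (Ihat \<sigma> f \<xi>)"
  using abs_sinh_le_cosh[of "\<sigma> * \<xi>"] by (simp add: Ihat_def Shat_def norm_mult mult_right_mono)

lemma Shat_L2: "L2 (Shat \<sigma> f)"
  by (rule L2_dominated[OF Shat_measurable Ihat_L2, of 1]) (simp add: Shat_le_Ihat)

lemma Shat_integrable: "integrable lborel (Shat \<sigma> f)"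
  by (rule Bochner_Integration.integrable_bound[OF Ihat_integrable]) (auto simp: Shat_le_Ihat)

text \<open>\<open>|tanh s| \<le> |s|\<close> trades one derivative for one power of
  \<open>\<sigma>\<close>.\<close>

lemma Shat_L2_le:
  assumes \<sigma>: "0 < \<sigma>" shows "L2_norm (Shat \<sigma> f) \<le> \<sigma> * L2_norm (\<lambda>\<xi>. of_real \<xi> * Ihat \<sigma> f \<xi>)"
proof -
  have "L2_norm (Shat \<sigma> f) \<le> L2_norm (\<lambda>\<xi>. of_real \<sigma> * (of_real \<xi> * Ihat \<sigma> f \<xi>))"
  proof (intro L2_norm_mono Shat_L2 L2_cmult dIhat_L2 AE_I2)
    fix \<xi>
    show "cmod (Shat \<sigma> f \<xi>) \<le> cmod (of_real \<sigma> * (of_real \<xi> * Ihat \<sigma> f \<xi>))"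
      using mult_right_mono[OF abs_sinh_le_mult_cosh[of "\<sigma> * \<xi>"] norm_ge_zero[of "fhat f \<xi>"]]
      by (simp add: Ihat_def Shat_def norm_mult abs_mult mult_ac)
  qed
  then show ?thesis using \<sigma> by (simp only: L2_norm_cmult) simp
qed

text \<open>This stands for the sup norm of \<open>v\<close>. One derivative buys half a power of
  \<open>\<sigma>\<close> here, since the other factor in Cauchy-Schwarz is
  \<open>lorentz \<sigma>\<close>.\<close>

lemma Shat_L1_le:
  assumes \<sigma>: "0 < \<sigma>"
  shows "(LINT \<xi>|lborel. cmod (Shat \<sigma> f \<xi>)) \<le> sqrt (2 * pi * \<sigma>) * L2_norm
    (\<lambda>\<xi>. of_real \<xi> * Ihat \<sigma> f \<xi>)"
proof (rule integral_le_lorentz(2)[OF \<sigma> Shat_measurable dIhat_L2])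
  fix \<xi>
  have "cmod (lorentz \<sigma> \<xi>) = sqrt 2 * \<sigma> / sqrt (1 + (\<sigma> * \<xi>)\<^sup>2)"
    unfolding lorentz_def norm_of_real using \<sigma> by simp
  then show "cmod (Shat \<sigma> f \<xi>) \<le> cmod (lorentz \<sigma> \<xi>) * cmod (of_real \<xi> * Ihat \<sigma> f \<xi>)"
    using mult_right_mono[OF abs_sinh_le_lorentz[of "\<sigma> * \<xi>"] norm_ge_zero[of "fhat f \<xi>"]] \<sigma>
    by (simp add: Ihat_def Shat_def norm_mult abs_mult mult_ac)
qed

text \<open>Up to the factor \<open>1 / (2 * pi)\<close> this is the transform of
  \<open>I (f^2)\<close>, split into the square of \<open>I f\<close> and the square of
  \<open>v\<close>.\<close>

definition Qhat :: "real \<Rightarrow> complex" where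
  "Qhat \<xi> = conv (Ihat \<sigma> f) (Ihat \<sigma> f) \<xi> + conv (Shat \<sigma> f) (Shat \<sigma> f) \<xi>"

text \<open>The addition theorem for \<open>cosh\<close> distributes the symbol of \<open>I\<close> over the convolution.\<close>

lemma cosh_conv: "of_real (cosh (\<sigma> * \<xi>)) * conv (fhat f) (fhat f) \<xi> = Qhat \<xi>"
proof -
  have "of_real (cosh (\<sigma> * \<xi>)) * (fhat f (\<xi> - \<eta>) * fhat f \<eta>)
     = Ihat \<sigma> f (\<xi> - \<eta>) * Ihat \<sigma> f \<eta> + Shat \<sigma> f (\<xi> - \<eta>) * Shat \<sigma> f \<eta>" for \<eta>
  proof -
    have "cosh (\<sigma> * \<xi>) = cosh (\<sigma> * (\<xi> - \<eta>)) * cosh (\<sigma> * \<eta>) + sinh (\<sigma> * (\<xi> - \<eta>)) * sinh (\<sigma> * \<eta>)"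
      unfolding cosh_add[symmetric] by (simp add: algebra_simps)
    then show ?thesis unfolding Ihat_def Shat_def by (simp add: algebra_simps)
  qed
  then show ?thesis
    unfolding Qhat_def conv_def integral_mult_right_zero[symmetric]
    by (simp add: conv_integrand Ihat_L2 Shat_L2)
qed

lemma conv_Ihat_L2: "L2 (conv (Ihat \<sigma> f) (Ihat \<sigma> f))" and conv_Shat_L2: "L2 (conv (Shat \<sigma> f)
  (Shat \<sigma> f))"
  by (intro L2_conv Ihat_integrable Ihat_L2 Shat_integrable Shat_L2)+

lemma Qhat_L2: "L2 Qhat"
  unfolding Qhat_def[abs_def] by (intro L2_add conv_Ihat_L2 conv_Shat_L2)

text \<open>A bound without any gain in \<open>\<sigma>\<close>; it will multiply only the
  high-frequency tail, which is made small separately.\<close>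

lemma Qhat_norm_le: "L2_norm Qhat \<le> 8 * pi * sqrt (2 * pi) * (H1_norm (I_op \<sigma> f))\<^sup>2"
proof -
  let ?h = "H1_norm (I_op \<sigma> f)"
  have h0: "0 \<le> ?h" by (simp add: H1_norm_def)
  have a: "L2_norm (conv (Ihat \<sigma> f) (Ihat \<sigma> f)) \<le> (4 * pi * ?h) * (sqrt (2 * pi) * ?h)"
    by (rule order_trans[OF conv_young mult_mono])
      (use Ihat_integrable Ihat_L2 Ihat_L1_le Ihat_norm_le(1) h0 in auto)
  have s1: "(LINT \<xi>|lborel. cmod (Shat \<sigma> f \<xi>)) \<le> 4 * pi * ?h"
    by (rule order_trans[OF integral_mono Ihat_L1_le])
      (use Shat_integrable Ihat_integrable Shat_le_Ihat in auto)
  have s2: "L2_norm (Shat \<sigma> f) \<le> sqrt (2 * pi) * ?h"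
    by (rule order_trans[OF L2_norm_mono Ihat_norm_le(1)])
      (use Shat_L2 Ihat_L2 Shat_le_Ihat in auto)
  have b: "L2_norm (conv (Shat \<sigma> f) (Shat \<sigma> f)) \<le> (4 * pi * ?h) * (sqrt (2 * pi) * ?h)"
    by (rule order_trans[OF conv_young mult_mono])
      (use Shat_integrable Shat_L2 s1 s2 h0 in auto)
  have "L2_norm Qhat \<le> L2_norm (conv (Ihat \<sigma> f) (Ihat \<sigma> f)) + L2_norm (conv (Shat \<sigma> f) (Shat \<sigma> f))"
    unfolding Qhat_def[abs_def] by (rule L2_norm_triangle[OF conv_Ihat_L2 conv_Shat_L2])
  also have "\<dots> \<le> (4 * pi * ?h) * (sqrt (2 * pi) * ?h) + (4 * pi * ?h) * (sqrt (2 * pi) * ?h)"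
    by (rule add_mono[OF a b])
  also have "\<dots> = 8 * pi * sqrt (2 * pi) * ?h\<^sup>2" by (simp add: power2_eq_square)
  finally show ?thesis .
qed

text \<open>Real functions have hermitian transforms, and \<open>cosh\<close> is even. This replaces
  the conjugate in the flux by the reflection that \<open>trilinear_cancel\<close> expects.\<close>

lemma Ihat_real: "AE \<xi> in lborel. cnj (Ihat \<sigma> f \<xi>) = Ihat \<sigma> f (- \<xi>)"
proof -
  have "has_fourier (\<lambda>x. of_real (f x)) (\<lambda>\<xi>. cnj (fhat f (- \<xi>)))"
    using has_fourier_cnj[OF has_fourier_fhat] by simp
  from has_fourier_unique[OF has_fourier_fhat this] show ?thesis
    by eventually_elim (simp add: Ihat_def)
qed

text \<open>The part of \<open>Qhat\<close> coming from the square of \<open>I f\<close> integrates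
  to zero. On the rest, Cauchy-Schwarz and Young put one \<open>Shat\<close> in L^1 and one in L^2,
  with gains \<open>sqrt \<sigma>\<close> and \<open>\<sigma>\<close>.\<close>

lemma cubic_flux_le:
  assumes \<sigma>: "0 < \<sigma>"
  shows "cmod (LINT \<xi>|lborel. of_real \<xi> * cnj (Ihat \<sigma> f \<xi>) * Qhat \<xi>)
    \<le> \<sigma> * sqrt (2 * pi * \<sigma>) * (L2_norm (\<lambda>\<xi>. of_real \<xi> * Ihat \<sigma> f \<xi>)) ^ 3"
proof -
  let ?A = "Ihat \<sigma> f" and ?S = "Shat \<sigma> f"
  let ?N = "L2_norm (\<lambda>\<xi>. of_real \<xi> * Ihat \<sigma> f \<xi>)"
  have cA: "L2 (\<lambda>\<xi>. of_real \<xi> * cnj (?A \<xi>))"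
    using L2_cnj[OF dIhat_L2] by simp
  have [measurable]: "conv ?A ?A \<in> borel_measurable borel" by measurable
  have "(LINT \<xi>|lborel. of_real \<xi> * cnj (?A \<xi>) * conv ?A ?A \<xi>) = (LINT \<xi>|lborel. of_real \<xi> * ?A
    (- \<xi>) * conv ?A ?A \<xi>)"
    by (rule integral_cong_AE) (use Ihat_real in \<open>auto elim!: eventually_mono\<close>)
  also have "\<dots> = 0" by (rule trilinear_cancel[OF Ihat_L2 Ihat_integrable dIhat_L2])
  finally have eq: "(LINT \<xi>|lborel. of_real \<xi> * cnj (?A \<xi>) * Qhat \<xi>) =
    (LINT \<xi>|lborel. of_real \<xi> * cnj (?A \<xi>) * conv ?S ?S \<xi>)"
    unfolding Qhat_def distrib_left using L2_mult_integrable(1)[OF cA conv_Ihat_L2]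
      L2_mult_integrable(1)[OF cA conv_Shat_L2]
    by simp
  have "cmod (LINT \<xi>|lborel. of_real \<xi> * cnj (?A \<xi>) * Qhat \<xi>) \<le> L2_norm (\<lambda>\<xi>. of_real \<xi> * cnj
    (?A \<xi>)) * L2_norm (conv ?S ?S)"
    unfolding eq by (rule L2_inner_le[OF cA conv_Shat_L2])
  also have "L2_norm (\<lambda>\<xi>. of_real \<xi> * cnj (?A \<xi>)) = ?N"
    using L2_norm_cnj[of "\<lambda>\<xi>. of_real \<xi> * ?A \<xi>"] by simp
  also have "?N * L2_norm (conv ?S ?S) \<le> ?N * ((sqrt (2 * pi * \<sigma>) * ?N) * (\<sigma> * ?N))"
    by (intro mult_left_mono order_trans[OF conv_young[OF Shat_integrable Shat_L2 Shat_integrable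
      Shat_L2]]
        mult_mono Shat_L1_le Shat_L2_le \<sigma>) (use \<sigma> in auto)
  finally show ?thesis by (simp add: power3_eq_cube mult_ac)
qed

end

section \<open>Evolution of the modified energy\<close>

text \<open>With the predicates themselves equal, \<open>SOME\<close> returns the same
  representative; hence \<open>I_op\<close> agrees exactly on functions that are equal only almost
  everywhere.\<close>

lemma has_fourier_AE_eq:
  assumes "L2 f" "L2 g" "AE x in lborel. f x = g x"
  shows "has_fourier f = has_fourier g"
proof -
  have [measurable]: "f \<in> borel_measurable borel" "g \<in> borel_measurable borel"
    using assms by (auto simp: L2_def)
  have "ft (trunc R f) = ft (trunc R g)" for R
    unfolding ft_def using assms(3) by (intro ext integral_cong_AE)
      (auto simp: trunc_def elim!: eventually_mono)
  then show ?thesis using assms by (intro ext) (simp add: has_fourier_iff)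
qed

lemma I_op_cong_AE:
  assumes f: "I_in_H1 \<sigma> f" and g: "I_in_H1 \<sigma> g" and eq: "AE x in lborel. f x = g x"
  shows "I_op \<sigma> f = I_op \<sigma> g"
proof -
  have "has_fourier (\<lambda>x. complex_of_real (f x)) = has_fourier (\<lambda>x. complex_of_real (g x))"
    using eq by (intro has_fourier_AE_eq f_L2[OF f] f_L2[OF g]) (auto elim!: eventually_mono)
  then show ?thesis by (simp add: I_op_def multiplier_def fourier_def)
qed

section \<open>The equation in Fourier variables and the truncated energy\<close>

definition phi :: "real \<Rightarrow> complex" where
  "phi \<xi> = \<i> * of_real \<xi> / of_real (1 + \<xi>\<^sup>2)"

lemma phi_measurable [measurable]: "phi \<in> borel_measurable borel"
  unfolding phi_def[abs_def] by measurable

lemma phi_le: "cmod (phi \<xi>) \<le> 1"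
proof -
  have "\<bar>\<xi>\<bar> \<le> 1 + \<xi>\<^sup>2" using sum_squares_bound[of 1 "\<bar>\<xi>\<bar>"] by simp
  moreover have "cmod (phi \<xi>) = \<bar>\<xi>\<bar> / (1 + \<xi>\<^sup>2)"
    unfolding phi_def norm_divide norm_mult norm_of_real by simp
  ultimately show ?thesis by (simp add: divide_le_eq add_pos_nonneg)
qed

lemma L2_phi: "L2 G \<Longrightarrow> L2 (\<lambda>\<xi>. phi \<xi> * G \<xi>)"
  by (rule L2_dominated[where c=1 and f=G])
    (auto simp: L2_def norm_mult intro: mult_left_le_one_le phi_le)

text \<open>Frees \<open>phi_D\<close> from the representative chosen by \<open>fourier\<close>: any
  transform \<open>G\<close> of \<open>f\<close> will do, in particular the convolution when
  \<open>f\<close> is a square.\<close>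

lemma has_fourier_phi_D:
  assumes f: "has_fourier (\<lambda>x. of_real (f x)) G"
  shows "has_fourier (phi_D f) (\<lambda>\<xi>. phi \<xi> * G \<xi>)"
proof -
  have L: "L2 (\<lambda>x. complex_of_real (f x))" "L2 G" using f by (auto simp: has_fourier_def)
  let ?F = "fourier (\<lambda>x. of_real (f x))"
  have F: "has_fourier (\<lambda>x. of_real (f x)) ?F" by (rule has_fourier_fourier[OF L(1)])
  have "has_fourier (phi_D f) (\<lambda>\<xi>. phi \<xi> * ?F \<xi>)"
    using F L unfolding phi_D_def phi_def[symmetric]
    by (intro has_fourier_multiplier) (simp add: multiplier_dom_def has_fourier_def L2_phi)
  then show ?thesis
  proof (rule has_fourier_cong_AE)
    show "phi_D f \<in> borel_measurable borel" using \<open>has_fourier (phi_D f) _\<close> by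
      (auto simp: has_fourier_def L2_def)
    show "(\<lambda>\<xi>. phi \<xi> * G \<xi>) \<in> borel_measurable borel" using L2_phi[OF L(2)] by (simp add: L2_def)
    show "AE \<xi> in lborel. phi \<xi> * ?F \<xi> = phi \<xi> * G \<xi>"
      using has_fourier_unique[OF F f] by eventually_elim simp
  qed simp
qed

definition bbm_rhs :: "(real \<Rightarrow> real) \<Rightarrow> real \<Rightarrow> complex" where
  "bbm_rhs f \<xi> = - (phi \<xi> * fhat f \<xi> + 1 / 2 * (phi \<xi> * (of_real (1 / (2 * pi)) * conv (fhat f)
    (fhat f) \<xi>)))"

definition cutoff :: "real \<Rightarrow> real \<Rightarrow> complex" where
  "cutoff N \<xi> = indicator {-N..N} \<xi>"

lemma cutoff_measurable [measurable]: "cutoff N \<in> borel_measurable borel"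
  unfolding cutoff_def[abs_def] by measurable

lemma cutoff_le: "cmod (cutoff N \<xi>) \<le> 1" "cmod (1 - cutoff N \<xi>) \<le> 1"
  by (auto simp: cutoff_def indicator_def)

lemma L2_cutoff: "L2 f \<Longrightarrow> L2 (\<lambda>\<xi>. cutoff N \<xi> * f \<xi>)" "L2 f \<Longrightarrow> L2 (\<lambda>\<xi>. (1 - cutoff N \<xi>) * f \<xi>)"
  by (rule L2_dominated[where c=1 and f=f];
      auto simp: L2_def norm_mult intro: mult_left_le_one_le cutoff_le)+

lemma cutoff_tendsto: "(\<lambda>n. cutoff (real n) \<xi>) \<longlonglongrightarrow> 1"
proof (rule tendsto_eventually)
  obtain n where n: "\<bar>\<xi>\<bar> \<le> real n" using real_arch_simple by blast
  show "\<forall>\<^sub>F k in sequentially. cutoff (real k) \<xi> = 1"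
    using eventually_ge_at_top[of n] by eventually_elim (use n in \<open>auto simp: cutoff_def
      indicator_def\<close>)
qed

lemma L2_lim_cutoff: 
  assumes f: "L2 f"
  shows "L2_lim (\<lambda>n \<xi>. cutoff (real n) \<xi> * f \<xi>) f sequentially"
    and "L2_lim (\<lambda>n \<xi>. (1 - cutoff (real n) \<xi>) * f \<xi>) (\<lambda>\<xi>. 0) sequentially"
proof -
  have [measurable]: "f \<in> borel_measurable borel" using f by (simp add: L2_def)
  have "(\<lambda>n. cutoff (real n) \<xi> * f \<xi>) \<longlonglongrightarrow> 1 * f \<xi>" "(\<lambda>n. (1 - cutoff (real n) \<xi>) * f \<xi>) \<longlonglongrightarrow> (1
    - 1) * f \<xi>" for \<xi>
    by (intro tendsto_intros cutoff_tendsto)+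
  then show "L2_lim (\<lambda>n \<xi>. cutoff (real n) \<xi> * f \<xi>) f sequentially"
    "L2_lim (\<lambda>n \<xi>. (1 - cutoff (real n) \<xi>) * f \<xi>) (\<lambda>\<xi>. 0) sequentially"
    using cutoff_le by (auto intro!: L2_lim_dominated[OF f] simp: norm_mult mult_left_le_one_le)
qed

text \<open>The H^1 weight times the squared symbol of \<open>I\<close>, cut off to be bounded so
  that the quadratic form is continuous in L^2, where the time derivative exists. The factor
  \<open>1 + \<xi>^2\<close> also cancels the denominator of \<open>phi\<close>.\<close>

definition energy_weight :: "real \<Rightarrow> real \<Rightarrow> real \<Rightarrow> complex" where
  "energy_weight \<sigma> N \<xi> = cutoff N \<xi> * of_real ((1 + \<xi>\<^sup>2) * (cosh (\<sigma> * \<xi>))\<^sup>2)"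

lemma energy_weight_measurable [measurable]: "energy_weight \<sigma> N \<in> borel_measurable borel"
  unfolding energy_weight_def[abs_def] cosh_field_def by measurable

lemma energy_weight_bounded:
  "cmod (energy_weight \<sigma> N \<xi>) \<le> (1 + N\<^sup>2) * (cosh (\<sigma> * N))\<^sup>2"
proof (cases "\<xi> \<in> {-N..N}")
  case True
  then have x: "\<bar>\<xi>\<bar> \<le> \<bar>N\<bar>" by auto
  then have "\<xi>\<^sup>2 \<le> N\<^sup>2" by (simp add: abs_le_square_iff)
  moreover have "cosh \<bar>\<sigma> * \<xi>\<bar> \<le> cosh \<bar>\<sigma> * N\<bar>"
    using x by (subst cosh_real_nonneg_le_iff) (auto simp: abs_mult mult_left_mono)
  ultimately have "(1 + \<xi>\<^sup>2) * (cosh (\<sigma> * \<xi>))\<^sup>2 \<le> (1 + N\<^sup>2) * (cosh (\<sigma> * N))\<^sup>2"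
    by (intro mult_mono power_mono) auto
  moreover have "cmod (energy_weight \<sigma> N \<xi>) = (1 + \<xi>\<^sup>2) * (cosh (\<sigma> * \<xi>))\<^sup>2"
    using True by (simp add: energy_weight_def cutoff_def norm_mult norm_power del: of_real_mult
      of_real_add)
  ultimately show ?thesis by simp
qed (simp add: energy_weight_def cutoff_def)

lemma cnj_energy_weight: "cnj (energy_weight \<sigma> N \<xi>) = energy_weight \<sigma> N \<xi>"
  by (simp add: energy_weight_def cutoff_def indicator_def)

text \<open>Written with \<open>fhat\<close> rather than \<open>Ihat\<close> because the equation
  controls the difference quotients in time of \<open>fhat\<close>.\<close>

definition trunc_energy :: "real \<Rightarrow> real \<Rightarrow> (real \<Rightarrow> real) \<Rightarrow> real" where
  "trunc_energy \<sigma> N f = Re (LINT \<xi>|lborel. energy_weight \<sigma> N \<xi> * fhat f \<xi> * cnj (fhat f \<xi>))"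

context
  fixes \<sigma> :: real and f :: "real \<Rightarrow> real"
  assumes I: "I_in_H1 \<sigma> f"
begin

lemma trunc_energy_eq:
  "trunc_energy \<sigma> N f = (L2_norm (\<lambda>\<xi>. cutoff N \<xi> * Ihat \<sigma> f \<xi>))\<^sup>2
     + (L2_norm (\<lambda>\<xi>. cutoff N \<xi> * (of_real \<xi> * Ihat \<sigma> f \<xi>)))\<^sup>2"
proof -
  have "energy_weight \<sigma> N \<xi> * fhat f \<xi> * cnj (fhat f \<xi>)
    = complex_of_real ((cmod (cutoff N \<xi> * Ihat \<sigma> f \<xi>))\<^sup>2 + (cmod (cutoff N \<xi> *
      (of_real \<xi> * Ihat \<sigma> f \<xi>)))\<^sup>2)" for \<xi>
  proof -
    have "cutoff N \<xi> = 1 \<or> cutoff N \<xi> = 0" by (simp add: cutoff_def indicator_def)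
    then show ?thesis
    proof
      assume c: "cutoff N \<xi> = 1"
      have "complex_of_real ((cmod (Ihat \<sigma> f \<xi>))\<^sup>2) = of_real ((cosh (\<sigma> * \<xi>))\<^sup>2) * (fhat f \<xi> * cnj
        (fhat f \<xi>))"
        unfolding complex_norm_square Ihat_def by (simp add: power2_eq_square mult_ac)
      then show ?thesis
        by (simp add: c energy_weight_def norm_mult power_mult_distrib distrib_right distrib_left
          mult_ac)
    qed (simp add: energy_weight_def)
  qed
  then have "trunc_energy \<sigma> N f = (LINT \<xi>|lborel. (cmod (cutoff N \<xi> * Ihat \<sigma> f \<xi>))\<^sup>2 + (cmod
    (cutoff N \<xi> * (of_real \<xi> * Ihat \<sigma> f \<xi>)))\<^sup>2)"
    unfolding trunc_energy_def by (simp only: integral_complex_of_real Re_complex_of_real)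
  also have "\<dots> = (L2_norm (\<lambda>\<xi>. cutoff N \<xi> * Ihat \<sigma> f \<xi>))\<^sup>2 + (L2_norm (\<lambda>\<xi>. cutoff N \<xi> *
    (of_real \<xi> * Ihat \<sigma> f \<xi>)))\<^sup>2"
    unfolding L2_norm_power2
    by (intro Bochner_Integration.integral_add L2_sq_integrable L2_cutoff Ihat_L2[OF I]
      dIhat_L2[OF I])
  finally show ?thesis .
qed

lemma trunc_energy_le: "trunc_energy \<sigma> N f \<le> 2 * pi * (H1_norm (I_op \<sigma> f))\<^sup>2"
proof -
  have cut: "L2_norm (\<lambda>\<xi>. cutoff N \<xi> * g \<xi>) \<le> L2_norm g" if "L2 g" for g
    using that cutoff_le by (intro L2_norm_mono L2_cutoff)
      (auto simp: norm_mult mult_left_le_one_le)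
  show ?thesis unfolding trunc_energy_eq energy_Ihat[OF I]
    by (intro add_mono power_mono cut Ihat_L2[OF I] dIhat_L2[OF I]) auto
qed

lemma trunc_energy_tendsto:
  "(\<lambda>n. trunc_energy \<sigma> (real n) f) \<longlonglongrightarrow> 2 * pi * (H1_norm (I_op \<sigma> f))\<^sup>2"
  unfolding trunc_energy_eq energy_Ihat[OF I]
  by (intro tendsto_intros L2_lim_norm L2_lim_cutoff Ihat_L2[OF I] dIhat_L2[OF I])

lemma rhs_L2: "L2 (bbm_rhs f)"
  unfolding bbm_rhs_def[abs_def]
  by (intro L2_uminus L2_add L2_cmult L2_phi L2_conv fhat_L2[OF I] fhat_integrable[OF I])

lemma has_fourier_rhs:
  "has_fourier (\<lambda>x. - (phi_D f x + 1 / 2 * phi_D (\<lambda>y. (f y)\<^sup>2) x)) (bbm_rhs f)"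
proof -
  have "has_fourier (\<lambda>x. of_real (f x) * of_real (f x)) (\<lambda>\<xi>. of_real (1 / (2 * pi)) * conv
    (fhat f) (fhat f) \<xi>)"
    by (intro has_fourier_mult has_fourier_fhat[OF I] fhat_integrable[OF I])
  then have "has_fourier (\<lambda>x. of_real ((f x)\<^sup>2)) (\<lambda>\<xi>. of_real (1 / (2 * pi)) * conv (fhat f)
    (fhat f) \<xi>)"
    by (simp add: power2_eq_square)
  from has_fourier_cmult[OF has_fourier_add[OF has_fourier_phi_D[OF has_fourier_fhat[OF I]]
      has_fourier_cmult[OF has_fourier_phi_D[OF this], of "1 / 2"]], of "-1"]
  show ?thesis by (simp add: bbm_rhs_def[abs_def])
qed

text \<open>Apart from the cutoff, Parseval makes this \<open>\<i> * (2 * pi)^2\<close> times the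
  integral of the derivative of \<open>I f\<close> against \<open>I (f^2)\<close>, so the imaginary
  part carries the physical flux.\<close>

definition flux :: "real \<Rightarrow> complex" where
  "flux N = (LINT \<xi>|lborel. cutoff N \<xi> * (of_real \<xi> * cnj (Ihat \<sigma> f \<xi>)) * Qhat \<sigma> f \<xi>)"

text \<open>The linear part of the equation contributes a purely imaginary integral.\<close>

lemma Re_energy_rhs:
  "Re (LINT \<xi>|lborel. energy_weight \<sigma> N \<xi> * bbm_rhs f \<xi> * cnj (fhat f \<xi>)) = Im (flux N) / (4 * pi)"
proof -
  have A: "L2 (\<lambda>\<xi>. of_real \<xi> * cnj (Ihat \<sigma> f \<xi>))" using L2_cnj[OF dIhat_L2[OF I]] by simp
  have pw: "energy_weight \<sigma> N \<xi> * bbm_rhs f \<xi> * cnj (fhat f \<xi>)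
     = - \<i> * (cutoff N \<xi> * (of_real \<xi> * cnj (Ihat \<sigma> f \<xi>)) * Ihat \<sigma> f \<xi>)
       - \<i> * of_real (1 / (4 * pi)) * (cutoff N \<xi> * (of_real \<xi> * cnj
         (Ihat \<sigma> f \<xi>)) * Qhat \<sigma> f \<xi>)" for \<xi>
  proof -
    define c where "c = complex_of_real (cosh (\<sigma> * \<xi>))"
    have nz: "complex_of_real (1 + \<xi>\<^sup>2) \<noteq> 0" 
      by (simp only: of_real_eq_0_iff) (simp add: add_nonneg_eq_0_iff)
    have w: "energy_weight \<sigma> N \<xi> * phi \<xi> = cutoff N \<xi> * \<i> * of_real \<xi> * c * c"
      using nz unfolding energy_weight_def phi_def c_def by (simp add: power2_eq_square)
    have "energy_weight \<sigma> N \<xi> * bbm_rhs f \<xi> * cnj (fhat f \<xi>)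
      = - (energy_weight \<sigma> N \<xi> * phi \<xi>) * (fhat f \<xi> + of_real (1 / (4 * pi)) * conv (fhat f)
        (fhat f) \<xi>) * cnj (fhat f \<xi>)"
      unfolding bbm_rhs_def by (simp add: algebra_simps)
    also have "\<dots> = - \<i> * (cutoff N \<xi> * (of_real \<xi> * (c * cnj (fhat f \<xi>))) * (c * fhat f \<xi>))
       - \<i> * of_real (1 / (4 * pi)) * (cutoff N \<xi> * (of_real \<xi> * (c * cnj (fhat f \<xi>))) * (c * conv
         (fhat f) (fhat f) \<xi>))"
      unfolding w by (simp add: algebra_simps)
    finally show ?thesis unfolding c_def cosh_conv[OF I] by (simp add: Ihat_def)
  qed
  have i1: "integrable lborel (\<lambda>\<xi>. cutoff N \<xi> * (of_real \<xi> * cnj (Ihat \<sigma> f \<xi>)) * Ihat \<sigma> f \<xi>)"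
    by (intro L2_mult_integrable L2_cutoff A Ihat_L2[OF I])
  have i2: "integrable lborel (\<lambda>\<xi>. cutoff N \<xi> * (of_real \<xi> * cnj (Ihat \<sigma> f \<xi>)) * Qhat \<sigma> f \<xi>)"
    by (intro L2_mult_integrable L2_cutoff A Qhat_L2[OF I])
  have "(LINT \<xi>|lborel. energy_weight \<sigma> N \<xi> * bbm_rhs f \<xi> * cnj (fhat f \<xi>))
     = (LINT \<xi>|lborel. - \<i> * (cutoff N \<xi> * (of_real \<xi> * cnj (Ihat \<sigma> f \<xi>)) * Ihat \<sigma> f \<xi>))
       - (LINT \<xi>|lborel. \<i> * of_real (1 / (4 * pi)) * (cutoff N \<xi> * (of_real \<xi> * cnj
         (Ihat \<sigma> f \<xi>)) * Qhat \<sigma> f \<xi>))"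
    unfolding pw by (intro Bochner_Integration.integral_diff integrable_mult_right i1 i2)
  also have "\<dots> = - \<i> * (LINT \<xi>|lborel. cutoff N \<xi> * (of_real \<xi> * cnj (Ihat \<sigma> f \<xi>)) * Ihat \<sigma> f \<xi>)
       - \<i> * of_real (1 / (4 * pi)) * flux N"
    unfolding flux_def by (simp only: integral_mult_right_zero)
  also have "(LINT \<xi>|lborel. cutoff N \<xi> * (of_real \<xi> * cnj (Ihat \<sigma> f \<xi>)) * Ihat \<sigma> f \<xi>)
     = (LINT \<xi>|lborel. complex_of_real (indicator {-N..N} \<xi> * \<xi> * (cmod (Ihat \<sigma> f \<xi>))\<^sup>2))"
  proof (intro Bochner_Integration.integral_cong refl)
    fix \<xi>
    have "cutoff N \<xi> = of_real (indicator {-N..N} \<xi>)" by (simp add: cutoff_def indicator_def)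
    then show "cutoff N \<xi> * (of_real \<xi> * cnj (Ihat \<sigma> f \<xi>)) * Ihat \<sigma> f \<xi>
      = complex_of_real (indicator {-N..N} \<xi> * \<xi> * (cmod (Ihat \<sigma> f \<xi>))\<^sup>2)"
      unfolding of_real_mult complex_norm_square by (simp only: mult_ac)
  qed
  also have "\<dots> = of_real (LINT \<xi>|lborel. indicator {-N..N} \<xi> * \<xi> * (cmod (Ihat \<sigma> f \<xi>))\<^sup>2)"
    by (rule integral_complex_of_real)
  finally show ?thesis by simp
qed

text \<open>The cutoff spoils the exact cancellation, so it is written as 1 minus its complement:
  the full integral falls under \<open>cubic_flux_le\<close>, and the complement is a high-frequency
  tail paired with \<open>Qhat\<close>.\<close>

lemma flux_le:
  assumes \<sigma>: "0 < \<sigma>"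
  shows "cmod (flux N) \<le> \<sigma> * sqrt (2 * pi * \<sigma>) * (sqrt (2 * pi) * H1_norm (I_op \<sigma> f)) ^ 3
     + L2_norm (\<lambda>\<xi>. (1 - cutoff N \<xi>) * (of_real \<xi> * Ihat \<sigma> f \<xi>)) * L2_norm (Qhat \<sigma> f)"
proof -
  have A: "L2 (\<lambda>\<xi>. of_real \<xi> * cnj (Ihat \<sigma> f \<xi>))" using L2_cnj[OF dIhat_L2[OF I]] by simp
  let ?B = "\<lambda>\<xi>. (1 - cutoff N \<xi>) * (of_real \<xi> * cnj (Ihat \<sigma> f \<xi>))"
  have B: "L2 ?B" by (intro L2_cutoff A)
  have "flux N = (LINT \<xi>|lborel. of_real \<xi> * cnj (Ihat \<sigma> f \<xi>) * Qhat \<sigma> f \<xi> - ?B \<xi> * Qhat \<sigma> f \<xi>)"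
    unfolding flux_def by (intro Bochner_Integration.integral_cong refl) (simp add: algebra_simps)
  also have "\<dots> = (LINT \<xi>|lborel. of_real \<xi> * cnj (Ihat \<sigma> f \<xi>) * Qhat \<sigma> f \<xi>) -
    (LINT \<xi>|lborel. ?B \<xi> * Qhat \<sigma> f \<xi>)"
    by (intro Bochner_Integration.integral_diff L2_mult_integrable A B Qhat_L2[OF I])
  finally have eq: "flux N = (LINT \<xi>|lborel. of_real \<xi> * cnj (Ihat \<sigma> f \<xi>) * Qhat \<sigma> f \<xi>) -
    (LINT \<xi>|lborel. ?B \<xi> * Qhat \<sigma> f \<xi>)" .
  have "cmod (flux N) \<le> cmod (LINT \<xi>|lborel. of_real \<xi> * cnj (Ihat \<sigma> f \<xi>) * Qhat \<sigma> f \<xi>) + cmod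
    (LINT \<xi>|lborel. ?B \<xi> * Qhat \<sigma> f \<xi>)"
    unfolding eq by (rule norm_triangle_ineq4)
  also have "\<dots> \<le> \<sigma> * sqrt (2 * pi * \<sigma>) * (L2_norm (\<lambda>\<xi>. of_real \<xi> * Ihat \<sigma> f \<xi>)) ^ 3
    + L2_norm ?B * L2_norm (Qhat \<sigma> f)"
    by (intro add_mono cubic_flux_le[OF I \<sigma>] L2_inner_le B Qhat_L2[OF I])
  also have "\<dots> \<le> \<sigma> * sqrt (2 * pi * \<sigma>) * (sqrt (2 * pi) * H1_norm (I_op \<sigma> f)) ^ 3
    + L2_norm ?B * L2_norm (Qhat \<sigma> f)"
    using \<sigma> by (intro add_right_mono mult_left_mono power_mono Ihat_norm_le[OF I]) auto
  also have "L2_norm ?B = L2_norm (\<lambda>\<xi>. (1 - cutoff N \<xi>) * (of_real \<xi> * Ihat \<sigma> f \<xi>))"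
    unfolding L2_norm_def norm_mult by simp
  finally show ?thesis .
qed

end

text \<open>\<open>H1_norm\<close> of the difference refers to a weak derivative chosen for the
  difference itself, hence \<open>H1_diff\<close> before passing to transforms.\<close>

lemma Ihat_diff_norm_le:
  assumes f: "I_in_H1 \<sigma> f" and g: "I_in_H1 \<sigma> g"
  shows "L2_norm (\<lambda>\<xi>. Ihat \<sigma> f \<xi> - Ihat \<sigma> g \<xi>) \<le> sqrt (2 * pi) * H1_norm (\<lambda>x. I_op \<sigma> f x
    - I_op \<sigma> g x)"
    and "L2_norm (\<lambda>\<xi>. of_real \<xi> * Ihat \<sigma> f \<xi> - of_real \<xi> * Ihat \<sigma> g \<xi>) \<le> sqrt (2 * pi) * H1_norm
      (\<lambda>x. I_op \<sigma> f x - I_op \<sigma> g x)"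
proof -
  let ?h = "H1_norm (\<lambda>x. I_op \<sigma> f x - I_op \<sigma> g x)"
  have 0: "0 \<le> sqrt (2 * pi) * ?h" by (simp add: H1_norm_def)
  have "H1 (\<lambda>x. I_op \<sigma> f x - I_op \<sigma> g x)" using f g by (intro H1_diff) (auto simp: I_in_H1_def)
  from H1_norm_fourier(2)[OF this has_fourier_diff[OF has_fourier_Ihat[OF f] has_fourier_Ihat[OF
    g]]]
  have "(sqrt (2 * pi) * ?h)\<^sup>2 = (L2_norm (\<lambda>\<xi>. Ihat \<sigma> f \<xi> - Ihat \<sigma> g \<xi>))\<^sup>2
     + (L2_norm (\<lambda>\<xi>. of_real \<xi> * (Ihat \<sigma> f \<xi> - Ihat \<sigma> g \<xi>)))\<^sup>2"
    by (simp add: power_mult_distrib)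
  then show "L2_norm (\<lambda>\<xi>. Ihat \<sigma> f \<xi> - Ihat \<sigma> g \<xi>) \<le> sqrt (2 * pi) * ?h"
    "L2_norm (\<lambda>\<xi>. of_real \<xi> * Ihat \<sigma> f \<xi> - of_real \<xi> * Ihat \<sigma> g \<xi>) \<le> sqrt (2 * pi) * ?h"
    unfolding right_diff_distrib[symmetric] by (auto intro!: power2_le_imp_le[OF _ 0])
qed

lemma eventually_at_within_self: "eventually (\<lambda>s. s \<in> S) (at t within S)"
  by (auto simp: eventually_at_filter)

text \<open>\<open>K\<close> is a uniform bound on the norm along the solution; the a priori bound
  of the local theory later supplies twice the initial norm.\<close>

locale bbm =
  fixes \<sigma> \<delta> K :: real and u :: "real \<Rightarrow> real \<Rightarrow> real"
  assumes \<sigma>: "0 < \<sigma>" and \<delta>: "0 < \<delta>" and K: "0 \<le> K"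
    and cont: "I_continuous_H1 \<sigma> \<delta> u"
    and bound: "\<And>t. t \<in> {0..\<delta>} \<Longrightarrow> H1_norm (I_op \<sigma> (u t)) \<le> K"
    and evolution: "\<And>t. t \<in> {0..\<delta>} \<Longrightarrow>
        ((\<lambda>s. L2_norm (\<lambda>x. of_real ((u s x - u t x) / (s - t))
             + phi_D (u t) x + 1/2 * phi_D (\<lambda>y. (u t y)\<^sup>2) x)) \<longlongrightarrow> 0) (at t within {0..\<delta>})"
begin

lemma I: "t \<in> {0..\<delta>} \<Longrightarrow> I_in_H1 \<sigma> (u t)"
  using cont by (simp add: I_continuous_H1_def)

lemma Ihat_continuous:
  assumes t: "t \<in> {0..\<delta>}"
  shows "((\<lambda>s. L2_norm (\<lambda>\<xi>. Ihat \<sigma> (u s) \<xi> - Ihat \<sigma> (u t) \<xi>)) \<longlongrightarrow> 0) (at t within {0..\<delta>})" (is ?A)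
    and "((\<lambda>s. L2_norm (\<lambda>\<xi>. of_real \<xi> * Ihat \<sigma> (u s) \<xi> - of_real \<xi> * Ihat \<sigma> (u t) \<xi>)) \<longlongrightarrow> 0)
      (at t within {0..\<delta>})" (is ?B)
proof -
  let ?h = "\<lambda>s. sqrt (2 * pi) * H1_norm (\<lambda>x. I_op \<sigma> (u s) x - I_op \<sigma> (u t) x)"
  have "(?h \<longlongrightarrow> sqrt (2 * pi) * 0) (at t within {0..\<delta>})"
    using cont t by (intro tendsto_intros) (simp add: I_continuous_H1_def)
  then have h: "(?h \<longlongrightarrow> 0) (at t within {0..\<delta>})" by simp
  show ?A
    by (rule Lim_null_comparison[OF _ h], rule eventually_mono[OF eventually_at_within_self])
      (use Ihat_diff_norm_le(1)[OF I I[OF t]] in auto)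
  show ?B
    by (rule Lim_null_comparison[OF _ h], rule eventually_mono[OF eventually_at_within_self])
      (use Ihat_diff_norm_le(2)[OF I I[OF t]] in auto)
qed

text \<open>
  Outside \<open>{0..\<delta>}\<close>, where \<open>u\<close> is unconstrained, the values are filled in so that every member
  of the family is in \<open>L\<^sup>2\<close>.
\<close>

definition dq :: "real \<Rightarrow> real \<Rightarrow> real \<Rightarrow> complex" where
  "dq t s = (if s \<in> {0..\<delta>} then (\<lambda>\<xi>. of_real (1 / (s - t)) * (fhat (u s) \<xi> - fhat
    (u t) \<xi>)) else bbm_rhs (u t))"

definition uh :: "real \<Rightarrow> real \<Rightarrow> real \<Rightarrow> complex" where
  "uh t s = (if s \<in> {0..\<delta>} then fhat (u s) else fhat (u t))"

text \<open>By Plancherel this is the differential equation itself: for \<open>s\<close> in the time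
  interval the distance is \<open>sqrt (2 * pi)\<close> times the quantity that
  \<open>evolution\<close> sends to 0.\<close>

lemma dq_lim:
  assumes t: "t \<in> {0..\<delta>}" shows "L2_lim (dq t) (bbm_rhs (u t)) (at t within {0..\<delta>})"
proof -
  have L: "L2 (dq t s)" for s
  proof (cases "s \<in> {0..\<delta>}")
    case True
    then show ?thesis
      unfolding dq_def by (simp only: if_True) (intro L2_cmult L2_diff fhat_L2[OF I] t)
  next
    case False
    then show ?thesis using rhs_L2[OF I[OF t]] by (simp only: dq_def if_False)
  qed
  let ?e = "\<lambda>s. L2_norm (\<lambda>x. of_real ((u s x - u t x) / (s - t)) + phi_D (u t) x + 1/2 * phi_D
    (\<lambda>y. (u t y)\<^sup>2) x)"
  have eq: "L2_norm (\<lambda>\<xi>. dq t s \<xi> - bbm_rhs (u t) \<xi>) = sqrt (2 * pi) * ?e s" if s: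
    "s \<in> {0..\<delta>}" for s
  proof -
    have "has_fourier (\<lambda>x. of_real (1 / (s - t)) * (of_real (u s x) - of_real (u t x))
        - - (phi_D (u t) x + 1 / 2 * phi_D (\<lambda>y. (u t y)\<^sup>2) x)) (\<lambda>\<xi>. dq t s \<xi> - bbm_rhs (u t) \<xi>)"
      unfolding dq_def using s
      by (simp only: if_True)
        (intro has_fourier_diff has_fourier_cmult has_fourier_fhat[OF I] has_fourier_rhs[OF I] s t)
    from has_fourier_plancherel[OF this] show ?thesis by
      (simp add: algebra_simps diff_divide_distrib)
  qed
  have "((\<lambda>s. sqrt (2 * pi) * ?e s) \<longlongrightarrow> sqrt (2 * pi) * 0) (at t within {0..\<delta>})"
    by (intro tendsto_intros evolution t)
  then have "((\<lambda>s. sqrt (2 * pi) * ?e s) \<longlongrightarrow> 0) (at t within {0..\<delta>})" by simp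
  then have "((\<lambda>s. L2_norm (\<lambda>\<xi>. dq t s \<xi> - bbm_rhs (u t) \<xi>)) \<longlongrightarrow> 0) (at t within {0..\<delta>})"
    by (rule Lim_transform_eventually)
      (rule eventually_mono[OF eventually_at_within_self], use eq in simp)
  then show ?thesis using L rhs_L2[OF I[OF t]] by (simp add: L2_lim_def)
qed

text \<open>\<open>cosh\<close> is at least 1, so differences of \<open>fhat\<close> are dominated
  by those of \<open>Ihat\<close>, which are continuous in time.\<close>

lemma uh_lim:
  assumes t: "t \<in> {0..\<delta>}" shows "L2_lim (uh t) (fhat (u t)) (at t within {0..\<delta>})"
proof -
  have L: "L2 (uh t s)" for s
    unfolding uh_def by (auto intro: fhat_L2[OF I] t)
  have le: "L2_norm (\<lambda>\<xi>. uh t s \<xi> - fhat (u t) \<xi>) \<le> L2_norm (\<lambda>\<xi>. Ihat \<sigma> (u s) \<xi> - Ihat \<sigma> (u t) \<xi>)"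
    if s: "s \<in> {0..\<delta>}" for s
  proof (intro L2_norm_mono L2_diff L fhat_L2[OF I] Ihat_L2[OF I] AE_I2 s t)
    fix \<xi>
    have "Ihat \<sigma> (u s) \<xi> - Ihat \<sigma> (u t) \<xi> = of_real (cosh (\<sigma> * \<xi>)) * (fhat (u s) \<xi> - fhat (u t) \<xi>)"
      by (simp add: Ihat_def algebra_simps)
    then show "cmod (uh t s \<xi> - fhat (u t) \<xi>) \<le> cmod (Ihat \<sigma> (u s) \<xi> - Ihat \<sigma> (u t) \<xi>)"
      using s cosh_real_ge_1[of "\<sigma> * \<xi>"] by (simp add: uh_def norm_mult mult_le_cancel_right1)
  qed
  have "((\<lambda>s. L2_norm (\<lambda>\<xi>. uh t s \<xi> - fhat (u t) \<xi>)) \<longlongrightarrow> 0) (at t within {0..\<delta>})"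
    by (rule Lim_null_comparison[OF _ Ihat_continuous(1)[OF t]], rule eventually_mono[OF
      eventually_at_within_self])
      (use le in simp)
  then show ?thesis using L fhat_L2[OF I[OF t]] by (simp add: L2_lim_def)
qed

text \<open>The product rule for a hermitian form: with \<open>b\<close> and \<open>a\<close> the
  transforms at times \<open>s\<close> and \<open>t\<close>,
  \<open>|b|^2 - |a|^2 = (b - a) * cnj b + a * cnj (b - a)\<close>, and after division by
  \<open>s - t\<close> every factor converges in L^2.\<close>

lemma trunc_energy_deriv:
  assumes t: "t \<in> {0..\<delta>}"
  shows "((\<lambda>s. trunc_energy \<sigma> N (u s)) has_real_derivative Im (flux \<sigma> (u t) N) / (2 * pi))
    (at t within {0..\<delta>})"
proof -
  let ?W = "energy_weight \<sigma> N" and ?a = "fhat (u t)" and ?F = "at t within {0..\<delta>}"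
  have W: "\<And>\<xi>. cmod (?W \<xi>) \<le> (1 + N\<^sup>2) * (cosh (\<sigma> * N))\<^sup>2" by (rule energy_weight_bounded)
  have WL: "L2 (\<lambda>\<xi>. ?W \<xi> * g \<xi>)" if "L2 g" for g
    using that W by (intro L2_dominated[OF _ that, where c="(1 + N\<^sup>2) * (cosh (\<sigma> * N))\<^sup>2"])
      (auto simp: norm_mult L2_def intro: mult_right_mono)
  note aL = fhat_L2[OF I[OF t]] and rL = rhs_L2[OF I[OF t]]
  have dL: "L2 (dq t s)" "L2 (uh t s)" for s
    using dq_lim[OF t] uh_lim[OF t] by (auto simp: L2_lim_def)
  define p where "p s = (LINT \<xi>|lborel. ?W \<xi> * dq t s \<xi> * cnj (uh t s \<xi>)) +
    (LINT \<xi>|lborel. ?W \<xi> * ?a \<xi> * cnj (dq t s \<xi>))" for s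
  have lim: "(p \<longlongrightarrow> (LINT \<xi>|lborel. ?W \<xi> * bbm_rhs (u t) \<xi> * cnj (?a \<xi>)) +
    (LINT \<xi>|lborel. ?W \<xi> * ?a \<xi> * cnj (bbm_rhs (u t) \<xi>))) ?F"
    unfolding p_def
  proof (intro tendsto_add L2_lim_inner)
    show "L2_lim (\<lambda>s \<xi>. ?W \<xi> * dq t s \<xi>) (\<lambda>\<xi>. ?W \<xi> * bbm_rhs (u t) \<xi>) ?F"
      by (rule L2_lim_mult_bounded[OF dq_lim[OF t] energy_weight_measurable W])
    show "L2_lim (\<lambda>s \<xi>. cnj (uh t s \<xi>)) (\<lambda>\<xi>. cnj (?a \<xi>)) ?F" by (rule L2_lim_cnj[OF uh_lim[OF t]])
    show "L2_lim (\<lambda>s \<xi>. cnj (dq t s \<xi>)) (\<lambda>\<xi>. cnj (bbm_rhs (u t) \<xi>)) ?F" by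
      (rule L2_lim_cnj[OF dq_lim[OF t]])
    show "L2_lim (\<lambda>s \<xi>. ?W \<xi> * ?a \<xi>) (\<lambda>\<xi>. ?W \<xi> * ?a \<xi>) ?F"
      using WL[OF aL] by (simp add: L2_lim_def)
  qed
  \<comment> \<open>The weight is real, so the two limit integrals are conjugate and contribute the
    same real part; this doubles the value from \<open>Re_energy_rhs\<close>.\<close>
  have r: "Re (LINT \<xi>|lborel. ?W \<xi> * ?a \<xi> * cnj (bbm_rhs (u t) \<xi>)) = Re
    (LINT \<xi>|lborel. ?W \<xi> * bbm_rhs (u t) \<xi> * cnj (?a \<xi>))"
  proof -
    have "(LINT \<xi>|lborel. ?W \<xi> * ?a \<xi> * cnj (bbm_rhs (u t) \<xi>)) = (LINT \<xi>|lborel. cnj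
      (?W \<xi> * bbm_rhs (u t) \<xi> * cnj (?a \<xi>)))"
      by (intro Bochner_Integration.integral_cong refl) (simp add: cnj_energy_weight mult_ac)
    also have "\<dots> = cnj (LINT \<xi>|lborel. ?W \<xi> * bbm_rhs (u t) \<xi> * cnj (?a \<xi>))"
      by (rule Bochner_Integration.integral_cnj)
    finally show ?thesis by (simp only: cnj.sel)
  qed
  have "((\<lambda>s. Re (p s)) \<longlongrightarrow> Im (flux \<sigma> (u t) N) / (2 * pi)) ?F"
    by (rule tendsto_eq_rhs[OF tendsto_Re[OF lim]]) (simp add: r Re_energy_rhs[OF I[OF t]])
  then have "((\<lambda>s. (trunc_energy \<sigma> N (u s) - trunc_energy \<sigma> N (u t)) / (s - t)) \<longlongrightarrow> Im (flux \<sigma>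
    (u t) N) / (2 * pi)) ?F"
  proof (rule Lim_transform_eventually)
    have "eventually (\<lambda>s. s \<in> {0..\<delta>} \<and> s \<noteq> t) ?F" by (auto simp: eventually_at_filter)
    then show "\<forall>\<^sub>F s in ?F. Re (p s) = (trunc_energy \<sigma> N (u s) - trunc_energy \<sigma> N (u t)) / (s - t)"
    proof eventually_elim
      case (elim s)
      then have s: "s \<in> {0..\<delta>}" and ne: "s \<noteq> t" by auto
      let ?b = "fhat (u s)"
      have bL: "L2 ?b" by (rule fhat_L2[OF I[OF s]])
      have d: "?b \<xi> - ?a \<xi> = of_real (s - t) * dq t s \<xi>" for \<xi>
      proof -
        have "complex_of_real (s - t) * of_real (1 / (s - t)) = 1"
          unfolding of_real_mult[symmetric] using ne by simp
        then show ?thesis using s by (simp only: dq_def if_True mult.assoc[symmetric]) simp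
      qed
      have pw: "?W \<xi> * ?b \<xi> * cnj (?b \<xi>) - ?W \<xi> * ?a \<xi> * cnj (?a \<xi>)
          = of_real (s - t) * (?W \<xi> * dq t s \<xi> * cnj (uh t s \<xi>) + ?W \<xi> * ?a \<xi> * cnj
            (dq t s \<xi>))" for \<xi>
      proof -
        have "?W \<xi> * ?b \<xi> * cnj (?b \<xi>) - ?W \<xi> * ?a \<xi> * cnj (?a \<xi>)
          = ?W \<xi> * (?b \<xi> - ?a \<xi>) * cnj (?b \<xi>) + ?W \<xi> * ?a \<xi> * cnj (?b \<xi> - ?a \<xi>)"
          by (simp add: algebra_simps)
        also have "\<dots> = of_real (s - t) * (?W \<xi> * dq t s \<xi> * cnj (uh t s \<xi>) + ?W \<xi> * ?a \<xi> * cnj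
          (dq t s \<xi>))"
          unfolding d using s by (simp add: uh_def distrib_left mult_ac del: of_real_diff)
        finally show ?thesis .
      qed
      have "(LINT \<xi>|lborel. ?W \<xi> * ?b \<xi> * cnj (?b \<xi>)) - (LINT \<xi>|lborel. ?W \<xi> * ?a \<xi> * cnj (?a \<xi>))
        = (LINT \<xi>|lborel. ?W \<xi> * ?b \<xi> * cnj (?b \<xi>) - ?W \<xi> * ?a \<xi> * cnj (?a \<xi>))"
        by (intro Bochner_Integration.integral_diff[symmetric] L2_mult_integrable WL L2_cnj aL bL)
      also have "\<dots> = of_real (s - t) * (LINT \<xi>|lborel. ?W \<xi> * dq t s \<xi> * cnj (uh t s \<xi>)
        + ?W \<xi> * ?a \<xi> * cnj (dq t s \<xi>))"
        unfolding pw by (rule integral_mult_right_zero)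
      also have "(LINT \<xi>|lborel. ?W \<xi> * dq t s \<xi> * cnj (uh t s \<xi>) + ?W \<xi> * ?a \<xi> * cnj (dq t s \<xi>))
        = p s"
        unfolding p_def by (intro Bochner_Integration.integral_add L2_mult_integrable WL L2_cnj aL
          dL)
      finally have "trunc_energy \<sigma> N (u s) - trunc_energy \<sigma> N (u t) = Re (of_real (s - t) * p s)"
        unfolding trunc_energy_def by (metis minus_complex.sel(1))
      also have "\<dots> = (s - t) * Re (p s)" by (simp del: of_real_diff)
      finally show ?case using ne by simp
    qed
  qed
  then show ?thesis by (simp add: has_field_derivative_iff)
qed

text \<open>If tails above \<open>e\<close> survived at arbitrarily high frequency, the times
  carrying them would accumulate at some \<open>l\<close>. Continuity in H^1 would move the tails to
  time \<open>l\<close>, where they belong to a single L^2 function and vanish in the limit.\<close>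

lemma uniform_tail:
  assumes e: "0 < e"
  shows "\<exists>n0. \<forall>n\<ge>n0. \<forall>t\<in>{0..\<delta>}. L2_norm (\<lambda>\<xi>. (1 - cutoff (real n) \<xi>) * (of_real \<xi> * Ihat \<sigma>
    (u t) \<xi>)) \<le> e"
proof (rule ccontr)
  define tl where "tl n t = L2_norm (\<lambda>\<xi>. (1 - cutoff (real n) \<xi>) * (of_real \<xi> * Ihat \<sigma>
    (u t) \<xi>))" for n :: nat and t
  have dL: "L2 (\<lambda>\<xi>. of_real \<xi> * Ihat \<sigma> (u t) \<xi>)" if "t \<in> {0..\<delta>}" for t by
    (rule dIhat_L2[OF I[OF that]])
  assume "\<not> ?thesis"
  then have "\<forall>n0. \<exists>n\<ge>n0. \<exists>t\<in>{0..\<delta>}. e < tl n t" unfolding tl_def by (metis not_le)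
  then obtain N T where NT: "\<And>k. k \<le> N k \<and> T k \<in> {0..\<delta>} \<and> e < tl (N k) (T k)" by metis
  have Tm: "T k \<in> {0..\<delta>}" for k using NT by auto
  \<comment> \<open>Tails shrink as the cutoff grows, so the frequency \<open>N k\<close> may be
    lowered to \<open>k\<close>.\<close>
  have ek: "e < tl k (T k)" for k
  proof -
    have "tl (N k) (T k) \<le> tl k (T k)"
      unfolding tl_def
    proof (intro L2_norm_mono L2_cutoff dL AE_I2)
      fix \<xi>
      have "cmod (1 - cutoff (real (N k)) \<xi>) \<le> cmod (1 - cutoff (real k) \<xi>)"
        using NT[of k] by (auto simp: cutoff_def indicator_def)
      then show "cmod ((1 - cutoff (real (N k)) \<xi>) * (of_real \<xi> * Ihat \<sigma> (u (T k)) \<xi>)) \<le> cmod ((1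
        - cutoff (real k) \<xi>) * (of_real \<xi> * Ihat \<sigma> (u (T k)) \<xi>))"
        unfolding norm_mult[of "1 - _"] by (rule mult_right_mono) simp
    qed (use NT in auto)
    then show ?thesis using NT[of k] by linarith
  qed
  have "\<exists>l\<in>{0..\<delta>}. \<exists>r. strict_mono r \<and> (T \<circ> r) \<longlonglongrightarrow> l"
    using compact_Icc[of 0 \<delta>] Tm unfolding compact_def by simp
  then obtain l r where l: "l \<in> {0..\<delta>}" and r: "strict_mono r" and lim: "(T \<circ> r) \<longlonglongrightarrow> l"
    by (elim bexE exE conjE)
  define c where "c s = L2_norm (\<lambda>\<xi>. of_real \<xi> * Ihat \<sigma> (u s) \<xi> - of_real \<xi> * Ihat \<sigma> (u l) \<xi>)" for s
  have "continuous (at l within {0..\<delta>}) c"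
    unfolding continuous_within c_def using Ihat_continuous(2)[OF l] by simp
  then have "(c \<circ> (T \<circ> r)) \<longlonglongrightarrow> c l"
    by (rule continuous_within_sequentially[THEN iffD1, rule_format]) (use Tm lim
      in \<open>simp add: o_def\<close>)
  then have c0: "(\<lambda>k. c (T (r k))) \<longlonglongrightarrow> 0" by (simp add: c_def o_def)
  have "(\<lambda>n. tl n l) \<longlonglongrightarrow> 0"
    using L2_lim_norm[OF L2_lim_cutoff(2)[OF dL[OF l]]] by (simp add: tl_def)
  then have t0: "(\<lambda>k. tl (r k) l) \<longlonglongrightarrow> 0"
    using LIMSEQ_subseq_LIMSEQ[OF _ r] by (auto simp: o_def)
  have "e \<le> tl (r k) l + c (T (r k))" for k
  proof -
    let ?T = "T (r k)"
    have T: "?T \<in> {0..\<delta>}" using Tm by blast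
    let ?g = "\<lambda>\<xi>. of_real \<xi> * Ihat \<sigma> (u ?T) \<xi> - of_real \<xi> * Ihat \<sigma> (u l) \<xi>"
    have g: "L2 ?g" by (intro L2_diff dL T l)
    have "tl (r k) ?T \<le> tl (r k) l + L2_norm (\<lambda>\<xi>. (1 - cutoff (real (r k)) \<xi>) * ?g \<xi>)"
      using L2_norm_triangle[OF L2_cutoff(2)[OF dL[OF l], of "real (r k)"] L2_cutoff(2)[OF g, of
        "real (r k)"]]
      unfolding tl_def by (simp add: algebra_simps)
    also have "L2_norm (\<lambda>\<xi>. (1 - cutoff (real (r k)) \<xi>) * ?g \<xi>) \<le> c ?T"
      unfolding c_def
    proof (intro L2_norm_mono L2_cutoff g AE_I2)
      fix \<xi>
      show "cmod ((1 - cutoff (real (r k)) \<xi>) * ?g \<xi>) \<le> cmod (?g \<xi>)"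
        unfolding norm_mult[of "1 - _"] by (rule mult_left_le_one_le) (auto simp: cutoff_le)
    qed
    finally show ?thesis using ek[of "r k"] NT l
      by (meson add_left_mono less_imp_le order_trans ek)
  qed
  then have "e \<le> 0 + 0"
    by (intro LIMSEQ_le_const[OF tendsto_add[OF t0 c0]]) auto
  then show False using e by simp
qed

lemma energy_growth:
  assumes t: "t \<in> {0..\<delta>}"
  shows "(H1_norm (I_op \<sigma> (u t)))\<^sup>2 \<le> (H1_norm (I_op \<sigma> (u 0)))\<^sup>2 + \<delta> * \<sigma> powr (3/2) * K ^ 3"
proof (cases "t = 0")
  case True
  then show ?thesis using \<delta> K by simp
next
  case False
  then have t0: "0 < t" and t\<delta>: "t \<le> \<delta>" using t by auto
  have z: "0 \<in> {0..\<delta>}" using \<delta> by simp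
  define Q where "Q = 8 * pi * sqrt (2 * pi) * K\<^sup>2"
  have Q0: "0 \<le> Q" by (simp add: Q_def)
  have QK: "L2_norm (Qhat \<sigma> (u s)) \<le> Q" if "s \<in> {0..\<delta>}" for s
    unfolding Q_def using bound[OF that]
    by (intro order_trans[OF Qhat_norm_le[OF I[OF that]]] mult_left_mono power_mono)
      (auto simp: H1_norm_def)
  define F where "F = \<sigma> * sqrt (2 * pi * \<sigma>) * (sqrt (2 * pi) * K) ^ 3"
  have F0: "0 \<le> F" using \<sigma> K by (simp add: F_def)
  have FK: "\<sigma> * sqrt (2 * pi * \<sigma>) * (sqrt (2 * pi) * H1_norm (I_op \<sigma> (u s))) ^ 3 \<le> F" if
    "s \<in> {0..\<delta>}" for s
    unfolding F_def using \<sigma> bound[OF that] by (intro mult_left_mono power_mono)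
      (auto simp: H1_norm_def)
  \<comment> \<open>The cutoff is removed while \<open>e\<close> is fixed, and only afterwards does
    \<open>e\<close> tend to 0; this makes the crude bound \<open>Q\<close> good enough for the
    tail.\<close>
  have main: "2 * pi * (H1_norm (I_op \<sigma> (u t)))\<^sup>2 \<le> 2 * pi * (H1_norm (I_op \<sigma> (u 0)))\<^sup>2 + (F
    + e * Q) / (2 * pi) * \<delta>" if e: "0 < e" for e
  proof -
    obtain n0 where n0: "\<And>n s. n0 \<le> n \<Longrightarrow> s \<in> {0..\<delta>} \<Longrightarrow>
        L2_norm (\<lambda>\<xi>. (1 - cutoff (real n) \<xi>) * (of_real \<xi> * Ihat \<sigma> (u s) \<xi>)) \<le> e"
      using uniform_tail[OF e] by blast
    have "trunc_energy \<sigma> (real n) (u t) \<le> 2 * pi * (H1_norm (I_op \<sigma> (u 0)))\<^sup>2 + (F + e * Q) /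
      (2 * pi) * \<delta>" if n: "n0 \<le> n" for n
    proof -
      \<comment> \<open>The mean value theorem uses the derivative at one intermediate time, where
        the flux bound applies because \<open>n0\<close> was chosen uniformly in time.\<close>
      have "\<exists>s\<in>{0<..<t}. trunc_energy \<sigma> (real n) (u t) - trunc_energy \<sigma> (real n) (u 0) = (\<lambda>h. Im
        (flux \<sigma> (u s) (real n)) / (2 * pi) * h) (t - 0)"
      proof (rule mvt_simple[OF t0])
        fix x assume "0 \<le> x" "x \<le> t"
        then have "((\<lambda>s. trunc_energy \<sigma> (real n) (u s)) has_real_derivative Im (flux \<sigma> (u x)
          (real n)) / (2 * pi)) (at x within {0..\<delta>})"
          using t\<delta> by (intro trunc_energy_deriv) auto
        then have "((\<lambda>s. trunc_energy \<sigma> (real n) (u s)) has_real_derivative Im (flux \<sigma> (u x)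
          (real n)) / (2 * pi)) (at x within {0..t})"
          by (rule DERIV_subset) (use t\<delta> in auto)
        then show "((\<lambda>s. trunc_energy \<sigma> (real n) (u s)) has_derivative (\<lambda>h. Im (flux \<sigma> (u x)
          (real n)) / (2 * pi) * h)) (at x within {0..t})"
          by (simp only: has_field_derivative_def)
      qed
      then obtain s where s: "0 < s" "s < t" and eq: "trunc_energy \<sigma> (real n) (u t)
        - trunc_energy \<sigma> (real n) (u 0) = Im (flux \<sigma> (u s) (real n)) / (2 * pi) * t"
        by auto
      have s\<delta>: "s \<in> {0..\<delta>}" using s t\<delta> by auto
      have "Im (flux \<sigma> (u s) (real n)) \<le> cmod (flux \<sigma> (u s) (real n))"
        using abs_Im_le_cmod[of "flux \<sigma> (u s) (real n)"] by linarith
      also have "\<dots> \<le> F + e * Q"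
        by (rule order_trans[OF flux_le[OF I[OF s\<delta>] \<sigma>] add_mono[OF FK[OF s\<delta>] mult_mono[OF n0[OF n
          s\<delta>] QK[OF s\<delta>]]]])
          (use e in auto)
      finally have "Im (flux \<sigma> (u s) (real n)) / (2 * pi) * t \<le> (F + e * Q) / (2 * pi) * \<delta>"
        using t0 t\<delta> F0 Q0 e by (intro mult_mono divide_right_mono) auto
      moreover have "trunc_energy \<sigma> (real n) (u 0) \<le> 2 * pi * (H1_norm (I_op \<sigma> (u 0)))\<^sup>2"
        by (rule trunc_energy_le[OF I[OF z]])
      ultimately show ?thesis using eq by linarith
    qed
    then show ?thesis
      by (intro LIMSEQ_le_const2[OF trunc_energy_tendsto[OF I[OF t]]]) blast
  qed
  have "((\<lambda>e. 2 * pi * (H1_norm (I_op \<sigma> (u 0)))\<^sup>2 + (F + e * Q) / (2 * pi) * \<delta>)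
      \<longlongrightarrow> 2 * pi * (H1_norm (I_op \<sigma> (u 0)))\<^sup>2 + (F + 0 * Q) / (2 * pi) * \<delta>) (at_right 0)"
    by (intro tendsto_intros) auto
  then have "2 * pi * (H1_norm (I_op \<sigma> (u t)))\<^sup>2 \<le> 2 * pi * (H1_norm (I_op \<sigma> (u 0)))\<^sup>2 + (F
    + 0 * Q) / (2 * pi) * \<delta>"
    by (rule tendsto_lowerbound) (use main in \<open>auto
      intro: eventually_mono[OF eventually_at_right_less]\<close>)
  \<comment> \<open>Of the two factors \<open>2 * pi\<close>, one cancels against the derivative of
    the energy and one against the Plancherel factor in front of the norm, so the constant in terms
    of \<open>K\<close> is 1.\<close>
  moreover have "F = (2 * pi)\<^sup>2 * (\<sigma> powr (3/2) * K ^ 3)"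
  proof -
    have "\<sigma> powr (3/2) = \<sigma> powr (1 + 1/2)" by simp
    also have "\<dots> = \<sigma> * sqrt \<sigma>" using \<sigma> by (subst powr_add) (simp add: powr_half_sqrt)
    finally have p: "\<sigma> powr (3/2) = \<sigma> * sqrt \<sigma>" .
    have "F = (sqrt (2 * pi) * sqrt (2 * pi)) * (sqrt (2 * pi) * sqrt (2 * pi)) *
      (\<sigma> * sqrt \<sigma> * K ^ 3)"
      unfolding F_def real_sqrt_mult[of "2 * pi" \<sigma>] by (simp only: power3_eq_cube mult_ac)
    then show ?thesis unfolding p by (simp add: power2_eq_square)
  qed
  ultimately have "2 * pi * (H1_norm (I_op \<sigma> (u t)))\<^sup>2 \<le> 2 * pi * ((H1_norm (I_op \<sigma> (u 0)))\<^sup>2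
    + \<delta> * \<sigma> powr (3/2) * K ^ 3)"
    by (simp add: power2_eq_square algebra_simps)
  then show ?thesis by simp
qed

end

theorem proposition3p4:
  "\<exists>C::real. C > 0 \<and>
     (\<forall>c1 c2 \<sigma> \<delta> :: real. \<forall>u0 :: real \<Rightarrow> real. \<forall>u :: real \<Rightarrow> real \<Rightarrow> real.
        0 < c1 \<longrightarrow> c1 \<le> c2 \<longrightarrow> 0 < \<sigma> \<longrightarrow>
        I_in_H1 \<sigma> u0 \<longrightarrow>
        local_solution c1 c2 \<sigma> u0 \<delta> u \<longrightarrow>
        (SUP t\<in>{0..\<delta>}. (H1_norm (I_op \<sigma> (u t)))\<^sup>2)
          \<le> (H1_norm (I_op \<sigma> u0))\<^sup>2
             + C * \<delta> * \<sigma> powr (3/2) * (H1_norm (I_op \<sigma> u0)) ^ 3)"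
proof (intro exI conjI allI impI)
  fix c1 c2 \<sigma> \<delta> :: real and u0 :: "real \<Rightarrow> real" and u :: "real \<Rightarrow> real \<Rightarrow> real"
  assume \<sigma>: "0 < \<sigma>" and u0: "I_in_H1 \<sigma> u0" and sol: "local_solution c1 c2 \<sigma> u0 \<delta> u"
  let ?M = "H1_norm (I_op \<sigma> u0)"
  \<comment> \<open>The bound by twice the initial norm is the source of the constant: its cube
    yields \<open>C = 8\<close>, a witness that \<open>exI\<close> leaves open until the final
    estimate.\<close>
  interpret bbm \<sigma> \<delta> "2 * ?M" u
    using \<sigma> sol by unfold_locales (auto simp: local_solution_def BBM_solution_def H1_norm_def)
  \<comment> \<open>\<open>u 0\<close> agrees with \<open>u0\<close> only almost everywhere, but the
    representatives chosen by \<open>I_op\<close> coincide.\<close>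
  have "I_op \<sigma> (u 0) = I_op \<sigma> u0"
    using sol \<delta> by (intro I_op_cong_AE I u0) (auto simp: local_solution_def BBM_solution_def)
  then have "(H1_norm (I_op \<sigma> (u t)))\<^sup>2 \<le> ?M\<^sup>2 + 8 * \<delta> * \<sigma> powr (3/2) * ?M ^ 3" if "t \<in> {0..\<delta>}" for t
    using energy_growth[OF that] by (simp add: power_mult_distrib mult_ac)
  then show "(SUP t\<in>{0..\<delta>}. (H1_norm (I_op \<sigma> (u t)))\<^sup>2) \<le> ?M\<^sup>2 + 8 * \<delta> * \<sigma> powr (3/2) * ?M ^ 3"
    using \<delta> by (intro cSUP_least) auto
qed simp

end
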